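(* Let $\mathbb{K}$ be a field, let $S=\{\sigma_0<\sigma_1<\cdots<\sigma_N\}$ be a finite totally ordered set and let $\mathfrak{b}$ be a set of bonds on $S$. Then the discrete LS algebra $A$ over $(S,\leq,\mathfrak{b})$ (with base field $\mathbb{K}$) is a normal domain. In particular $A$ is the homogeneous coordinate ring of an irreducible projective $N$-dimensional (normal) toric variety.
   Context: Bonds: a set of bonds $\mathfrak{b}$ on the totally ordered set $S=\{\sigma_0<\cdots<\sigma_N\}$ is a choice of a positive integer $\mathfrak{b}(\sigma_i,\sigma_{i+1})$ for each $i=0,\ldots,N-1$. It is extended to all pairs $\sigma_i<\sigma_j$ by $\mathfrak{b}(\sigma_i,\sigma_j)=\gcd_{i\leq k\leq j-1}\mathfrak{b}(\sigma_k,\sigma_{k+1})$. LS-paths: a function $\pi:S\to\mathbb{Q}$ is an LS-path of degree $r\in\mathbb{N}=\{0,1,2,\ldots\}$ if (1) $\pi(\sigma)\geq 0$ for all $\sigma\in S$, and (2) if $\mathrm{supp}\,\pi=\{\sigma\in S\mid \pi(\sigma)\neq 0\}=\{\tau_1<\cdots<\tau_n\}$, then $\mathfrak{b}(\tau_j,\tau_{j+1})\sum_{i=1}^j\pi(\tau_i)\in\mathbb{N}$ for $j=1,\ldots,n-1$ and $\sum_{i=1}^n\pi(\tau_i)=r$. The sum $\pi\dotplus\pi'$ of two LS-paths as functions on $S$ is again an LS-path, of degree $\deg\pi+\deg\pi'$. Standard monomials: a formal commutative monomial $\pi_1\cdots\pi_r$ of degree $1$ LS-paths is standard if (up to reordering)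 $\max\mathrm{supp}\,\pi_h\leq\min\mathrm{supp}\,\pi_{h+1}$ for $h=1,\ldots,r-1$. Every LS-path $\pi$ of degree $r$ can be written uniquely as $\pi=\pi_{0,1}\dotplus\cdots\dotplus\pi_{0,r}$ with $\pi_{0,1}\cdots\pi_{0,r}$ a standard monomial of degree $1$ LS-paths; this is the canonical form of $\pi$, and of any monomial $\pi_1\cdots\pi_r$ of degree $1$ LS-paths with $\pi_1\dotplus\cdots\dotplus\pi_r=\pi$. Discrete LS algebra over $(S,\leq,\mathfrak{b})$ ($S$ totally ordered): the commutative graded $\mathbb{K}$-algebra having the set of all LS-paths as $\mathbb{K}$-basis, graded by the degree of LS-paths, in which an LS-path with canonical form $\pi_{0,1}\dotplus\cdots\dotplus\pi_{0,r}$ equals the product $\pi_{0,1}\cdots\pi_{0,r}$, and in which for every non-standard monomial $\pi_1\pi_2$ of degree $1$ LS-paths one has $\pi_1\pi_2=\pi_{0,1}\pi_{0,2}$, where $\pi_{0,1}\pi_{0,2}$ is the canonical form of $\pi_1\pi_2$. Equivalently the product of two basis elements $\pi,\pi'$ is $\pi\dotplus\pi'$. It is generated by its degree $1$ part. *)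

theory Defs
  imports
    "HOL-Algebra.Algebra"
    "HOL-Algebra.Algebraic_Closure_Type"
    "HOL-Library.Poly_Mapping"
    "HOL-Library.Extended_Nat"
begin

section \<open>Bonds, LS-paths and the discrete LS algebra\<close>

definition succ_in :: "'s::linorder set \<Rightarrow> 's \<Rightarrow> 's \<Rightarrow> bool" where
  "succ_in T x y \<longleftrightarrow> x \<in> T \<and> y \<in> T \<and> x < y \<and> \<not> (\<exists>z\<in>T. x < z \<and> z < y)"

text \<open>Only the values of \<open>b\<close> on pairs of consecutive elements of \<open>S\<close> are meaningful.\<close>

definition bonds :: "'s::linorder set \<Rightarrow> ('s \<Rightarrow> 's \<Rightarrow> nat) \<Rightarrow> bool" where
  "bonds S b \<longleftrightarrow> (\<forall>x y. succ_in S x y \<longrightarrow> b x y > 0)"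

definition bond :: "'s::linorder set \<Rightarrow> ('s \<Rightarrow> 's \<Rightarrow> nat) \<Rightarrow> 's \<Rightarrow> 's \<Rightarrow> nat" where
  "bond S b x y = Gcd {b s t | s t. succ_in S s t \<and> x \<le> s \<and> t \<le> y}"

text \<open>
  A function on the finite set \<open>S\<close> is represented by its extension by zero, so that
  \<^term>\<open>Poly_Mapping.keys \<pi>\<close> is the support of \<open>\<pi>\<close> and the sum of LS-paths
  is the addition of the type.
\<close>

definition ls_path ::
  "'s::linorder set \<Rightarrow> ('s \<Rightarrow> 's \<Rightarrow> nat) \<Rightarrow> nat \<Rightarrow> ('s \<Rightarrow>\<^sub>0 rat) \<Rightarrow> bool" where
  "ls_path S b r \<pi> \<longleftrightarrow>
     Poly_Mapping.keys \<pi> \<subseteq> S \<and>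
     (\<forall>\<sigma>. Poly_Mapping.lookup \<pi> \<sigma> \<ge> 0) \<and>
     (\<forall>\<tau> \<tau>'. succ_in (Poly_Mapping.keys \<pi>) \<tau> \<tau>' \<longrightarrow>
        of_nat (bond S b \<tau> \<tau>') *
          (\<Sum>\<sigma>\<in>{\<sigma> \<in> Poly_Mapping.keys \<pi>. \<sigma> \<le> \<tau>}. Poly_Mapping.lookup \<pi> \<sigma>) \<in> \<nat>) \<and>
     (\<Sum>\<sigma>\<in>Poly_Mapping.keys \<pi>. Poly_Mapping.lookup \<pi> \<sigma>) = of_nat r"

text \<open>
  Finitely supported functions from LS-paths to the base field. Multiplication of the type is
  convolution, hence the product of the basis elements \<open>\<pi>\<close> and \<open>\<pi>'\<close> is \<open>\<pi> + \<pi>'\<close>.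
\<close>

definition ls_algebra ::
  "'s::linorder set \<Rightarrow> ('s \<Rightarrow> 's \<Rightarrow> nat) \<Rightarrow> (('s \<Rightarrow>\<^sub>0 rat) \<Rightarrow>\<^sub>0 'k::field) ring" where
  "ls_algebra S b =
     \<lparr>carrier = {f. Poly_Mapping.keys f \<subseteq> {\<pi>. \<exists>r. ls_path S b r \<pi>}},
      monoid.mult = (*), one = 1, ring.zero = 0, add = (+)\<rparr>"

definition ls_component ::
  "'s::linorder set \<Rightarrow> ('s \<Rightarrow> 's \<Rightarrow> nat) \<Rightarrow> nat \<Rightarrow> (('s \<Rightarrow>\<^sub>0 rat) \<Rightarrow>\<^sub>0 'k::field) set" where
  "ls_component S b r = {f. Poly_Mapping.keys f \<subseteq> {\<pi>. ls_path S b r \<pi>}}"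

definition ls_scalar :: "'k::field \<Rightarrow> (('s \<Rightarrow>\<^sub>0 rat) \<Rightarrow>\<^sub>0 'k)" where
  "ls_scalar c = Poly_Mapping.single 0 c"


section \<open>Normal domains\<close>

definition fraction_rel :: "('a, 'm) ring_scheme \<Rightarrow> (('a \<times> 'a) \<times> ('a \<times> 'a)) set" where
  "fraction_rel R =
     {((a, b), (c, d)) | a b c d.
        a \<in> carrier R \<and> b \<in> carrier R - {\<zero>\<^bsub>R\<^esub>} \<and>
        c \<in> carrier R \<and> d \<in> carrier R - {\<zero>\<^bsub>R\<^esub>} \<and> a \<otimes>\<^bsub>R\<^esub> d = c \<otimes>\<^bsub>R\<^esub> b}"

definition fraction :: "('a, 'm) ring_scheme \<Rightarrow> 'a \<Rightarrow> 'a \<Rightarrow> ('a \<times> 'a) set" where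
  "fraction R a b = fraction_rel R `` {(a, b)}"

text \<open>
  The unions defining the operations run over equal equivalence classes when \<open>R\<close> is a domain.
\<close>

definition fraction_field :: "('a, 'm) ring_scheme \<Rightarrow> ('a \<times> 'a) set ring" where
  "fraction_field R =
     \<lparr>carrier = {fraction R a b | a b. a \<in> carrier R \<and> b \<in> carrier R - {\<zero>\<^bsub>R\<^esub>}},
      monoid.mult = (\<lambda>x y. \<Union>(a, b)\<in>x. \<Union>(c, d)\<in>y. fraction R (a \<otimes>\<^bsub>R\<^esub> c) (b \<otimes>\<^bsub>R\<^esub> d)),
      one = fraction R \<one>\<^bsub>R\<^esub> \<one>\<^bsub>R\<^esub>,
      ring.zero = fraction R \<zero>\<^bsub>R\<^esub> \<one>\<^bsub>R\<^esub>,
      add = (\<lambda>x y. \<Union>(a, b)\<in>x. \<Union>(c, d)\<in>y.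
               fraction R ((a \<otimes>\<^bsub>R\<^esub> d) \<oplus>\<^bsub>R\<^esub> (c \<otimes>\<^bsub>R\<^esub> b)) (b \<otimes>\<^bsub>R\<^esub> d))\<rparr>"

text \<open>Polynomials are coefficient lists with the leading coefficient first.\<close>

definition integral_over :: "('a, 'm) ring_scheme \<Rightarrow> 'a set \<Rightarrow> 'a \<Rightarrow> bool" where
  "integral_over F R x \<longleftrightarrow>
     (\<exists>p. polynomial\<^bsub>F\<^esub> R p \<and> p \<noteq> [] \<and> hd p = \<one>\<^bsub>F\<^esub> \<and> ring.eval F p x = \<zero>\<^bsub>F\<^esub>)"

definition normal_domain :: "('a, 'm) ring_scheme \<Rightarrow> bool" where
  "normal_domain R \<longleftrightarrow> domain R \<and>
     (let R' = (\<lambda>a. fraction R a \<one>\<^bsub>R\<^esub>) ` carrier R in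
      \<forall>x \<in> carrier (fraction_field R). integral_over (fraction_field R) R' x \<longrightarrow> x \<in> R')"


section \<open>Polynomials and projective space\<close>

text \<open>
  A polynomial is a finitely supported function on exponent vectors, its variables being indexed
  by natural numbers. The argument \<open>h\<close> of an evaluation is the embedding of the coefficient field
  into the field containing the coordinates of the points.
\<close>

type_synonym 'c mpoly = "(nat \<Rightarrow>\<^sub>0 nat) \<Rightarrow>\<^sub>0 'c"

definition mpoly_ring :: "nat \<Rightarrow> 'c::field mpoly ring" where
  "mpoly_ring m =
     \<lparr>carrier = {p. \<forall>u\<in>Poly_Mapping.keys p. Poly_Mapping.keys u \<subseteq> {..m}},
      monoid.mult = (*), one = 1, ring.zero = 0, add = (+)\<rparr>"

definition form :: "nat \<Rightarrow> nat \<Rightarrow> 'c::field mpoly \<Rightarrow> bool" where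
  "form m d p \<longleftrightarrow> (\<forall>u\<in>Poly_Mapping.keys p.
     Poly_Mapping.keys u \<subseteq> {..m} \<and> (\<Sum>i\<le>m. Poly_Mapping.lookup u i) = d)"

definition peval :: "('c::field \<Rightarrow> 'l::field) \<Rightarrow> 'c mpoly \<Rightarrow> (nat \<Rightarrow> 'l) \<Rightarrow> 'l" where
  "peval h p x = (\<Sum>u\<in>Poly_Mapping.keys p. h (Poly_Mapping.lookup p u) *
     (\<Prod>i\<in>Poly_Mapping.keys u. x i ^ Poly_Mapping.lookup u i))"

text \<open>
  A point of projective \<open>m\<close>-space is the set of all its vectors of homogeneous coordinates;
  these are indexed by \<open>0, \<dots>, m\<close> and extended by zero.
\<close>

type_synonym 'l ppoint = "(nat \<Rightarrow> 'l) set"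

definition proj_space :: "nat \<Rightarrow> 'l::field ppoint set" where
  "proj_space m = {{(\<lambda>i. c * x i) | c. c \<noteq> 0} | x. (\<forall>i>m. x i = 0) \<and> (\<exists>i\<le>m. x i \<noteq> 0)}"

definition vanishes_at :: "('c::field \<Rightarrow> 'l::field) \<Rightarrow> 'c mpoly \<Rightarrow> 'l ppoint \<Rightarrow> bool" where
  "vanishes_at h p P \<longleftrightarrow> (\<forall>x\<in>P. peval h p x = 0)"

definition zariski_closed :: "nat \<Rightarrow> 'l::field ppoint set \<Rightarrow> bool" where
  "zariski_closed m Z \<longleftrightarrow>
     (\<exists>F \<subseteq> {p. \<exists>d. form m d p}. Z = {P \<in> proj_space m. \<forall>p\<in>F. vanishes_at id p P})"

definition irreducible_closed :: "nat \<Rightarrow> 'l::field ppoint set \<Rightarrow> bool" where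
  "irreducible_closed m Z \<longleftrightarrow> zariski_closed m Z \<and> Z \<noteq> {} \<and>
     (\<forall>Z1 Z2. zariski_closed m Z1 \<longrightarrow> zariski_closed m Z2 \<longrightarrow> Z = Z1 \<union> Z2 \<longrightarrow> Z = Z1 \<or> Z = Z2)"

definition zariski_dim :: "nat \<Rightarrow> 'l::field ppoint set \<Rightarrow> enat" where
  "zariski_dim m V = (SUP l \<in> {l. \<exists>Z :: nat \<Rightarrow> 'l ppoint set.
     (\<forall>i\<le>l. irreducible_closed m (Z i) \<and> Z i \<subseteq> V) \<and> (\<forall>i<l. Z i \<subset> Z (Suc i))}. enat l)"

definition vanishing_ideal ::
  "('c::field \<Rightarrow> 'l::field) \<Rightarrow> nat \<Rightarrow> 'l ppoint set \<Rightarrow> 'c mpoly set" where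
  "vanishing_ideal h m V = {p \<in> carrier (mpoly_ring m). \<forall>P\<in>V. vanishes_at h p P}"

definition coordinate_ring ::
  "('c::field \<Rightarrow> 'l::field) \<Rightarrow> nat \<Rightarrow> 'l ppoint set \<Rightarrow> 'c mpoly set ring" where
  "coordinate_ring h m V = mpoly_ring m Quot vanishing_ideal h m V"

definition residue_class ::
  "('c::field \<Rightarrow> 'l::field) \<Rightarrow> nat \<Rightarrow> 'l ppoint set \<Rightarrow> 'c mpoly \<Rightarrow> 'c mpoly set" where
  "residue_class h m V p = vanishing_ideal h m V +>\<^bsub>mpoly_ring m\<^esub> p"

text \<open>
  The local ring at \<open>P\<close> is the homogeneous localization of the coordinate ring at the
  homogeneous prime ideal of \<open>P\<close>, as a subring of the field of fractions.
\<close>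

definition local_ring ::
  "nat \<Rightarrow> 'l::field ppoint set \<Rightarrow> 'l ppoint \<Rightarrow> ('l mpoly set \<times> 'l mpoly set) set ring" where
  "local_ring m V P =
     fraction_field (coordinate_ring id m V)
       \<lparr>carrier := {fraction (coordinate_ring id m V) (residue_class id m V f) (residue_class id m V g)
                    | f g d. form m d f \<and> form m d g \<and> \<not> vanishes_at id g P}\<rparr>"

definition normal_variety :: "nat \<Rightarrow> 'l::field ppoint set \<Rightarrow> bool" where
  "normal_variety m V \<longleftrightarrow> (\<forall>P\<in>V. normal_domain (local_ring m V P))"


section \<open>Projective varieties over an arbitrary field\<close>

text \<open>
  A variety over the field \<open>K\<close> is given by its points over the algebraic closure of \<open>K\<close>.
  Closedness, irreducibility, dimension and normality refer to the algebraic closure, and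
  the structure over \<open>K\<close> is recorded by requiring the vanishing ideal to be generated by
  polynomials over \<open>K\<close>.
\<close>

definition irreducible_projective_variety ::
  "nat \<Rightarrow> 'k::field alg_closure ppoint set \<Rightarrow> bool" where
  "irreducible_projective_variety m V \<longleftrightarrow> irreducible_closed m V \<and>
     vanishing_ideal id m V =
       Idl\<^bsub>mpoly_ring m\<^esub> (Poly_Mapping.map to_ac ` (vanishing_ideal to_ac m V :: 'k mpoly set))"

text \<open>
  The following two notions are relative to \<open>K\<close>: the maps are given, locally for the Zariski
  topology, by forms of equal (bi)degree with coefficients in \<open>K\<close>.
\<close>

definition regular_map ::
  "nat \<Rightarrow> 'k::field alg_closure ppoint set \<Rightarrow> nat \<Rightarrow>
   ('k alg_closure ppoint \<Rightarrow> 'k alg_closure ppoint) \<Rightarrow> bool" where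
  "regular_map n Y m f \<longleftrightarrow> f ` Y \<subseteq> proj_space m \<and>
     (\<forall>P\<in>Y. \<exists>d. \<exists>F :: nat \<Rightarrow> 'k mpoly. (\<forall>i\<le>m. form n d (F i)) \<and>
        (\<exists>i\<le>m. \<not> vanishes_at to_ac (F i) P) \<and>
        (\<forall>Q\<in>Y. (\<exists>i\<le>m. \<not> vanishes_at to_ac (F i) Q) \<longrightarrow>
           (\<forall>x\<in>Q. (\<lambda>i. if i \<le> m then peval to_ac (F i) x else 0) \<in> f Q)))"

text \<open>
  In a form in two groups of variables, the indices \<open>0, \<dots>, n\<close> make up the first group
  and \<open>n + 1, \<dots>, n + 1 + m\<close> the second.
\<close>

definition biform :: "nat \<Rightarrow> nat \<Rightarrow> nat \<Rightarrow> nat \<Rightarrow> 'c::field mpoly \<Rightarrow> bool" where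
  "biform n m d e p \<longleftrightarrow> (\<forall>u\<in>Poly_Mapping.keys p. Poly_Mapping.keys u \<subseteq> {..n + 1 + m} \<and>
     (\<Sum>i\<le>n. Poly_Mapping.lookup u i) = d \<and> (\<Sum>j\<le>m. Poly_Mapping.lookup u (n + 1 + j)) = e)"

definition join_coords :: "nat \<Rightarrow> (nat \<Rightarrow> 'l) \<Rightarrow> (nat \<Rightarrow> 'l) \<Rightarrow> nat \<Rightarrow> 'l" where
  "join_coords n x y = (\<lambda>i. if i \<le> n then x i else y (i - (n + 1)))"

definition regular_map2 ::
  "nat \<Rightarrow> 'k::field alg_closure ppoint set \<Rightarrow> nat \<Rightarrow> 'k alg_closure ppoint set \<Rightarrow> nat \<Rightarrow>
   ('k alg_closure ppoint \<Rightarrow> 'k alg_closure ppoint \<Rightarrow> 'k alg_closure ppoint) \<Rightarrow> bool" where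
  "regular_map2 n Y m V l f \<longleftrightarrow> (\<forall>P\<in>Y. \<forall>Q\<in>V. f P Q \<in> proj_space l) \<and>
     (\<forall>P\<in>Y. \<forall>Q\<in>V. \<exists>d e. \<exists>F :: nat \<Rightarrow> 'k mpoly. (\<forall>i\<le>l. biform n m d e (F i)) \<and>
        (\<exists>i\<le>l. \<exists>x\<in>P. \<exists>y\<in>Q. peval to_ac (F i) (join_coords n x y) \<noteq> 0) \<and>
        (\<forall>P'\<in>Y. \<forall>Q'\<in>V. \<forall>x\<in>P'. \<forall>y\<in>Q'.
           (\<exists>i\<le>l. peval to_ac (F i) (join_coords n x y) \<noteq> 0) \<longrightarrow>
           (\<lambda>i. if i \<le> l then peval to_ac (F i) (join_coords n x y) else 0) \<in> f P' Q'))"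

text \<open>
  The split torus of dimension \<open>n\<close> is the complement of the coordinate hyperplanes in
  projective \<open>n\<close>-space, with coordinatewise multiplication; the quotients
  \<open>x\<^sub>i / x\<^sub>0\<close> for \<open>1 \<le> i \<le> n\<close> identify it with the \<open>n\<close>-fold product
  of the multiplicative group.
\<close>

definition torus :: "nat \<Rightarrow> 'l::field ppoint set" where
  "torus n = {P \<in> proj_space n. \<forall>x\<in>P. \<forall>i\<le>n. x i \<noteq> 0}"

definition torus_mult :: "'l::field ppoint \<Rightarrow> 'l ppoint \<Rightarrow> 'l ppoint" where
  "torus_mult P Q = {(\<lambda>i. x i * y i) | x y. x \<in> P \<and> y \<in> Q}"

definition torus_one :: "nat \<Rightarrow> 'l::field ppoint" where
  "torus_one n = {(\<lambda>i. if i \<le> n then c else 0) | c. c \<noteq> 0}"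

text \<open>
  A variety containing a torus as an open subset (which is dense by irreducibility) such that
  the action of the torus on itself extends to the variety.
\<close>

definition projective_toric_variety ::
  "nat \<Rightarrow> 'k::field alg_closure ppoint set \<Rightarrow> bool" where
  "projective_toric_variety m V \<longleftrightarrow> irreducible_projective_variety m V \<and>
     (\<exists>n \<phi> \<alpha>.
        regular_map n (torus n) m \<phi> \<and> \<phi> ` torus n \<subseteq> V \<and> inj_on \<phi> (torus n) \<and>
        regular_map m (\<phi> ` torus n) n (the_inv_into (torus n) \<phi>) \<and>
        (\<exists>Z. zariski_closed m Z \<and> \<phi> ` torus n = V - Z) \<and>
        regular_map2 n (torus n) m V m \<alpha> \<and>
        (\<forall>t\<in>torus n. \<forall>Q\<in>V. \<alpha> t Q \<in> V) \<and>
        (\<forall>Q\<in>V. \<alpha> (torus_one n) Q = Q) \<and>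
        (\<forall>s\<in>torus n. \<forall>t\<in>torus n. \<forall>Q\<in>V. \<alpha> (torus_mult s t) Q = \<alpha> s (\<alpha> t Q)) \<and>
        (\<forall>s\<in>torus n. \<forall>t\<in>torus n. \<alpha> s (\<phi> t) = \<phi> (torus_mult s t)))"

text \<open>
  The graded algebra over \<open>K\<close> with ring \<open>A\<close>, components \<open>gr\<close> and structure map \<open>scal\<close>
  is isomorphic to the homogeneous coordinate ring over \<open>K\<close> of \<open>V\<close>.
\<close>

definition is_homogeneous_coordinate_ring ::
  "'a ring \<Rightarrow> (nat \<Rightarrow> 'a set) \<Rightarrow> ('k::field \<Rightarrow> 'a) \<Rightarrow> nat \<Rightarrow> 'k alg_closure ppoint set \<Rightarrow> bool" where
  "is_homogeneous_coordinate_ring A gr scal m V \<longleftrightarrow>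
     (\<exists>h \<in> ring_iso (coordinate_ring to_ac m V) A.
        (\<forall>c. h (residue_class to_ac m V (Poly_Mapping.single 0 c)) = scal c) \<and>
        (\<forall>d. h ` (residue_class to_ac m V ` {p. form m d p}) = gr d))"

end

theory Submission
  imports Defs "HOL-Computational_Algebra.Fraction_Field"
begin

text \<open>
  An LS-path is determined by its partial sums. Multiplied by the bonds, the partial sums become
  integers, and the support condition in the definition of LS-paths turns into one integrality
  condition for each pair of neighbours in \<open>S\<close>. Hence the LS-paths form the monoid \<open>M\<close> of all
  lattice points \<open>t\<close> with \<open>0 \<le> t\<^sub>N / \<beta>\<^sub>N \<le> \<dots> \<le> t\<^sub>1 / \<beta>\<^sub>1 \<le> t\<^sub>0\<close>, the cone over a
  lattice simplex, where \<open>t\<^sub>0\<close> is the degree, and the discrete LS algebra is the monoid algebra of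
  \<open>M\<close>. It is normal because \<open>M\<close> is saturated: if \<open>f / g\<close> is almost integral over the algebra, so
  is its leading monomial, which therefore lies in \<open>M\<close> and can be subtracted; this terminates
  because the monomial order compares degrees first and each degree has finitely many elements
  (\<open>completely_integrally_closed\<close>).

  Cutting the simplex at height one shows that \<open>M\<close> is generated in degree one
  (\<open>Mdeg_Suc_decompose\<close>). The elements of degree one therefore give a surjection \<open>theta\<close> from a
  polynomial ring onto the monoid algebra, whose kernel is spanned by differences of monomials, and
  the variety \<open>V\<close> is cut out by these. Conversely every polynomial vanishing on \<open>V\<close> lies in the kernel,
  since its values on the torus of \<open>V\<close> give a linear relation between distinct characters, which
  are linearly independent (\<open>vanishing_ideal_face_variety\<close>). This identifies the homogeneous coordinate
  ring of \<open>V\<close> over the base field with the LS algebra, and the one over the algebraic closure with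
  the corresponding monoid algebra. As the latter is a domain, \<open>V\<close> is irreducible; its ideal is generated
  by binomials, hence defined over the base field.

  For the dimension, the faces of the simplex in a flag give a chain of \<open>N + 1\<close> irreducible closed
  subsets. A longer chain would yield \<open>N + 2\<close> algebraically independent forms of equal degree on
  its largest member, and the number of their monomials would exceed the number of lattice points in
  multiples of the simplex, which grows only like the \<open>N\<close>-th power (\<open>no_long_chain\<close>). The torus
  embeds because the neighbours of the vertices along the edges of the flag, taken relative to these
  vertices, form a basis of the lattice of degree zero; it is the locus where the coordinates of all
  vertices are nonzero. The local rings of \<open>V\<close> are homogeneous localizations of the monoid algebra and inherit
  its normality by clearing denominators (\<open>local_values_integrally_closed\<close>).
\<close>


abbreviation keys :: "('a \<Rightarrow>\<^sub>0 'b::zero) \<Rightarrow> 'a set" where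
  "keys \<equiv> Poly_Mapping.keys"

abbreviation lookup :: "('a \<Rightarrow>\<^sub>0 'b::zero) \<Rightarrow> 'a \<Rightarrow> 'b" where
  "lookup \<equiv> Poly_Mapping.lookup"

abbreviation single :: "'a \<Rightarrow> 'b \<Rightarrow> 'a \<Rightarrow>\<^sub>0 'b::zero" where
  "single \<equiv> Poly_Mapping.single"

abbreviation set_ring :: "'a::comm_ring_1 set \<Rightarrow> 'a ring" where
  "set_ring C \<equiv> \<lparr>carrier = C, monoid.mult = (*), one = 1, ring.zero = 0, add = (+)\<rparr>"



section \<open>Evaluation of monoid algebras\<close>

text \<open>
  For a ring homomorphism \<open>h\<close> and a multiplicative \<open>\<chi>\<close>, this is the algebra homomorphism that
  maps scalars by \<open>h\<close> and monomials by \<open>\<chi>\<close>. It serves for evaluating polynomials at points, for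
  maps between monoid algebras, and for evaluating elements of a monoid algebra.
\<close>

definition mon_eval :: "('c::zero \<Rightarrow> 'd) \<Rightarrow> ('m \<Rightarrow> 'd) \<Rightarrow> ('m \<Rightarrow>\<^sub>0 'c) \<Rightarrow> 'd::comm_semiring_1" where
  "mon_eval h \<chi> f = (\<Sum>u\<in>keys f. h (lookup f u) * \<chi> u)"

locale semiring_map =
  fixes h :: "'c::comm_semiring_1 \<Rightarrow> 'd::comm_semiring_1"
  assumes map_zero [simp]: "h 0 = 0"
    and map_one [simp]: "h 1 = 1"
    and map_add: "h (x + y) = h x + h y"
    and map_mult: "h (x * y) = h x * h y"
begin

lemma mon_eval_superset:
  assumes "finite U" "keys f \<subseteq> U"
  shows "mon_eval h \<chi> f = (\<Sum>u\<in>U. h (lookup f u) * \<chi> u)"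
  unfolding mon_eval_def
  by (rule sum.mono_neutral_left) (use assms in \<open>auto simp: in_keys_iff\<close>)

lemma mon_eval_zero [simp]: "mon_eval h \<chi> 0 = 0"
  by (simp add: mon_eval_def)

lemma mon_eval_single: "mon_eval h \<chi> (single u c) = h c * \<chi> u"
  by (subst mon_eval_superset[of "{u}"]) auto

lemma mon_eval_one: "mon_eval h \<chi> 1 = \<chi> 0"
  using mon_eval_single[of \<chi> 0 1] by simp

lemma mon_eval_add: "mon_eval h \<chi> (f + g) = mon_eval h \<chi> f + mon_eval h \<chi> g"
proof -
  let ?U = "keys f \<union> keys g"
  have "finite ?U" "keys (f + g) \<subseteq> ?U"
    using Poly_Mapping.keys_add[of f g] by auto
  then show ?thesis
    by (subst (1 2 3) mon_eval_superset[of ?U])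
      (auto simp: lookup_add map_add distrib_right sum.distrib)
qed

lemma mon_eval_sum: "mon_eval h \<chi> (sum f A) = (\<Sum>a\<in>A. mon_eval h \<chi> (f a))"
  by (induction A rule: infinite_finite_induct) (auto simp: mon_eval_add)

end

lemma poly_mapping_expand:
  "f = (\<Sum>u\<in>keys f. single u (lookup f u))"
proof (rule poly_mapping_eqI)
  fix k
  have "(\<Sum>u\<in>keys f. lookup (single u (lookup f u)) k)
      = (\<Sum>u\<in>keys f. if u = k then lookup f u else 0)"
    by (rule sum.cong) (auto simp: lookup_single when_def)
  then show "lookup f k = lookup
    (\<Sum>u\<in>keys f. single u (lookup f u)) k"
    by (auto simp: lookup_sum sum.delta in_keys_iff)
qed

lemma poly_mapping_mult_expand:
  fixes f g :: "'m::comm_monoid_add \<Rightarrow>\<^sub>0 'c::comm_semiring_1"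
  shows "f * g = (\<Sum>u\<in>keys f. \<Sum>v\<in>keys g.
      single (u + v) (lookup f u * lookup g v))"
  by (subst poly_mapping_expand[of f], subst poly_mapping_expand[of g])
    (simp add: sum_product mult_single)

lemma (in semiring_map) mon_eval_mult:
  fixes f g :: "'m::comm_monoid_add \<Rightarrow>\<^sub>0 'c"
  assumes "\<And>u v. u \<in> keys f \<Longrightarrow> v \<in> keys g \<Longrightarrow> \<chi> (u + v) = \<chi> u * \<chi> v"
  shows "mon_eval h \<chi> (f * g) = mon_eval h \<chi> f * mon_eval h \<chi> g"
proof -
  have "mon_eval h \<chi> (f * g) = (\<Sum>u\<in>keys f. \<Sum>v\<in>keys g.
      h (lookup f u * lookup g v) * \<chi> (u + v))"
    by (subst poly_mapping_mult_expand) (simp add: mon_eval_sum mon_eval_single)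
  also have "\<dots> = (\<Sum>u\<in>keys f. \<Sum>v\<in>keys g.
      (h (lookup f u) * \<chi> u) * (h (lookup g v) * \<chi> v))"
    by (intro sum.cong refl) (simp add: assms map_mult algebra_simps)
  finally show ?thesis
    by (simp add: mon_eval_def sum_product)
qed

lemma semiring_map_single: "semiring_map (\<lambda>c::'c::comm_semiring_1. single (0::'m::comm_monoid_add) c)"
  by unfold_locales (auto simp: single_add mult_single)

lemma semiring_map_id: "semiring_map (id :: 'c::comm_semiring_1 \<Rightarrow> 'c)"
  by unfold_locales auto

lemma semiring_map_to_ac: "semiring_map (to_ac :: 'k::field \<Rightarrow> 'k alg_closure)"
  by unfold_locales auto

text \<open>
  Dedekind's independence of characters: if two characters differ at a point \<open>y\<close>, translating a
  relation by \<open>y\<close> and subtracting a multiple of the relation itself removes one character.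
\<close>

lemma characters_independent:
  fixes \<chi> :: "'m \<Rightarrow> 'x \<Rightarrow> 'l::field" and tr :: "'x \<Rightarrow> 'x \<Rightarrow> 'x"
  assumes "finite U"
    and D: "e \<in> D" "\<And>x y. x \<in> D \<Longrightarrow> y \<in> D \<Longrightarrow> tr x y \<in> D"
    and hom: "\<And>u x y. u \<in> U \<Longrightarrow> x \<in> D \<Longrightarrow> y \<in> D \<Longrightarrow> \<chi> u (tr x y) = \<chi> u x * \<chi> u y"
    and one: "\<And>u. u \<in> U \<Longrightarrow> \<chi> u e = 1"
    and sep: "\<And>u v. u \<in> U \<Longrightarrow> v \<in> U \<Longrightarrow> u \<noteq> v \<Longrightarrow> \<exists>y\<in>D. \<chi> u y \<noteq> \<chi> v y"
    and rel: "\<And>x. x \<in> D \<Longrightarrow> (\<Sum>u\<in>U. c u * \<chi> u x) = 0"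
    and "u \<in> U"
  shows "c u = 0"
  using assms(1) hom one sep rel \<open>u \<in> U\<close>
proof (induction U arbitrary: c u rule: finite_induct)
  case empty
  then show ?case by simp
next
  case (insert w U)
  have c0: "c v = 0" if v: "v \<in> U" for v
  proof -
    have "v \<noteq> w" using insert.hyps v by auto
    then obtain y where y: "y \<in> D" "\<chi> v y \<noteq> \<chi> w y"
      using insert.prems(3)[of v w] v by auto
    have "c v * (\<chi> v y - \<chi> w y) = 0"
    proof (rule insert.IH[of "\<lambda>v. c v * (\<chi> v y - \<chi> w y)"])
      fix x assume x: "x \<in> D"
      have "(\<Sum>u\<in>U. c u * (\<chi> u y - \<chi> w y) * \<chi> u x) =
            (\<Sum>u\<in>insert w U. c u * \<chi> u (tr y x)) - \<chi> w y * (\<Sum>u\<in>insert w U. c u * \<chi> u x)"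
        using insert.hyps insert.prems(1) x y
        by (simp add: algebra_simps sum_distrib_left flip: sum_subtractf)
      also have "\<dots> = 0"
        using insert.prems(4)[OF x] insert.prems(4)[OF D(2)[OF y(1) x]] by simp
      finally show "(\<Sum>u\<in>U. c u * (\<chi> u y - \<chi> w y) * \<chi> u x) = 0" .
    qed (use insert.prems v in auto)
    then show ?thesis using y by simp
  qed
  have "(\<Sum>u\<in>insert w U. c u * \<chi> u e) = 0"
    using insert.prems(4) D by blast
  moreover have "(\<Sum>u\<in>U. c u * \<chi> u e) = 0"
    by (rule sum.neutral) (simp add: c0)
  ultimately have "c w = 0"
    using insert.hyps insert.prems(2)[of w] by simp
  then show ?case using c0 insert.prems by auto
qed

text \<open>Over a finite field, one plus the product of all \<open>x - a\<close> has no root.\<close>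

lemma alg_closed_infinite: "infinite (UNIV :: 'l::alg_closed_field set)"
proof
  assume fin: "finite (UNIV :: 'l set)"
  define p :: "'l Polynomial.poly" where "p = (\<Prod>a\<in>UNIV. [:-a, 1:]) + 1"
  have "Polynomial.degree (\<Prod>a\<in>(UNIV::'l set). [:-a, 1:]) = card (UNIV :: 'l set)"
    by (subst Polynomial.degree_prod_sum_eq) auto
  moreover have "card (UNIV :: 'l set) > 0"
    using fin by (simp add: card_gt_0_iff)
  ultimately have "Polynomial.degree p > 0"
    unfolding p_def by (subst Polynomial.degree_add_eq_left) auto
  then obtain x where "Polynomial.poly p x = 0"
    using alg_closed_imp_poly_has_root by blast
  moreover have "(\<Prod>a\<in>(UNIV::'l set). x - a) = 0"
    using fin by (subst prod_zero_iff) auto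
  ultimately show False
    by (simp add: p_def Polynomial.poly_prod)
qed

lemma separating_scalar:
  assumes "a \<noteq> (b::nat)"
  shows "\<exists>s::'l::alg_closed_field. s \<noteq> 0 \<and> s ^ a \<noteq> s ^ b"
proof -
  define p :: "'l Polynomial.poly" where "p = Polynomial.monom 1 1 * (Polynomial.monom 1 a - Polynomial.monom 1 b)"
  have "Polynomial.monom (1::'l) a \<noteq> Polynomial.monom 1 b"
    using assms by (metis Polynomial.degree_monom_eq one_neq_zero)
  then have "p \<noteq> 0"
    by (auto simp: p_def)
  then have "finite {x. Polynomial.poly p x = 0}"
    by (rule Polynomial.poly_roots_finite)
  then obtain x where "Polynomial.poly p x \<noteq> 0"
    using alg_closed_infinite[where ?'l='l] by (metis (mono_tags, lifting) UNIV_I finite_subset mem_Collect_eq subsetI)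
  then show ?thesis
    by (intro exI[of _ x]) (auto simp: p_def Polynomial.poly_monom)
qed


section \<open>Rings embedded in a field\<close>

text \<open>
  The rings of the theorem are all records on different types. Each of them is studied through an
  injection into a type of class \<open>field\<close>, where the automation for fields is available.
\<close>

locale field_embedding =
  fixes R :: "('a, 'm) ring_scheme" (structure) and j :: "'a \<Rightarrow> 'f::field"
  assumes inj: "inj_on j (carrier R)"
    and one_closed: "\<one> \<in> carrier R"
    and zero_closed: "\<zero> \<in> carrier R"
    and add_closed: "a \<in> carrier R \<Longrightarrow> b \<in> carrier R \<Longrightarrow> a \<oplus> b \<in> carrier R"
    and mult_closed: "a \<in> carrier R \<Longrightarrow> b \<in> carrier R \<Longrightarrow> a \<otimes> b \<in> carrier R"
    and neg_closed: "a \<in> carrier R \<Longrightarrow> \<exists>b\<in>carrier R. j b = - j a"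
    and j_one: "j \<one> = 1"
    and j_zero: "j \<zero> = 0"
    and j_add: "a \<in> carrier R \<Longrightarrow> b \<in> carrier R \<Longrightarrow> j (a \<oplus> b) = j a + j b"
    and j_mult: "a \<in> carrier R \<Longrightarrow> b \<in> carrier R \<Longrightarrow> j (a \<otimes> b) = j a * j b"
begin

lemmas j_simps = one_closed zero_closed add_closed mult_closed j_one j_zero j_add j_mult

lemma j_eq_iff: "a \<in> carrier R \<Longrightarrow> b \<in> carrier R \<Longrightarrow> a = b \<longleftrightarrow> j a = j b"
  using inj by (auto simp: inj_on_def)

lemma j_eq_0_iff: "a \<in> carrier R \<Longrightarrow> j a = 0 \<longleftrightarrow> a = \<zero>"
  using j_eq_iff[of a \<zero>] by (simp add: j_simps)

lemma is_domain: "domain R"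
proof -
  have "cring R"
  proof (rule cringI)
    show "abelian_group R"
    proof (rule abelian_groupI)
      fix x assume x: "x \<in> carrier R"
      from neg_closed[OF x] obtain b where "b \<in> carrier R" "j b = - j x" by blast
      then show "\<exists>y\<in>carrier R. y \<oplus> x = \<zero>"
        using x by (intro bexI[of _ b]) (auto simp: j_simps j_eq_iff)
    qed (auto simp: j_simps j_eq_iff)
    show "comm_monoid R"
      by (rule comm_monoidI) (auto simp: j_simps j_eq_iff)
  qed (auto simp: j_simps j_eq_iff algebra_simps)
  then show ?thesis
    by (rule domain.intro) (unfold_locales, auto simp: j_simps j_eq_iff)
qed

text \<open>
  The fraction of \<open>a\<close> and \<open>b\<close> is the set of all pairs with quotient \<open>j a / j b\<close>, so any
  representative yields its value.
\<close>

definition quot_val :: "('a \<times> 'a) set \<Rightarrow> 'f" where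
  "quot_val Y = (case SOME ab. ab \<in> Y of (a, b) \<Rightarrow> j a / j b)"

lemma fraction_eq:
  assumes "a \<in> carrier R" "b \<in> carrier R - {\<zero>}"
  shows "fraction R a b = {(c, d). c \<in> carrier R \<and> d \<in> carrier R - {\<zero>} \<and> j c / j d = j a / j b}"
  using assms by (auto simp: fraction_def fraction_rel_def j_simps j_eq_iff field_simps)

lemma fraction_memI:
  assumes "a \<in> carrier R" "b \<in> carrier R - {\<zero>}"
  shows "(a, b) \<in> fraction R a b"
  using assms by (simp add: fraction_eq)

lemma quot_val_fraction:
  assumes "a \<in> carrier R" "b \<in> carrier R - {\<zero>}"
  shows "quot_val (fraction R a b) = j a / j b"
proof -
  have "(SOME ab. ab \<in> fraction R a b) \<in> fraction R a b"
    using fraction_memI[OF assms] by (rule someI)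
  then show ?thesis
    using assms by (auto simp: quot_val_def fraction_eq)
qed

lemma fraction_eq_iff:
  assumes "a \<in> carrier R" "b \<in> carrier R - {\<zero>}" "c \<in> carrier R" "d \<in> carrier R - {\<zero>}"
  shows "fraction R a b = fraction R c d \<longleftrightarrow> j a / j b = j c / j d"
  using assms quot_val_fraction[of a b] quot_val_fraction[of c d] by (auto simp: fraction_eq)

lemma carrier_fraction_field:
  "carrier (fraction_field R) = {fraction R a b | a b. a \<in> carrier R \<and> b \<in> carrier R - {\<zero>}}"
  by (simp add: fraction_field_def)

lemma nonzero_mult_closed:
  "x \<in> carrier R - {\<zero>} \<Longrightarrow> y \<in> carrier R - {\<zero>} \<Longrightarrow> x \<otimes> y \<in> carrier R - {\<zero>}"
  by (auto simp: j_simps j_eq_iff)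

lemma fraction_mult:
  assumes "a \<in> carrier R" "b \<in> carrier R - {\<zero>}" "c \<in> carrier R" "d \<in> carrier R - {\<zero>}"
  shows "fraction R a b \<otimes>\<^bsub>fraction_field R\<^esub> fraction R c d = fraction R (a \<otimes> c) (b \<otimes> d)"
proof -
  have "fraction R (a' \<otimes> c') (b' \<otimes> d') = fraction R (a \<otimes> c) (b \<otimes> d)"
    if "(a', b') \<in> fraction R a b" "(c', d') \<in> fraction R c d" for a' b' c' d'
  proof -
    have *: "a' \<in> carrier R" "b' \<in> carrier R - {\<zero>}" "c' \<in> carrier R" "d' \<in> carrier R - {\<zero>}"
      "j a' / j b' = j a / j b" "j c' / j d' = j c / j d"
      using that assms by (auto simp: fraction_eq)
    have val: "j (a \<otimes> c) / j (b \<otimes> d) = (j a / j b) * (j c / j d)"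
      if "a \<in> carrier R" "b \<in> carrier R - {\<zero>}" "c \<in> carrier R" "d \<in> carrier R - {\<zero>}" for a b c d
      using that by (simp add: j_simps)
    have "j (a' \<otimes> c') / j (b' \<otimes> d') = j (a \<otimes> c) / j (b \<otimes> d)"
      unfolding val[OF *(1-4)] val[OF assms] *(5,6) ..
    then show ?thesis
      using * assms nonzero_mult_closed[OF *(2,4)] nonzero_mult_closed[OF assms(2,4)]
      by (subst fraction_eq_iff) (auto intro!: mult_closed)
  qed
  moreover have "(a, b) \<in> fraction R a b" "(c, d) \<in> fraction R c d"
    using assms by (auto intro: fraction_memI)
  ultimately have "(\<Union>(a, b)\<in>fraction R a b. \<Union>(c, d)\<in>fraction R c d. fraction R (a \<otimes> c) (b \<otimes> d))
     = fraction R (a \<otimes> c) (b \<otimes> d)"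
    by fast
  then show ?thesis
    by (simp add: fraction_field_def)
qed

lemma fraction_add:
  assumes "a \<in> carrier R" "b \<in> carrier R - {\<zero>}" "c \<in> carrier R" "d \<in> carrier R - {\<zero>}"
  shows "fraction R a b \<oplus>\<^bsub>fraction_field R\<^esub> fraction R c d
    = fraction R ((a \<otimes> d) \<oplus> (c \<otimes> b)) (b \<otimes> d)"
proof -
  have val: "j ((a \<otimes> d) \<oplus> (c \<otimes> b)) / j (b \<otimes> d) = j a / j b + j c / j d"
    if "a \<in> carrier R" "b \<in> carrier R - {\<zero>}" "c \<in> carrier R" "d \<in> carrier R - {\<zero>}" for a b c d
    using that by (auto simp: j_simps j_eq_0_iff field_simps)
  have "fraction R ((a' \<otimes> d') \<oplus> (c' \<otimes> b')) (b' \<otimes> d') = fraction R ((a \<otimes> d) \<oplus> (c \<otimes> b)) (b \<otimes> d)"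
    if "(a', b') \<in> fraction R a b" "(c', d') \<in> fraction R c d" for a' b' c' d'
  proof -
    have *: "a' \<in> carrier R" "b' \<in> carrier R - {\<zero>}" "c' \<in> carrier R" "d' \<in> carrier R - {\<zero>}"
      "j a' / j b' = j a / j b" "j c' / j d' = j c / j d"
      using that assms by (auto simp: fraction_eq)
    have "j ((a' \<otimes> d') \<oplus> (c' \<otimes> b')) / j (b' \<otimes> d') = j ((a \<otimes> d) \<oplus> (c \<otimes> b)) / j (b \<otimes> d)"
      unfolding val[OF *(1-4)] val[OF assms] *(5,6) ..
    then show ?thesis
      using * assms nonzero_mult_closed[OF *(2,4)] nonzero_mult_closed[OF assms(2,4)]
      by (subst fraction_eq_iff) (auto intro!: mult_closed add_closed)
  qed
  moreover have "(a, b) \<in> fraction R a b" "(c, d) \<in> fraction R c d"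
    using assms by (auto intro: fraction_memI)
  ultimately have "(\<Union>(a, b)\<in>fraction R a b. \<Union>(c, d)\<in>fraction R c d.
      fraction R ((a \<otimes> d) \<oplus> (c \<otimes> b)) (b \<otimes> d)) = fraction R ((a \<otimes> d) \<oplus> (c \<otimes> b)) (b \<otimes> d)"
    by fast
  then show ?thesis
    by (simp add: fraction_field_def)
qed

lemma one_nonzero: "\<one> \<in> carrier R - {\<zero>}"
  by (auto simp: j_simps j_eq_iff)

lemma fraction_zero: "\<zero>\<^bsub>fraction_field R\<^esub> = fraction R \<zero> \<one>"
  and fraction_one: "\<one>\<^bsub>fraction_field R\<^esub> = fraction R \<one> \<one>"
  by (simp_all add: fraction_field_def)

lemma quot_val_add:
  assumes "x \<in> carrier (fraction_field R)" "y \<in> carrier (fraction_field R)"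
  shows "quot_val (x \<oplus>\<^bsub>fraction_field R\<^esub> y) = quot_val x + quot_val y"
    and "x \<oplus>\<^bsub>fraction_field R\<^esub> y \<in> carrier (fraction_field R)"
proof -
  obtain a b c d where *: "x = fraction R a b" "y = fraction R c d"
    "a \<in> carrier R" "b \<in> carrier R - {\<zero>}" "c \<in> carrier R" "d \<in> carrier R - {\<zero>}"
    using assms unfolding carrier_fraction_field by blast
  have nz: "b \<otimes> d \<in> carrier R - {\<zero>}" and cl: "(a \<otimes> d) \<oplus> (c \<otimes> b) \<in> carrier R"
    using * nonzero_mult_closed[of b d] by (auto intro!: mult_closed add_closed)
  show "quot_val (x \<oplus>\<^bsub>fraction_field R\<^esub> y) = quot_val x + quot_val y"
    using * by (auto simp: fraction_add quot_val_fraction[OF cl nz] quot_val_fraction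
        j_simps j_eq_0_iff field_simps)
  show "x \<oplus>\<^bsub>fraction_field R\<^esub> y \<in> carrier (fraction_field R)"
    using * nz cl by (auto simp: carrier_fraction_field fraction_add)
qed

lemma quot_val_mult:
  assumes "x \<in> carrier (fraction_field R)" "y \<in> carrier (fraction_field R)"
  shows "quot_val (x \<otimes>\<^bsub>fraction_field R\<^esub> y) = quot_val x * quot_val y"
    and "x \<otimes>\<^bsub>fraction_field R\<^esub> y \<in> carrier (fraction_field R)"
proof -
  obtain a b c d where *: "x = fraction R a b" "y = fraction R c d"
    "a \<in> carrier R" "b \<in> carrier R - {\<zero>}" "c \<in> carrier R" "d \<in> carrier R - {\<zero>}"
    using assms unfolding carrier_fraction_field by blast
  have nz: "b \<otimes> d \<in> carrier R - {\<zero>}" and cl: "a \<otimes> c \<in> carrier R"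
    using * nonzero_mult_closed[of b d] by (auto intro!: mult_closed add_closed)
  show "quot_val (x \<otimes>\<^bsub>fraction_field R\<^esub> y) = quot_val x * quot_val y"
    using * by (auto simp: fraction_mult quot_val_fraction[OF cl nz] quot_val_fraction
        j_simps j_eq_0_iff field_simps)
  show "x \<otimes>\<^bsub>fraction_field R\<^esub> y \<in> carrier (fraction_field R)"
    using * nz cl by (auto simp: carrier_fraction_field fraction_mult)
qed

text \<open>
  Fractions with equal values are equal. Hence the field of fractions is again embedded in the same
  field, and everything shown for the ring applies to it as well.
\<close>

lemma fraction_field_embedding: "field_embedding (fraction_field R) quot_val"
proof
  show "inj_on quot_val (carrier (fraction_field R))"
  proof (rule inj_onI)
    fix x y assume "x \<in> carrier (fraction_field R)" "y \<in> carrier (fraction_field R)"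
      and eq: "quot_val x = quot_val y"
    then obtain a b c d where *: "x = fraction R a b" "y = fraction R c d"
      "a \<in> carrier R" "b \<in> carrier R - {\<zero>}" "c \<in> carrier R" "d \<in> carrier R - {\<zero>}"
      unfolding carrier_fraction_field by blast
    then show "x = y"
      using eq fraction_eq_iff[OF *(3-6)] by (simp add: quot_val_fraction)
  qed
  show "\<one>\<^bsub>fraction_field R\<^esub> \<in> carrier (fraction_field R)"
    "\<zero>\<^bsub>fraction_field R\<^esub> \<in> carrier (fraction_field R)"
    using one_nonzero zero_closed by (auto simp: carrier_fraction_field fraction_zero fraction_one)
  show "quot_val \<one>\<^bsub>fraction_field R\<^esub> = 1" "quot_val \<zero>\<^bsub>fraction_field R\<^esub> = 0"
    using one_nonzero zero_closed
    by (auto simp: fraction_zero fraction_one quot_val_fraction j_simps)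
  fix x assume "x \<in> carrier (fraction_field R)"
  then obtain a b where ab: "x = fraction R a b" "a \<in> carrier R" "b \<in> carrier R - {\<zero>}"
    unfolding carrier_fraction_field by blast
  obtain a' where "a' \<in> carrier R" "j a' = - j a"
    using neg_closed ab by blast
  then show "\<exists>y\<in>carrier (fraction_field R). quot_val y = - quot_val x"
    using ab by (intro bexI[of _ "fraction R a' b"]) (auto simp: quot_val_fraction carrier_fraction_field)
qed (use quot_val_add quot_val_mult in auto)

end

definition integral_elem :: "'f::field set \<Rightarrow> 'f \<Rightarrow> bool" where
  "integral_elem C x \<longleftrightarrow> (\<exists>n c. (\<forall>i<n. c i \<in> C) \<and> x ^ n + (\<Sum>i<n. c i * x ^ i) = 0)"

lemma (in field_embedding) j_power:
  assumes "x \<in> carrier R"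
  shows "j (x [^] (n::nat)) = j x ^ n"
proof -
  interpret domain R by (rule is_domain)
  show ?thesis
    using assms by (induction n) (auto simp: j_simps)
qed

lemma (in field_embedding) j_eval:
  assumes "set p \<subseteq> carrier R" "x \<in> carrier R"
  shows "j (ring.eval R p x) = (\<Sum>i<length p. j (rev p ! i) * j x ^ i)"
proof -
  interpret domain R by (rule is_domain)
  show ?thesis
    using assms
  proof (induction p)
    case (Cons c p)
    have "j (eval (c # p) x) = j c * j x ^ length p + j (eval p x)"
      using Cons by (simp add: j_add j_mult j_power eval_in_carrier)
    then show ?case
      using Cons by (simp add: nth_append)
  qed (simp add: j_zero)
qed

text \<open>
  Taking values turns an integral equation in the field of fractions, whose elements are sets of
  pairs, into one in the given field.
\<close>

lemma (in field_embedding) normal_domainI: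
  assumes *: "\<And>a b. a \<in> carrier R \<Longrightarrow> b \<in> carrier R \<Longrightarrow> j b \<noteq> 0 \<Longrightarrow>
    integral_elem (j ` carrier R) (j a / j b) \<Longrightarrow> j a / j b \<in> j ` carrier R"
  shows "normal_domain R"
proof -
  interpret Q: field_embedding "fraction_field R" quot_val
    by (rule fraction_field_embedding)
  interpret Qd: domain "fraction_field R" by (rule Q.is_domain)
  define R' where "R' = (\<lambda>a. fraction R a \<one>) ` carrier R"
  have val: "quot_val (fraction R a \<one>) = j a" if "a \<in> carrier R" for a
    using that one_nonzero by (simp add: quot_val_fraction j_one)
  have sub: "R' \<subseteq> carrier (fraction_field R)"
    using one_nonzero by (auto simp: R'_def carrier_fraction_field)
  have "x \<in> R'" if x: "x \<in> carrier (fraction_field R)" and i: "integral_over (fraction_field R) R' x" for x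
  proof -
    obtain a b where ab: "x = fraction R a b" "a \<in> carrier R" "b \<in> carrier R - {\<zero>}"
      using x unfolding carrier_fraction_field by blast
    obtain p where p: "set p \<subseteq> R'" "p \<noteq> []" "hd p = \<one>\<^bsub>fraction_field R\<^esub>"
      "Qd.eval p x = \<zero>\<^bsub>fraction_field R\<^esub>"
      using i by (auto simp: integral_over_def polynomial_def)
    obtain q where q: "p = \<one>\<^bsub>fraction_field R\<^esub> # q"
      using p by (cases p) auto
    have "(\<Sum>i<length p. quot_val (rev p ! i) * quot_val x ^ i) = 0"
      using Q.j_eval[of p x] p sub x Q.j_zero by auto
    then have "quot_val x ^ length q + (\<Sum>i<length q. quot_val (rev q ! i) * quot_val x ^ i) = 0"
      by (simp add: q nth_append Q.j_one algebra_simps)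
    moreover have "quot_val (rev q ! i) \<in> j ` carrier R" if "i < length q" for i
    proof -
      have "rev q ! i \<in> set q"
        using that by (metis length_rev nth_mem set_rev)
      then have "rev q ! i \<in> R'"
        using p q by auto
      then show ?thesis
        using val by (auto simp: R'_def)
    qed
    ultimately have "integral_elem (j ` carrier R) (quot_val x)"
      unfolding integral_elem_def
      by (intro exI[of _ "length q"] exI[of _ "\<lambda>i. quot_val (rev q ! i)"]) auto
    then have "j a / j b \<in> j ` carrier R"
      using ab by (intro *) (auto simp: quot_val_fraction j_eq_0_iff)
    then obtain r where r: "r \<in> carrier R" "j a / j b = j r"
      by blast
    then have "x = fraction R r \<one>"
      using ab one_nonzero by (auto simp: fraction_eq_iff j_one)
    then show ?thesis
      using r by (auto simp: R'_def)
  qed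
  then show ?thesis
    using is_domain by (auto simp: normal_domain_def R'_def Let_def)
qed

section \<open>Normality of monoid algebras\<close>

definition monoid_algebra :: "'m set \<Rightarrow> ('m \<Rightarrow>\<^sub>0 'c::zero) set" where
  "monoid_algebra M = {f. keys f \<subseteq> M}"

definition lead :: "('m::linorder \<Rightarrow>\<^sub>0 'c::zero) \<Rightarrow> 'm" where
  "lead f = Max (keys f)"

lemma lead_in_keys: "f \<noteq> 0 \<Longrightarrow> lead f \<in> keys f"
  unfolding lead_def by (rule Max_in) auto

lemma le_lead: "u \<in> keys f \<Longrightarrow> u \<le> lead f"
  by (simp add: lead_def)

text \<open>Leading terms cannot cancel, since only one pair of exponents has the largest sum.\<close>

lemma lead_mult:
  fixes f g :: "'m::{ordered_cancel_comm_monoid_add, linorder} \<Rightarrow>\<^sub>0 'c::idom"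
  assumes "f \<noteq> 0" "g \<noteq> 0"
  shows "lookup (f * g) (lead f + lead g)
      = lookup f (lead f) * lookup g (lead g)"
    and "lead (f * g) = lead f + lead g"
proof -
  let ?l = "lookup" and ?k = "keys"
  have max: "u = lead f \<and> v = lead g" if "u \<in> ?k f" "v \<in> ?k g" "u + v = lead f + lead g" for u v
    using that le_lead[of u f] le_lead[of v g]
    by (metis add_less_le_mono add_le_less_mono order.not_eq_order_implies_strict order_less_irrefl)
  have "?l (f * g) (lead f + lead g) = (\<Sum>u\<in>?k f. \<Sum>v\<in>?k g.
      if u = lead f \<and> v = lead g then ?l f u * ?l g v else 0)"
    by (subst poly_mapping_mult_expand, unfold lookup_sum)
      (intro sum.cong refl, use max in \<open>auto simp: lookup_single when_def\<close>)
  also have "\<dots> = (\<Sum>u\<in>?k f. if u = lead f then ?l f u * ?l g (lead g) else 0)"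
  proof (intro sum.cong refl)
    fix u
    show "(\<Sum>v\<in>?k g. if u = lead f \<and> v = lead g then ?l f u * ?l g v else 0)
        = (if u = lead f then ?l f u * ?l g (lead g) else 0)"
      using lead_in_keys[OF assms(2)] by (cases "u = lead f") (auto simp: sum.delta')
  qed
  also have "\<dots> = ?l f (lead f) * ?l g (lead g)"
    using lead_in_keys[OF assms(1)] by (simp add: sum.delta')
  finally show *: "?l (f * g) (lead f + lead g) = ?l f (lead f) * ?l g (lead g)" .
  have "lead f + lead g \<in> ?k (f * g)"
    using assms lead_in_keys by (auto simp: in_keys_iff *)
  moreover have "w \<le> lead f + lead g" if "w \<in> ?k (f * g)" for w
    using that keys_mult[of f g] le_lead[of _ f] le_lead[of _ g] by (fastforce intro: add_mono)
  ultimately show "lead (f * g) = lead f + lead g"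
    unfolding lead_def by (intro Max_eqI) auto
qed

lemma lead_power:
  fixes f :: "'m::{ordered_cancel_comm_monoid_add, linorder} \<Rightarrow>\<^sub>0 'c::idom"
  assumes "f \<noteq> 0"
  shows "lead (f ^ k) = (\<Sum>i<k. lead f)"
proof (induction k)
  case 0
  have "keys (1 :: 'm \<Rightarrow>\<^sub>0 'c) = {0}" by simp
  then show ?case by (simp add: lead_def)
next
  case (Suc k)
  then show ?case
    using assms by (simp add: lead_mult add.commute)
qed

text \<open>
  The last assumption says that \<open>M\<close> is saturated in its group of differences, in a form that
  speaks of elements of \<open>M\<close> only. The one before it makes the monomial order a well-order on \<open>M\<close>.
\<close>

locale saturated_monoid =
  fixes M :: "'m::{ordered_cancel_comm_monoid_add, linorder} set"
  assumes zero_mem: "0 \<in> M"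
    and add_mem: "s \<in> M \<Longrightarrow> t \<in> M \<Longrightarrow> s + t \<in> M"
    and finite_below: "s \<in> M \<Longrightarrow> finite {t \<in> M. t \<le> s}"
    and saturated: "s \<in> M \<Longrightarrow> t \<in> M \<Longrightarrow> d \<in> M \<Longrightarrow>
      (\<And>k::nat. \<exists>h\<in>M. d + (\<Sum>i<k. s) = (\<Sum>i<k. t) + h) \<Longrightarrow> \<exists>e\<in>M. s = t + e"
begin

lemma algebra_zero: "0 \<in> monoid_algebra M"
  by (simp add: monoid_algebra_def)

lemma algebra_single: "u \<in> M \<Longrightarrow> single u c \<in> monoid_algebra M"
  by (simp add: monoid_algebra_def)

lemma algebra_one: "(1 :: 'm \<Rightarrow>\<^sub>0 'c::comm_semiring_1) \<in> monoid_algebra M"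
  using algebra_single[OF zero_mem, of "1::'c"] by simp

lemma algebra_add: "f \<in> monoid_algebra M \<Longrightarrow> g \<in> monoid_algebra M \<Longrightarrow> f + g \<in> monoid_algebra M"
  using Poly_Mapping.keys_add[of f g] by (auto simp: monoid_algebra_def)

lemma algebra_uminus: "f \<in> monoid_algebra M \<Longrightarrow> - f \<in> monoid_algebra M"
  by (auto simp: monoid_algebra_def in_keys_iff)

lemma algebra_mult:
  fixes f g :: "'m \<Rightarrow>\<^sub>0 'c::comm_semiring_1"
  shows "f \<in> monoid_algebra M \<Longrightarrow> g \<in> monoid_algebra M \<Longrightarrow> f * g \<in> monoid_algebra M"
  using keys_mult[of f g] add_mem by (fastforce simp: monoid_algebra_def)

lemma algebra_power:
  fixes f :: "'m \<Rightarrow>\<^sub>0 'c::comm_semiring_1"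
  shows "f \<in> monoid_algebra M \<Longrightarrow> f ^ k \<in> monoid_algebra M"
  by (induction k) (auto intro: algebra_one algebra_mult)

lemma algebra_sum:
  "(\<And>a. a \<in> A \<Longrightarrow> f a \<in> monoid_algebra M) \<Longrightarrow> sum f A \<in> monoid_algebra M"
  by (induction A rule: infinite_finite_induct) (auto intro: algebra_zero algebra_add)

lemma algebra_of_nat: "(of_nat k :: 'm \<Rightarrow>\<^sub>0 'c::comm_semiring_1) \<in> monoid_algebra M"
  by (induction k) (auto intro: algebra_zero algebra_add algebra_one)

text \<open>
  The hypothesis says that \<open>d (f / g)\<^sup>k\<close> lies in the algebra for all \<open>k\<close>. Applied to leading
  monomials, it makes the one of \<open>f\<close>, divided by the one of \<open>g\<close>, a monomial \<open>e\<close> of the algebra,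
  by saturation. Subtracting a multiple of \<open>e\<close> from \<open>f / g\<close> keeps the hypothesis and lowers the
  leading monomial of the numerator.
\<close>

theorem completely_integrally_closed:
  fixes f g d :: "'m \<Rightarrow>\<^sub>0 'c::field"
  assumes "f \<in> monoid_algebra M" "g \<in> monoid_algebra M" "d \<in> monoid_algebra M" "g \<noteq> 0" "d \<noteq> 0"
    and "\<And>k. \<exists>h\<in>monoid_algebra M. d * f ^ k = g ^ k * h"
  shows "\<exists>h\<in>monoid_algebra M. f = g * h"
  using assms(1,6)
proof (induction "card {t \<in> M. t \<le> lead f}" arbitrary: f rule: less_induct)
  case less
  let ?l = "lookup" and ?k = "keys"
  show ?case
  proof (cases "f = 0")
    case True
    then show ?thesis using algebra_zero by (intro bexI[of _ 0]) auto
  next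
    case False
    have lead_mem: "lead h \<in> M" if "h \<in> monoid_algebra M" "h \<noteq> 0" for h :: "'m \<Rightarrow>\<^sub>0 'c"
      using lead_in_keys[OF that(2)] that(1) by (auto simp: monoid_algebra_def)
    have "\<exists>e\<in>M. lead f = lead g + e"
    proof (rule saturated)
      fix k :: nat
      obtain h where h: "h \<in> monoid_algebra M" "d * f ^ k = g ^ k * h"
        using less.prems(2) by blast
      then have "h \<noteq> 0"
        using False \<open>d \<noteq> 0\<close> by auto
      then have "lead d + (\<Sum>i<k. lead f) = (\<Sum>i<k. lead g) + lead h"
        using arg_cong[OF h(2), of lead] False \<open>d \<noteq> 0\<close> \<open>g \<noteq> 0\<close>
        by (simp add: lead_mult lead_power)
      then show "\<exists>h\<in>M. lead d + (\<Sum>i<k. lead f) = (\<Sum>i<k. lead g) + h"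
        using lead_mem[OF h(1) \<open>h \<noteq> 0\<close>] by blast
    qed (use less.prems(1) assms False lead_mem in auto)
    then obtain e where e: "e \<in> M" "lead f = lead g + e" by blast
    define c where "c = ?l f (lead f) / ?l g (lead g)"
    define m where "m = single e c"
    define f' where "f' = f - g * m"
    have g_coeff: "?l g (lead g) \<noteq> 0" and f_coeff: "?l f (lead f) \<noteq> 0"
      using lead_in_keys[OF \<open>g \<noteq> 0\<close>] lead_in_keys[OF False] by (auto simp: in_keys_iff)
    then have "c \<noteq> 0" by (simp add: c_def)
    then have "m \<noteq> 0"
      using inj_single[of e] by (metis injD m_def single_zero)
    have lead_m: "lead m = e"
      using \<open>c \<noteq> 0\<close> by (simp add: m_def lead_def)
    have m_mem: "m \<in> monoid_algebra M"
      unfolding m_def using e(1) by (rule algebra_single)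
    have f'_mem: "f' \<in> monoid_algebra M"
      using less.prems(1) assms m_mem algebra_add[OF _ algebra_uminus[OF algebra_mult], of f g m]
      by (simp add: f'_def)
    have lower: "lead f' < lead f" if "f' \<noteq> 0"
    proof -
      have "?l (g * m) (lead f) = ?l g (lead g) * ?l m e" "lead (g * m) = lead f"
        using lead_mult[OF \<open>g \<noteq> 0\<close> \<open>m \<noteq> 0\<close>] unfolding lead_m e(2) by auto
      moreover have "?l m e = c"
        by (simp add: m_def)
      ultimately have gm: "lead (g * m) = lead f" "?l (g * m) (lead f) = ?l f (lead f)"
        using g_coeff by (auto simp: c_def)
      have "u \<le> lead f" if "u \<in> ?k f'" for u
      proof -
        have "u \<in> ?k f \<or> u \<in> ?k (g * m)"
          using that by (auto simp: f'_def in_keys_iff lookup_minus)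
        then show ?thesis
          using le_lead[of u f] le_lead[of u "g * m"] gm by auto
      qed
      moreover have "lead f \<notin> ?k f'"
        using gm(2) by (simp add: f'_def in_keys_iff lookup_minus)
      ultimately show ?thesis
        using lead_in_keys[OF that] by (metis order.not_eq_order_implies_strict)
    qed
    have "\<exists>h\<in>monoid_algebra M. f' = g * h"
    proof (cases "f' = 0")
      case True
      then show ?thesis using algebra_zero by (intro bexI[of _ 0]) auto
    next
      case False': False
      show ?thesis
      proof (rule less.hyps)
        have "{t \<in> M. t \<le> lead f'} \<subseteq> {t \<in> M. t \<le> lead f}"
          using lower[OF False'] by auto
        moreover have "lead f \<in> M"
          using lead_mem[OF less.prems(1) False] .
        ultimately have "{t \<in> M. t \<le> lead f'} \<subset> {t \<in> M. t \<le> lead f}"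
          using lower[OF False'] by (metis (mono_tags, lifting) mem_Collect_eq order_refl leD psubsetI)
        then show "card {t \<in> M. t \<le> lead f'} < card {t \<in> M. t \<le> lead f}"
          using finite_below[OF lead_mem[OF less.prems(1) False]] by (rule psubset_card_mono[rotated])
        show "f' \<in> monoid_algebra M" by (rule f'_mem)
        fix k
        obtain h where h: "\<And>i. h i \<in> monoid_algebra M" "\<And>i. d * f ^ i = g ^ i * h i"
          using less.prems(2) by metis
        have "d * f' ^ k = d * (f + g * (- m)) ^ k"
          by (simp add: f'_def)
        also have "\<dots> = (\<Sum>i\<le>k. of_nat (k choose i) * (d * f ^ i) * (g * (- m)) ^ (k - i))"
          unfolding binomial_ring sum_distrib_left by (simp only: mult_ac)
        also have "\<dots> = (\<Sum>i\<le>k. g ^ k * (of_nat (k choose i) * h i * (- m) ^ (k - i)))"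
        proof (intro sum.cong refl)
          fix i assume "i \<in> {..k}"
          then have "g ^ k = g ^ i * g ^ (k - i)"
            by (simp flip: power_add)
          then show "of_nat (k choose i) * (d * f ^ i) * (g * (- m)) ^ (k - i)
              = g ^ k * (of_nat (k choose i) * h i * (- m) ^ (k - i))"
            unfolding h(2) power_mult_distrib by (simp only: mult_ac)
        qed
        also have "\<dots> = g ^ k * (\<Sum>i\<le>k. of_nat (k choose i) * h i * (- m) ^ (k - i))"
          by (simp add: sum_distrib_left)
        finally show "\<exists>h\<in>monoid_algebra M. d * f' ^ k = g ^ k * h"
          using h(1) m_mem
          by (intro bexI[of _ "\<Sum>i\<le>k. of_nat (k choose i) * h i * (- m) ^ (k - i)"])
            (auto intro!: algebra_sum algebra_mult algebra_power algebra_uminus algebra_of_nat)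
      qed
    qed
    then obtain h where "h \<in> monoid_algebra M" "f' = g * h" by blast
    then show ?thesis
      using m_mem algebra_add[of h m]
      by (intro bexI[of _ "h + m"]) (auto simp: f'_def algebra_simps)
  qed
qed

end

text \<open>
  The equation of degree \<open>n\<close> expresses all higher powers of \<open>x\<close> by those below \<open>n\<close>, for
  which \<open>g\<^sup>n\<close> is a common denominator.
\<close>

lemma integral_elem_almost:
  fixes C :: "'f::field set"
  assumes C: "0 \<in> C" "1 \<in> C" "\<And>x y. x \<in> C \<Longrightarrow> y \<in> C \<Longrightarrow> x + y \<in> C"
      "\<And>x y. x \<in> C \<Longrightarrow> y \<in> C \<Longrightarrow> x * y \<in> C" "\<And>x. x \<in> C \<Longrightarrow> - x \<in> C"
    and "integral_elem C x" "g \<in> C" "g * x \<in> C"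
  shows "\<exists>n. \<forall>k. g ^ n * x ^ k \<in> C"
proof -
  obtain n c where c: "\<And>i. i < n \<Longrightarrow> c i \<in> C" "x ^ n + (\<Sum>i<n. c i * x ^ i) = 0"
    using assms(6) by (auto simp: integral_elem_def)
  have pow: "y ^ i \<in> C" if "y \<in> C" for y i
    using that C by (induction i) auto
  have sum: "sum f A \<in> C" if "\<And>a. a \<in> A \<Longrightarrow> f a \<in> C" for f and A :: "nat set"
    using that C by (induction A rule: infinite_finite_induct) auto
  have "g ^ n * x ^ k \<in> C" for k
  proof (induction k rule: less_induct)
    case (less k)
    show ?case
    proof (cases "k < n")
      case True
      then have "g ^ n * x ^ k = g ^ (n - k) * (g * x) ^ k"
        by (simp add: power_mult_distrib flip: power_add mult.assoc)
      then show ?thesis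
        using assms pow C by simp
    next
      case False
      have "x ^ k = x ^ n * x ^ (k - n)"
        using False by (simp flip: power_add)
      also have "x ^ n = - (\<Sum>i<n. c i * x ^ i)"
        using c(2) by (simp only: eq_neg_iff_add_eq_0)
      also have "- (\<Sum>i<n. c i * x ^ i) * x ^ (k - n) = - (\<Sum>i<n. c i * x ^ (i + (k - n)))"
        by (simp add: sum_distrib_right power_add mult.assoc)
      finally have "g ^ n * x ^ k = - (\<Sum>i<n. c i * (g ^ n * x ^ (i + (k - n))))"
        by (simp add: sum_distrib_left mult_ac)
      moreover have "c i * (g ^ n * x ^ (i + (k - n))) \<in> C" if "i < n" for i
        using that False by (intro C c less.IH) auto
      ultimately show ?thesis
        by (auto intro!: C(5) sum)
    qed
  qed
  then show ?thesis by blast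
qed

lemma Fract_power: "Fract a b ^ k = Fract (a ^ k) (b ^ k)" for a :: "'a::idom"
  by (induction k) (auto simp: One_fract_def)

lemma (in saturated_monoid) integrally_closed:
  fixes f g :: "'m \<Rightarrow>\<^sub>0 'c::field"
  assumes "f \<in> monoid_algebra M" "g \<in> monoid_algebra M" "g \<noteq> 0"
    and int: "integral_elem ((\<lambda>f. Fract f 1) ` monoid_algebra M) (Fract f g)"
  shows "\<exists>h\<in>monoid_algebra M. f = g * h"
proof -
  let ?C = "(\<lambda>f. Fract f 1) ` (monoid_algebra M :: ('m \<Rightarrow>\<^sub>0 'c) set)"
  have "\<exists>n. \<forall>k. Fract g 1 ^ n * Fract f g ^ k \<in> ?C"
  proof (rule integral_elem_almost)
    show "Fract g 1 * Fract f g \<in> ?C"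
      using assms mult_fract_cancel[of g f 1] by auto
  qed (use assms algebra_zero algebra_one in
      \<open>auto simp: Zero_fract_def One_fract_def intro!: imageI algebra_add algebra_mult algebra_uminus\<close>)
  then obtain n where n: "\<And>k. Fract g 1 ^ n * Fract f g ^ k \<in> ?C" by blast
  have "\<exists>h\<in>monoid_algebra M. g ^ n * f ^ k = g ^ k * h" for k
  proof -
    obtain h where "h \<in> monoid_algebra M" "Fract g 1 ^ n * Fract f g ^ k = Fract h 1"
      using n by blast
    then show ?thesis
      using \<open>g \<noteq> 0\<close> by (intro bexI[of _ h]) (auto simp: Fract_power eq_fract mult_ac)
  qed
  then show ?thesis
    using assms by (intro completely_integrally_closed[of f g "g ^ n"]) (auto intro: algebra_power)
qed


section \<open>The monoid of a weighted flag\<close>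

lemma lookup_of_nat_mult:
  fixes t :: "'a::monoid_add \<Rightarrow>\<^sub>0 'b::semiring_1"
  shows "lookup (of_nat n * t) i = of_nat n * lookup t i"
  by (induction n) (auto simp: distrib_right lookup_add)

text \<open>
  The monoid of LS-paths in integral coordinates: if \<open>\<rho>\<^sub>0 > \<dots> > \<rho>\<^sub>N\<close> are the elements of
  \<open>S\<close>, then \<open>t\<^sub>i\<close> stands for \<open>\<beta>\<^sub>i\<close> times the sum of the path over all elements
  \<open>\<le> \<rho>\<^sub>i\<close>, where \<open>\<beta>\<^sub>i\<close> is the bond between \<open>\<rho>\<^sub>i\<close> and \<open>\<rho>\<^bsub>i-1\<^esub>\<close>
  and \<open>\<beta>\<^sub>0 = 1\<close>. In particular \<open>t\<^sub>0\<close> is the degree. Descending order is chosen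
  because the lexicographic order of the type then compares degrees first.
\<close>

locale flag_monoid =
  fixes N :: nat and \<beta> :: "nat \<Rightarrow> nat"
  assumes beta_0: "\<beta> 0 = 1" and beta_pos: "\<And>i. \<beta> i > 0"
begin

definition M :: "(nat \<Rightarrow>\<^sub>0 nat) set" where
  "M = {t. keys t \<subseteq> {..N} \<and>
     (\<forall>i<N. lookup t (Suc i) * \<beta> i \<le> lookup t i * \<beta> (Suc i))}"

definition Mdeg :: "nat \<Rightarrow> (nat \<Rightarrow>\<^sub>0 nat) set" where
  "Mdeg d = {t \<in> M. lookup t 0 = d}"

lemma M_keys: "t \<in> M \<Longrightarrow> keys t \<subseteq> {..N}"
  by (simp add: M_def)

lemma M_lookup_beyond: "t \<in> M \<Longrightarrow> i > N \<Longrightarrow> lookup t i = 0"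
  using M_keys[of t] by (auto simp: in_keys_iff)

lemma M_step: "t \<in> M \<Longrightarrow> lookup t (Suc i) * \<beta> i \<le> lookup t i * \<beta> (Suc i)"
  using M_lookup_beyond[of t "Suc i"] by (cases "i < N") (simp_all add: M_def)

lemma M_I:
  assumes "\<And>i. i > N \<Longrightarrow> lookup t i = 0"
    and "\<And>i. i < N \<Longrightarrow> lookup t (Suc i) * \<beta> i \<le> lookup t i * \<beta> (Suc i)"
  shows "t \<in> M"
proof -
  have "keys t \<subseteq> {..N}"
    using assms(1) by (meson atMost_iff in_keys_iff linorder_not_less subsetI)
  then show ?thesis
    using assms(2) by (simp add: M_def)
qed

lemma M_bound: "t \<in> M \<Longrightarrow> lookup t i \<le> \<beta> i * lookup t 0"
proof (induction i)
  case 0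
  then show ?case by (simp add: beta_0)
next
  case (Suc i)
  have "lookup t (Suc i) * \<beta> i \<le> lookup t i * \<beta> (Suc i)"
    using Suc by (intro M_step)
  also have "\<dots> \<le> (\<beta> i * lookup t 0) * \<beta> (Suc i)"
    using Suc by (intro mult_right_mono) auto
  finally have "lookup t (Suc i) * \<beta> i \<le> (\<beta> (Suc i) * lookup t 0) * \<beta> i"
    by (simp add: mult_ac)
  then show ?case
    using beta_pos[of i] by simp
qed

lemma M_zero: "0 \<in> M"
  by (simp add: M_def)

lemma M_add: "s \<in> M \<Longrightarrow> t \<in> M \<Longrightarrow> s + t \<in> M"
  by (rule M_I) (auto simp: lookup_add M_lookup_beyond distrib_right intro!: add_mono M_step)

lemma Mdeg_add: "s \<in> Mdeg c \<Longrightarrow> t \<in> Mdeg d \<Longrightarrow> s + t \<in> Mdeg (c + d)"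
  by (simp add: Mdeg_def M_add lookup_add)

lemma Mdeg_sub: "Mdeg d \<subseteq> M"
  by (auto simp: Mdeg_def)

lemma Mdeg_0: "Mdeg 0 = {0}"
proof -
  have "t = 0" if "t \<in> Mdeg 0" for t
    using that M_bound[of t] by (intro poly_mapping_eqI) (auto simp: Mdeg_def)
  then show ?thesis by (auto simp: Mdeg_def M_zero)
qed

lemma Mdeg_card: "finite (Mdeg d)" "card (Mdeg d) \<le> (\<Prod>i\<in>{1..N}. \<beta> i * d + 1)"
proof -
  define F where "F = (\<lambda>t::nat \<Rightarrow>\<^sub>0 nat. restrict (lookup t) {1..N})"
  have inj: "inj_on F (Mdeg d)"
  proof (rule inj_onI)
    fix s t assume *: "s \<in> Mdeg d" "t \<in> Mdeg d" "F s = F t"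
    show "s = t"
    proof (rule poly_mapping_eqI)
      fix i
      have "i = 0 \<or> i \<in> {1..N} \<or> i > N" by auto
      then show "lookup s i = lookup t i"
        using * fun_cong[OF *(3)[unfolded F_def], of i]
        by (auto simp: Mdeg_def M_lookup_beyond restrict_def)
    qed
  qed
  have img: "F ` Mdeg d \<subseteq> (\<Pi>\<^sub>E i\<in>{1..N}. {..\<beta> i * d})"
    using M_bound by (auto simp: F_def Mdeg_def)
  have fin: "finite (\<Pi>\<^sub>E i\<in>{1..N}. {..\<beta> i * d})"
    by (intro finite_PiE) auto
  show "finite (Mdeg d)"
    using finite_subset[OF img fin] inj by (rule finite_imageD)
  have "card (Mdeg d) \<le> card (\<Pi>\<^sub>E i\<in>{1..N}. {..\<beta> i * d})"
    using card_mono[OF fin img] card_image[OF inj] by simp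
  also have "\<dots> = (\<Prod>i\<in>{1..N}. \<beta> i * d + 1)"
    by (subst card_PiE) auto
  finally show "card (Mdeg d) \<le> (\<Prod>i\<in>{1..N}. \<beta> i * d + 1)" .
qed

lemma lex_le_imp_lookup_0_le:
  fixes s t :: "nat \<Rightarrow>\<^sub>0 nat"
  assumes "s \<le> t"
  shows "lookup s 0 \<le> lookup t 0"
proof (cases "s = t")
  case False
  then have "s < t" using assms by simp
  then obtain k where k: "lookup s k < lookup t k"
    "\<And>k'. k' < k \<Longrightarrow> lookup s k' = lookup t k'"
    by (auto simp: less_poly_mapping.rep_eq less_fun_def)
  then show ?thesis by (cases "k = 0") auto
qed simp

sublocale saturated_monoid M
proof
  fix s :: "nat \<Rightarrow>\<^sub>0 nat" assume "s \<in> M"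
  have "{t \<in> M. t \<le> s} \<subseteq> (\<Union>d\<le>lookup s 0. Mdeg d)"
    by (auto simp: Mdeg_def dest: lex_le_imp_lookup_0_le)
  then show "finite {t \<in> M. t \<le> s}"
    by (rule finite_subset) (auto simp: Mdeg_card)
next
  fix s t d :: "nat \<Rightarrow>\<^sub>0 nat"
  assume mem: "s \<in> M" "t \<in> M" "d \<in> M"
    and *: "\<And>k::nat. \<exists>h\<in>M. d + (\<Sum>i<k. s) = (\<Sum>i<k. t) + h"
  define h where "h k = (SOME h. h \<in> M \<and> d + (\<Sum>i<k. s) = (\<Sum>i<k. t) + h)" for k :: nat
  have h: "h k \<in> M" "d + (\<Sum>i<k. s) = (\<Sum>i<k. t) + h k" for k
    using someI_ex[OF *[of k, unfolded Bex_def]] by (simp_all add: h_def)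
  let ?l = "lookup"
  have eq: "?l d i + k * ?l s i = k * ?l t i + ?l (h k) i" for k i
    using arg_cong[OF h(2)[of k], of "\<lambda>t. ?l t i"] by (simp add: lookup_add lookup_of_nat_mult)
  \<comment> \<open>An affine function of \<open>k\<close> that is nowhere negative has nonnegative slope.\<close>
  have slope: "0 \<le> c" if "\<And>k. 0 \<le> a + int k * c" for a c :: int
  proof (rule ccontr)
    assume "\<not> 0 \<le> c"
    then have "int (nat \<bar>a\<bar> + 1) * c \<le> int (nat \<bar>a\<bar> + 1) * (-1)"
      by (intro mult_left_mono) auto
    then show False
      using that[of "nat \<bar>a\<bar> + 1"] by simp
  qed
  have le: "?l t i \<le> ?l s i" for i
  proof -
    have "0 \<le> int (?l s i) - int (?l t i)"
    proof (rule slope)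
      fix k
      show "0 \<le> int (?l d i) + int k * (int (?l s i) - int (?l t i))"
        using arg_cong[OF eq[of i k], of int] by (simp add: algebra_simps)
    qed
    then show ?thesis by simp
  qed
  define e where "e = s - t"
  have e: "?l e i = ?l s i - ?l t i" for i
    by (simp add: e_def lookup_minus)
  have "e \<in> M"
  proof (rule M_I)
    fix i
    define D where "D = (\<lambda>t. int (?l t i) * int (\<beta> (Suc i)) - int (?l t (Suc i)) * int (\<beta> i))"
    have "0 \<le> D s - D t"
    proof (rule slope)
      fix k
      have "int (?l d i) + int k * int (?l s i) = int k * int (?l t i) + int (?l (h k) i)" for i
        using arg_cong[OF eq[of i k], of int] by simp
      then have *: "int (?l (h k) i) = int (?l d i) + int k * int (?l s i) - int k * int (?l t i)" for i
        by (simp add: algebra_simps)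
      have "D (h k) = D d + int k * (D s - D t)"
        unfolding D_def * by (simp add: algebra_simps)
      moreover have "D (h k) \<ge> 0"
        using M_step[OF h(1), of k i] by (simp add: D_def flip: of_nat_mult)
      ultimately show "0 \<le> D d + int k * (D s - D t)" by simp
    qed
    then have "0 \<le> int (?l e i) * int (\<beta> (Suc i)) - int (?l e (Suc i)) * int (\<beta> i)"
      using le by (simp add: D_def e of_nat_diff algebra_simps)
    then show "?l e (Suc i) * \<beta> i \<le> ?l e i * \<beta> (Suc i)"
      by (simp flip: of_nat_mult)
  qed (use mem in \<open>simp add: e M_lookup_beyond\<close>)
  moreover have "s = t + e"
    using le by (intro poly_mapping_eqI) (simp add: lookup_add e)
  ultimately show "\<exists>e\<in>M. s = t + e" by blast
qed (auto simp: M_zero M_add)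

text \<open>
  Cutting at height one: with \<open>t\<^sub>i / \<beta>\<^sub>i\<close> as heights, the parts below and above \<open>1\<close> of a
  descending sequence of heights are again descending.
\<close>

lemma Mdeg_Suc_decompose:
  assumes "t \<in> Mdeg (Suc r)"
  shows "\<exists>e\<in>Mdeg 1. \<exists>t'\<in>Mdeg r. t = e + t'"
proof -
  let ?l = "lookup"
  have tM: "t \<in> M" and t0: "?l t 0 = Suc r"
    using assms by (auto simp: Mdeg_def)
  define e where "e = Abs_poly_mapping (\<lambda>i. min (\<beta> i) (?l t i))"
  have "finite {i. min (\<beta> i) (?l t i) \<noteq> 0}"
    by (rule finite_subset[of _ "keys t"]) (auto simp: in_keys_iff)
  then have e: "?l e i = min (\<beta> i) (?l t i)" for i
    by (simp add: e_def)
  have e': "?l (t - e) i = ?l t i - min (\<beta> i) (?l t i)" for i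
    by (simp add: lookup_minus e)
  have step: "?l t (Suc i) * \<beta> i \<le> ?l t i * \<beta> (Suc i)" for i
    using tM by (rule M_step)
  have full: "\<beta> i \<le> ?l t i" if "\<beta> (Suc i) \<le> ?l t (Suc i)" for i
  proof -
    have "\<beta> (Suc i) * \<beta> i \<le> ?l t i * \<beta> (Suc i)"
      using mult_right_mono[OF that, of "\<beta> i"] step[of i] by linarith
    then show ?thesis using beta_pos[of "Suc i"] by simp
  qed
  have eM: "e \<in> M"
  proof (rule M_I)
    fix i
    show "?l e (Suc i) * \<beta> i \<le> ?l e i * \<beta> (Suc i)"
    proof (cases "\<beta> i \<le> ?l t i")
      case True
      have "min (\<beta> (Suc i)) (?l t (Suc i)) * \<beta> i \<le> \<beta> (Suc i) * \<beta> i"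
        by (intro mult_right_mono) auto
      then show ?thesis using True by (simp add: e mult_ac)
    next
      case False
      then have "\<not> \<beta> (Suc i) \<le> ?l t (Suc i)" using full[of i] by blast
      with False show ?thesis using step[of i] by (simp add: e min_def)
    qed
  qed (simp add: e M_lookup_beyond tM)
  have rM: "t - e \<in> M"
  proof (rule M_I)
    fix i
    show "?l (t - e) (Suc i) * \<beta> i \<le> ?l (t - e) i * \<beta> (Suc i)"
    proof (cases "\<beta> (Suc i) \<le> ?l t (Suc i)")
      case True
      then show ?thesis
        using full[of i] step[of i] by (simp add: e' diff_mult_distrib diff_mult_distrib2 mult.commute diff_le_mono)
    next
      case False
      then show ?thesis by (simp add: e')
    qed
  qed (simp add: e' M_lookup_beyond tM)
  have "t = e + (t - e)"
    by (intro poly_mapping_eqI) (simp add: lookup_add lookup_minus e)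
  moreover have "e \<in> Mdeg 1" "t - e \<in> Mdeg r"
    using eM rM by (auto simp: Mdeg_def e e' t0 beta_0)
  ultimately show ?thesis by blast
qed

text \<open>
  \<open>vertex k\<close> is the path concentrated in \<open>\<rho>\<^sub>k\<close>, and \<open>edge k\<close> is the lattice point
  next to \<open>vertex (k - 1)\<close> on the segment from there to \<open>vertex k\<close>. The differences
  \<open>edge k - vertex (k - 1)\<close> form the standard basis of the lattice of degree \<open>0\<close>.
\<close>

definition vertex :: "nat \<Rightarrow> (nat \<Rightarrow>\<^sub>0 nat)" where
  "vertex k = (\<Sum>i\<le>k. single i (\<beta> i))"

definition edge :: "nat \<Rightarrow> (nat \<Rightarrow>\<^sub>0 nat)" where
  "edge k = vertex (k - 1) + single k 1"

lemma lookup_vertex: "lookup (vertex k) i = (if i \<le> k then \<beta> i else 0)"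
  by (simp add: vertex_def lookup_sum lookup_single when_def sum.delta')

lemma vertex_mem: "k \<le> N \<Longrightarrow> vertex k \<in> Mdeg 1"
  unfolding Mdeg_def mem_Collect_eq
  by (intro conjI M_I) (auto simp: lookup_vertex beta_0 mult_ac)

lemma lookup_edge: "k \<ge> 1 \<Longrightarrow>
  lookup (edge k) i = (if i < k then \<beta> i else if i = k then 1 else 0)"
  by (auto simp: edge_def lookup_add lookup_vertex lookup_single when_def)

lemma edge_mem: "1 \<le> k \<Longrightarrow> k \<le> N \<Longrightarrow> edge k \<in> Mdeg 1"
  unfolding Mdeg_def mem_Collect_eq
  by (intro conjI M_I) (auto simp: lookup_edge beta_0 mult_ac Suc_le_eq beta_pos)

end

section \<open>Points of projective space and forms\<close>

definition power_prod :: "(nat \<Rightarrow> 'l::comm_semiring_1) \<Rightarrow> (nat \<Rightarrow>\<^sub>0 nat) \<Rightarrow> 'l" where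
  "power_prod x u = (\<Prod>i\<in>keys u. x i ^ lookup u i)"

lemma power_prod_superset:
  assumes "finite I" "keys u \<subseteq> I"
  shows "power_prod x u = (\<Prod>i\<in>I. x i ^ lookup u i)"
  unfolding power_prod_def
  by (rule prod.mono_neutral_left) (use assms in \<open>auto simp: in_keys_iff\<close>)

lemma power_prod_zero [simp]: "power_prod x 0 = 1"
  by (simp add: power_prod_def)

lemma power_prod_single: "power_prod x (single i n) = x i ^ n"
  by (subst power_prod_superset[of "{i}"]) auto

lemma power_prod_add: "power_prod x (u + v) = power_prod x u * power_prod x v"
proof -
  let ?U = "keys u \<union> keys v"
  have "finite ?U" "keys (u + v) \<subseteq> ?U"
    using Poly_Mapping.keys_add[of u v] by auto
  then show ?thesis
    by (subst (1 2 3) power_prod_superset[of ?U])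
      (auto simp: lookup_add power_add prod.distrib)
qed

lemma power_prod_sum: "power_prod x (sum f A) = (\<Prod>a\<in>A. power_prod x (f a))"
  by (induction A rule: infinite_finite_induct) (auto simp: power_prod_add)

lemma power_prod_of_nat_mult: "power_prod x (of_nat n * u) = power_prod x u ^ n"
  by (induction n) (auto simp: power_prod_add distrib_right)

lemma power_prod_mult: "power_prod (\<lambda>i. x i * y i) u = power_prod x u * power_prod y u"
  by (simp add: power_prod_def power_mult_distrib prod.distrib)

lemma power_prod_cong:
  "(\<And>i. i \<in> keys u \<Longrightarrow> x i = y i) \<Longrightarrow> power_prod x u = power_prod y u"
  by (simp add: power_prod_def)

lemma power_prod_eq_0_iff:
  fixes x :: "nat \<Rightarrow> 'l::idom"
  shows "power_prod x u = 0 \<longleftrightarrow> (\<exists>i\<in>keys u. x i = 0)"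
  by (auto simp: power_prod_def in_keys_iff)

lemma power_prod_const:
  assumes "keys u \<subseteq> {..m}"
  shows "power_prod (\<lambda>i. c) u = c ^ (\<Sum>i\<le>m. lookup u i)"
  by (subst power_prod_superset[of "{..m}"]) (use assms in \<open>auto simp: power_sum\<close>)

lemma peval_eq_mon_eval: "peval h p x = mon_eval h (power_prod x) p"
  by (simp add: peval_def mon_eval_def power_prod_def)

locale field_map = semiring_map h for h :: "'c::field \<Rightarrow> 'l::field"
begin

lemma peval_mult: "peval h (p * q) x = peval h p x * peval h q x"
  unfolding peval_eq_mon_eval by (rule mon_eval_mult) (rule power_prod_add)

lemma peval_add: "peval h (p + q) x = peval h p x + peval h q x"
  unfolding peval_eq_mon_eval by (rule mon_eval_add)

lemma peval_sum: "peval h (sum f A) x = (\<Sum>a\<in>A. peval h (f a) x)"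
  unfolding peval_eq_mon_eval by (rule mon_eval_sum)

lemma peval_single: "peval h (single u c) x = h c * power_prod x u"
  unfolding peval_eq_mon_eval by (rule mon_eval_single)

lemma peval_one: "peval h 1 x = 1"
  unfolding peval_eq_mon_eval by (simp add: mon_eval_one)

lemma peval_power: "peval h (p ^ n) x = peval h p x ^ n"
  by (induction n) (auto simp: peval_one peval_mult)

lemma peval_prod: "peval h (prod f A) x = (\<Prod>a\<in>A. peval h (f a) x)"
  by (induction A rule: infinite_finite_induct) (auto simp: peval_one peval_mult)

end

lemma field_map_id: "field_map (id :: 'c::field \<Rightarrow> 'c)"
  by (rule field_map.intro[OF semiring_map_id])

lemma field_map_to_ac: "field_map (to_ac :: 'k::field \<Rightarrow> 'k alg_closure)"
  by (rule field_map.intro[OF semiring_map_to_ac])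

lemma form_mpoly: "form m d p \<Longrightarrow> p \<in> carrier (mpoly_ring m)"
  by (auto simp: form_def mpoly_ring_def)

lemma form_single:
  "keys u \<subseteq> {..m} \<Longrightarrow> (\<Sum>i\<le>m. lookup u i) = d \<Longrightarrow>
    form m d (single u c)"
  by (auto simp: form_def)

lemma form_zero: "form m d 0"
  by (simp add: form_def)

lemma form_one: "form m 0 1"
  by (simp add: form_def)

lemma form_var: "i \<le> m \<Longrightarrow> form m 1 (single (single i 1) c)"
  by (rule form_single) (auto simp: lookup_single when_def sum.delta)

lemma form_add: "form m d p \<Longrightarrow> form m d q \<Longrightarrow> form m d (p + q)"
  using Poly_Mapping.keys_add[of p q] by (fastforce simp: form_def)

lemma form_sum: "(\<And>a. a \<in> A \<Longrightarrow> form m d (f a)) \<Longrightarrow> form m d (sum f A)"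
  by (induction A rule: infinite_finite_induct) (auto intro: form_zero form_add)

lemma form_mult:
  assumes "form m d p" "form m e q"
  shows "form m (d + e) (p * q)"
  unfolding form_def
proof (intro ballI)
  fix w assume "w \<in> keys (p * q)"
  then obtain u v where "w = u + v" "u \<in> keys p" "v \<in> keys q"
    using keys_mult[of p q] by blast
  then show "keys w \<subseteq> {..m} \<and> (\<Sum>i\<le>m. lookup w i) = d + e"
    using assms Poly_Mapping.keys_add[of u v] by (fastforce simp: form_def lookup_add sum.distrib)
qed

lemma form_power: "form m d p \<Longrightarrow> form m (n * d) (p ^ n)"
  by (induction n) (auto intro: form_one form_mult)

lemma form_prod:
  "finite A \<Longrightarrow> (\<And>a. a \<in> A \<Longrightarrow> form m (d a) (f a)) \<Longrightarrow> form m (\<Sum>a\<in>A. d a) (prod f A)"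
  by (induction A rule: finite_induct) (auto intro: form_one form_mult)

lemma form_scale: "form m d p \<Longrightarrow> form m d (single 0 c * p)"
  using form_mult[of m 0 "single 0 c" d p] form_single[of 0 m 0 c] by simp

lemma (in field_map) peval_scale_point:
  assumes "form m d p"
  shows "peval h p (\<lambda>i. c * x i) = c ^ d * peval h p x"
proof -
  have "power_prod (\<lambda>i. c * x i) u = c ^ d * power_prod x u" if "u \<in> keys p" for u
    using assms that power_prod_const[of u m c] by (auto simp: power_prod_mult form_def)
  then show ?thesis
    by (simp add: peval_eq_mon_eval mon_eval_def sum_distrib_left mult_ac)
qed

lemma keys_sum_subset: "keys (sum f A) \<subseteq> (\<Union>a\<in>A. keys (f a))"
  using Poly_Mapping.keys_add by (induction A rule: infinite_finite_induct) fastforce+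

lemma field_map_eq_0:
  fixes h :: "'c::field \<Rightarrow> 'l::field"
  assumes "field_map h" "h c = 0"
  shows "c = 0"
proof (rule ccontr)
  interpret field_map h by (rule assms(1))
  assume "c \<noteq> 0"
  then have "h c * h (inverse c) = 1"
    using map_mult[of c "inverse c"] map_one by simp
  then show False using assms(2) by simp
qed

definition proj_class :: "(nat \<Rightarrow> 'l::field) \<Rightarrow> 'l ppoint" where
  "proj_class x = {(\<lambda>i. c * x i) | c. c \<noteq> 0}"

lemma proj_space_iff:
  "P \<in> proj_space m \<longleftrightarrow> (\<exists>x. P = proj_class x \<and> (\<forall>i>m. x i = 0) \<and> (\<exists>i\<le>m. x i \<noteq> 0))"
  by (auto simp: proj_space_def proj_class_def)

lemma proj_class_self: "x \<in> proj_class x"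
  by (auto simp: proj_class_def intro: exI[of _ 1])

lemma proj_class_eqI:
  assumes "c \<noteq> 0" "\<And>i. y i = c * x i"
  shows "proj_class y = proj_class x"
proof -
  have y: "y = (\<lambda>i. c * x i)" using assms by auto
  show ?thesis
  proof (intro equalityI subsetI)
    fix z assume "z \<in> proj_class y"
    then obtain a where "a \<noteq> 0" "z = (\<lambda>i. a * (c * x i))" by (auto simp: proj_class_def y)
    then show "z \<in> proj_class x"
      using assms(1) by (auto simp: proj_class_def mult.assoc intro!: exI[of _ "a * c"])
  next
    fix z assume "z \<in> proj_class x"
    then obtain a where "a \<noteq> 0" "z = (\<lambda>i. a * x i)" by (auto simp: proj_class_def)
    then show "z \<in> proj_class y"
      using assms(1) by (auto simp: proj_class_def y intro!: exI[of _ "a / c"])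
  qed
qed

lemma proj_class_of_mem: "y \<in> proj_class x \<Longrightarrow> proj_class y = proj_class x"
proof -
  assume "y \<in> proj_class x"
  then obtain c where "c \<noteq> 0" "y = (\<lambda>i. c * x i)" by (auto simp: proj_class_def)
  then show ?thesis by (intro proj_class_eqI[of c]) auto
qed

lemma proj_space_memD:
  assumes "P \<in> proj_space m" "x \<in> P"
  shows "P = proj_class x" "i > m \<Longrightarrow> x i = 0" "\<exists>i\<le>m. x i \<noteq> 0"
proof -
  obtain y where y: "P = proj_class y" "\<forall>i>m. y i = 0" "\<exists>i\<le>m. y i \<noteq> 0"
    using assms by (auto simp: proj_space_iff)
  then obtain c where "c \<noteq> 0" "x = (\<lambda>i. c * y i)"
    using assms by (auto simp: proj_class_def)
  then show "P = proj_class x" "i > m \<Longrightarrow> x i = 0" "\<exists>i\<le>m. x i \<noteq> 0"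
    using y assms(2) proj_class_of_mem by auto
qed

lemma proj_space_ex: "P \<in> proj_space m \<Longrightarrow> \<exists>x. x \<in> P"
  by (auto simp: proj_space_iff intro: proj_class_self)

text \<open>
  Scaling the coordinates multiplies the value of a form by a power of the factor, so one vector of
  coordinates decides.
\<close>

lemma form_vanishes_at_iff:
  fixes h :: "'c::field \<Rightarrow> 'l::field"
  assumes h: "field_map h" and "form m d p" "P \<in> proj_space m" "x \<in> P"
  shows "vanishes_at h p P \<longleftrightarrow> peval h p x = 0"
proof -
  interpret field_map h by (rule h)
  have "P = proj_class x"
    using proj_space_memD(1)[OF assms(3,4)] .
  then show ?thesis
    using proj_class_self[of x] by (auto simp: vanishes_at_def proj_class_def peval_scale_point[OF assms(2)])
qed


section \<open>The toric variety of a weighted flag\<close>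

text \<open>
  \<open>e\<close> numbers the monoid elements of degree one, which index the homogeneous coordinates of
  the ambient projective space.
\<close>

locale flag_variety = flag_monoid N \<beta> for N \<beta> +
  fixes m :: nat and e :: "nat \<Rightarrow> (nat \<Rightarrow>\<^sub>0 nat)"
  assumes e_bij: "bij_betw e {..m} (Mdeg 1)"
begin

definition wt :: "(nat \<Rightarrow>\<^sub>0 nat) \<Rightarrow> (nat \<Rightarrow>\<^sub>0 nat)" where
  "wt u = (\<Sum>i\<le>m. of_nat (lookup u i) * e i)"

lemma e_mem: "i \<le> m \<Longrightarrow> e i \<in> Mdeg 1"
  using e_bij by (auto simp: bij_betw_def)

lemma e_surj: "t \<in> Mdeg 1 \<Longrightarrow> \<exists>i\<le>m. e i = t"
  using e_bij by (auto simp: bij_betw_def image_iff) (metis atMost_iff imageE)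

lemma lookup_wt: "lookup (wt u) j =
    (\<Sum>i\<le>m. lookup u i * lookup (e i) j)"
  by (simp add: wt_def lookup_sum lookup_of_nat_mult)

lemma wt_zero [simp]: "wt 0 = 0"
  by (simp add: wt_def)

lemma wt_add: "wt (u + v) = wt u + wt v"
  by (simp add: wt_def lookup_add distrib_right sum.distrib)

lemma wt_sum: "wt (sum f A) = (\<Sum>a\<in>A. wt (f a))"
  by (induction A rule: infinite_finite_induct) (auto simp: wt_add)

lemma wt_single: "i \<le> m \<Longrightarrow> wt (single i n) = of_nat n * e i"
proof -
  assume "i \<le> m"
  have "wt (single i n) = (\<Sum>j\<le>m. if j = i then of_nat n * e i else 0)"
    unfolding wt_def by (intro sum.cong refl) (auto simp: lookup_single when_def)
  then show ?thesis using \<open>i \<le> m\<close> by simp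
qed

lemma M_of_nat_mult: "t \<in> M \<Longrightarrow> of_nat n * t \<in> M"
  by (induction n) (auto simp: distrib_right intro: M_add M_zero)

lemma wt_mem: "wt u \<in> M"
proof -
  have *: "sum f A \<in> M" if "\<And>a. a \<in> A \<Longrightarrow> f a \<in> M" for f and A :: "nat set"
    using that by (induction A rule: infinite_finite_induct) (auto intro: M_add M_zero)
  have "e i \<in> M" if "i \<le> m" for i
    using e_mem[OF that] Mdeg_sub by blast
  then show ?thesis
    unfolding wt_def by (intro * M_of_nat_mult) simp
qed

lemma wt_degree: "lookup (wt u) 0 = (\<Sum>i\<le>m. lookup u i)"
  unfolding lookup_wt using e_mem by (intro sum.cong refl) (auto simp: Mdeg_def)

lemma wt_surj: "t \<in> M \<Longrightarrow> \<exists>u. keys u \<subseteq> {..m} \<and> wt u = t"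
proof -
  have "t \<in> Mdeg d \<Longrightarrow> \<exists>u. keys u \<subseteq> {..m} \<and> wt u = t" for d t
  proof (induction d arbitrary: t)
    case 0
    then show ?case by (intro exI[of _ 0]) (auto simp: Mdeg_0)
  next
    case (Suc d)
    then obtain s t' where *: "s \<in> Mdeg 1" "t' \<in> Mdeg d" "t = s + t'"
      using Mdeg_Suc_decompose by blast
    obtain i where i: "i \<le> m" "e i = s" using e_surj[OF *(1)] by blast
    obtain u where u: "keys u \<subseteq> {..m}" "wt u = t'" using Suc.IH[OF *(2)] by blast
    show ?case
      using i u * Poly_Mapping.keys_add[of "single i 1" u]
      by (intro exI[of _ "single i 1 + u"]) (fastforce simp: wt_add wt_single)
  qed
  then show "t \<in> M \<Longrightarrow> ?thesis" by (auto simp: Mdeg_def)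
qed

text \<open>
  The homomorphism from the polynomial ring to the monoid algebra that sends the \<open>i\<close>-th variable
  to the monomial \<open>e i\<close>, or to zero if \<open>e i\<close> does not lie in the \<open>k\<close>-th face, the one where
  all coordinates beyond the \<open>k\<close>-th vanish. For \<open>k = N\<close> nothing is killed.
\<close>

definition theta :: "nat \<Rightarrow> 'c::field mpoly \<Rightarrow> 'c mpoly" where
  "theta k p = mon_eval (single 0)
     (\<lambda>u. if keys (wt u) \<subseteq> {..k} then single (wt u) 1 else 0) p"

lemma keys_add_nat: "keys (u + v :: nat \<Rightarrow>\<^sub>0 nat) = keys u \<union> keys v"
  by (auto simp: in_keys_iff lookup_add)

lemma theta_add: "theta k (p + q) = theta k p + theta k q"
  unfolding theta_def by (rule semiring_map.mon_eval_add[OF semiring_map_single])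

lemma theta_zero [simp]: "theta k 0 = 0"
  unfolding theta_def by (rule semiring_map.mon_eval_zero[OF semiring_map_single])

lemma theta_sum: "theta k (sum f A) = (\<Sum>a\<in>A. theta k (f a))"
  unfolding theta_def by (rule semiring_map.mon_eval_sum[OF semiring_map_single])

lemma theta_mult: "theta k (p * q) = theta k p * theta k q"
  unfolding theta_def
  by (rule semiring_map.mon_eval_mult[OF semiring_map_single])
    (auto simp: wt_add keys_add_nat mult_single)

lemma theta_single: "theta k (single u c) =
    (if keys (wt u) \<subseteq> {..k} then single (wt u) c else 0)"
  unfolding theta_def semiring_map.mon_eval_single[OF semiring_map_single]
  by (simp add: mult_single)

lemma theta_one: "theta k 1 = 1"
  using theta_single[of k 0 1] by simp

lemma theta_uminus: "theta k (- p) = - theta k p"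
  using theta_add[of k p "- p"] by (simp add: eq_neg_iff_add_eq_0 add.commute)

lemma lookup_theta: "lookup (theta k p) w =
   (\<Sum>u\<in>keys p. if wt u = w \<and> keys w \<subseteq> {..k} then lookup p u else 0)"
  by (subst poly_mapping_expand[of p], unfold theta_sum theta_single lookup_sum)
    (intro sum.cong refl, auto simp: lookup_single when_def)

lemma theta_keys: "w \<in> keys (theta k p) \<Longrightarrow>
    keys w \<subseteq> {..k} \<and> (\<exists>u\<in>keys p. w = wt u)"
proof -
  assume "w \<in> keys (theta k p)"
  then have "(\<Sum>u\<in>keys p. if wt u = w \<and> keys w \<subseteq> {..k}
      then lookup p u else 0) \<noteq> 0"
    by (simp add: in_keys_iff lookup_theta)
  then show ?thesis
    by (rule contrapos_np) (intro sum.neutral, auto)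
qed

lemma theta_mem: "theta k p \<in> monoid_algebra M"
  using theta_keys[of _ k p] wt_mem by (auto simp: monoid_algebra_def)

lemma theta_form_mem: "form m d p \<Longrightarrow> theta k p \<in> monoid_algebra (Mdeg d)"
  using theta_keys[of _ k p] wt_mem by (fastforce simp: monoid_algebra_def Mdeg_def wt_degree form_def)

lemma theta_surj:
  assumes "f \<in> monoid_algebra M"
  shows "\<exists>p \<in> carrier (mpoly_ring m). theta N p = f \<and> (\<forall>d. f \<in> monoid_algebra (Mdeg d) \<longrightarrow> form m d p)"
proof -
  define s where "s t = (SOME u. keys u \<subseteq> {..m} \<and> wt u = t)" for t
  have s: "keys (s t) \<subseteq> {..m}" "wt (s t) = t" if "t \<in> M" for t
    using someI_ex[OF wt_surj[OF that]] by (auto simp: s_def)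
  define p where "p = (\<Sum>t\<in>keys f. single (s t) (lookup f t))"
  have fM: "t \<in> M" if "t \<in> keys f" for t
    using that assms by (auto simp: monoid_algebra_def)
  have "theta N p = (\<Sum>t\<in>keys f. single t (lookup f t))"
    unfolding p_def theta_sum
    by (intro sum.cong refl) (use fM s M_keys in \<open>auto simp: theta_single\<close>)
  then have "theta N p = f"
    using poly_mapping_expand[of f] by simp
  moreover have "p \<in> carrier (mpoly_ring m)"
  proof -
    have "keys p \<subseteq> (\<Union>t\<in>keys f. {s t})"
      unfolding p_def by (rule order.trans[OF keys_sum_subset]) (auto split: if_splits)
    then show ?thesis using s fM by (auto simp: mpoly_ring_def)
  qed
  moreover have "form m d p" if "f \<in> monoid_algebra (Mdeg d)" for d
    unfolding p_def
  proof (intro form_sum form_single)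
    fix t assume t: "t \<in> keys f"
    show "keys (s t) \<subseteq> {..m}" using s fM[OF t] by auto
    show "(\<Sum>i\<le>m. lookup (s t) i) = d"
      using t that s(2)[OF fM[OF t]] wt_degree[of "s t"] by (auto simp: monoid_algebra_def Mdeg_def)
  qed
  ultimately show ?thesis by blast
qed

definition binomials_hold :: "(nat \<Rightarrow> 'l::comm_semiring_1) \<Rightarrow> bool" where
  "binomials_hold x \<longleftrightarrow> (\<forall>u v. keys u \<subseteq> {..m} \<longrightarrow> keys v \<subseteq> {..m} \<longrightarrow>
     wt u = wt v \<longrightarrow> power_prod x u = power_prod x v)"

text \<open>
  The subvarieties belonging to the flag of faces; the one for \<open>k = N\<close> is the toric variety itself,
  and the others are needed for the lower bound on its dimension.
\<close>

definition face_variety :: "nat \<Rightarrow> 'l::field ppoint set" where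
  "face_variety k = {P \<in> proj_space m. \<forall>x\<in>P. binomials_hold x \<and>
     (\<forall>i\<le>m. \<not> keys (e i) \<subseteq> {..k} \<longrightarrow> x i = 0)}"

lemma binomials_holdD:
  "binomials_hold x \<Longrightarrow> keys u \<subseteq> {..m} \<Longrightarrow> keys v \<subseteq> {..m} \<Longrightarrow>
    wt u = wt v \<Longrightarrow> power_prod x u = power_prod x v"
  unfolding binomials_hold_def by blast

text \<open>
  A point of the variety is a multiplicative function on the monoid: the value at a monomial
  of the monoid algebra is that of any monomial in the variables over it.
\<close>

definition point_char :: "(nat \<Rightarrow> 'l::comm_semiring_1) \<Rightarrow> (nat \<Rightarrow>\<^sub>0 nat) \<Rightarrow> 'l" where
  "point_char x w = power_prod x (SOME u. keys u \<subseteq> {..m} \<and> wt u = w)"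

lemma point_char_wt:
  assumes "binomials_hold x" "keys u \<subseteq> {..m}"
  shows "point_char x (wt u) = power_prod x u"
proof -
  define v where "v = (SOME v. keys v \<subseteq> {..m} \<and> wt v = wt u)"
  have "keys v \<subseteq> {..m} \<and> wt v = wt u"
    unfolding v_def by (rule someI[of _ u]) (simp add: assms(2))
  then show ?thesis
    using assms binomials_holdD[of x v u] by (simp add: point_char_def v_def)
qed

lemma peval_eq_theta:
  fixes x :: "nat \<Rightarrow> 'l::field" and h :: "'c::field \<Rightarrow> 'l"
  assumes h: "field_map h" and p: "p \<in> carrier (mpoly_ring m)" and "binomials_hold x"
    and zero: "\<And>i. i \<le> m \<Longrightarrow> \<not> keys (e i) \<subseteq> {..k} \<Longrightarrow> x i = 0"
  shows "peval h p x = mon_eval h (point_char x) (theta k p)"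
proof -
  interpret field_map h by (rule h)
  have "mon_eval h (point_char x) (theta k p) = (\<Sum>u\<in>keys p.
      mon_eval h (point_char x) (theta k (single u (lookup p u))))"
    by (subst poly_mapping_expand[of p]) (simp only: theta_sum mon_eval_sum)
  also have "\<dots> = (\<Sum>u\<in>keys p. h (lookup p u) * power_prod x u)"
  proof (intro sum.cong refl)
    fix u assume "u \<in> keys p"
    then have u: "keys u \<subseteq> {..m}" using p by (auto simp: mpoly_ring_def)
    show "mon_eval h (point_char x) (theta k (single u (lookup p u)))
        = h (lookup p u) * power_prod x u"
    proof (cases "keys (wt u) \<subseteq> {..k}")
      case True
      then show ?thesis
        using assms(3) u by (simp add: theta_single mon_eval_single point_char_wt)
    next
      case False
      then obtain j where "lookup (wt u) j \<noteq> 0" "j > k"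
        by (metis atMost_iff in_keys_iff linorder_not_less subsetI)
      then obtain i where "i \<le> m" "lookup u i * lookup (e i) j \<noteq> 0"
        unfolding lookup_wt by (meson atMost_iff sum.not_neutral_contains_not_neutral)
      then have "i \<in> keys u" "x i = 0"
        using zero[of i] \<open>j > k\<close>
        by (simp_all add: in_keys_iff) (metis atMost_iff in_keys_iff linorder_not_less neq0_conv subsetD)
      then have "power_prod x u = 0"
        by (auto simp: power_prod_eq_0_iff)
      then show ?thesis using False by (simp add: theta_single)
    qed
  qed
  finally show ?thesis by (simp add: peval_eq_mon_eval mon_eval_def)
qed

text \<open>
  The monomial parametrization. For \<open>z\<close> vanishing beyond \<open>k\<close> and nonzero up to \<open>k\<close> it runs
  through the torus of the \<open>k\<close>-th face; since \<open>0\<^sup>0 = 1\<close>, all the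
  parameters but the one with index \<open>0\<close> may vanish.
\<close>

definition torus_coords :: "(nat \<Rightarrow> 'l::comm_semiring_1) \<Rightarrow> nat \<Rightarrow> 'l" where
  "torus_coords z = (\<lambda>i. if i \<le> m then power_prod z (e i) else 0)"

lemma power_prod_torus_coords:
  assumes "keys u \<subseteq> {..m}"
  shows "power_prod (torus_coords z) u = power_prod z (wt u)"
proof -
  have "power_prod (torus_coords z) u = (\<Prod>i\<le>m. torus_coords z i ^ lookup u i)"
    using assms by (intro power_prod_superset) auto
  then show ?thesis
    by (simp add: wt_def power_prod_sum power_prod_of_nat_mult torus_coords_def)
qed

lemma torus_coords_binomials: "binomials_hold (torus_coords z)"
  by (auto simp: binomials_hold_def power_prod_torus_coords)

lemma e_degree: "i \<le> m \<Longrightarrow> lookup (e i) 0 = 1"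
  using e_mem by (auto simp: Mdeg_def)

lemma e_keys: "i \<le> m \<Longrightarrow> keys (e i) \<subseteq> {..N}"
  using e_mem M_keys by (auto simp: Mdeg_def)

lemma torus_coords_scale: "torus_coords (z(0 := c * z 0)) i = c * torus_coords z i"
proof (cases "i \<le> m")
  case True
  have 0: "0 \<in> keys (e i)"
    using e_degree[OF True] by (simp add: in_keys_iff)
  have "power_prod y (e i) = y 0 * (\<Prod>j\<in>keys (e i) - {0}. y j ^ lookup (e i) j)"
    for y :: "nat \<Rightarrow> 'a"
    unfolding power_prod_def using e_degree[OF True] 0 by (subst prod.remove[of _ 0]) auto
  from this[of "z(0 := c * z 0)"] this[of z]
  have "power_prod (z(0 := c * z 0)) (e i) = c * power_prod z (e i)"
    by (simp add: mult.assoc)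
  then show ?thesis
    using True by (simp add: torus_coords_def)
qed (simp add: torus_coords_def)

lemma proj_class_torus_coords:
  "x \<in> proj_class (torus_coords z) \<Longrightarrow> \<exists>c. c \<noteq> 0 \<and> x = torus_coords (z(0 := c * z 0))"
proof -
  assume "x \<in> proj_class (torus_coords z)"
  then obtain c where "c \<noteq> 0" "x = (\<lambda>i. c * torus_coords z i)"
    by (auto simp: proj_class_def)
  then show ?thesis
    by (intro exI[of _ c]) (simp add: fun_eq_iff torus_coords_scale)
qed

lemma vertex_index:
  assumes "k \<le> N" obtains i where "i \<le> m" "e i = vertex k"
  using e_surj[OF vertex_mem[OF assms]] by blast

lemma torus_coords_zero:
  fixes z :: "nat \<Rightarrow> 'l::idom"
  assumes "\<And>j. j > k \<Longrightarrow> z j = 0" "\<not> keys (e i) \<subseteq> {..k}"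
  shows "torus_coords z i = 0"
proof -
  obtain j where "j \<in> keys (e i)" "j > k"
    using assms(2) by (metis atMost_iff linorder_not_less subsetI)
  then show ?thesis
    using assms(1) by (auto simp: torus_coords_def power_prod_eq_0_iff)
qed

lemma torus_point_mem:
  fixes z :: "nat \<Rightarrow> 'l::field"
  assumes "z 0 \<noteq> 0" "\<And>j. j > k \<Longrightarrow> z j = 0"
  shows "proj_class (torus_coords z) \<in> face_variety k"
proof -
  obtain i where i: "i \<le> m" "e i = vertex 0"
    using vertex_index[of 0] by auto
  have "vertex 0 = single 0 1"
    by (simp add: vertex_def beta_0)
  then have "torus_coords z i \<noteq> 0"
    using assms(1) i by (simp add: torus_coords_def power_prod_single)
  then have "proj_class (torus_coords z) \<in> proj_space m"
    using i by (auto simp: proj_space_iff torus_coords_def intro!: exI[of _ "torus_coords z"])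
  moreover have "binomials_hold x \<and> (\<forall>i\<le>m. \<not> keys (e i) \<subseteq> {..k} \<longrightarrow> x i = 0)"
    if mem: "x \<in> proj_class (torus_coords z)" for x
  proof -
    obtain c where x: "c \<noteq> 0" "x = torus_coords (z(0 := c * z 0))"
      using proj_class_torus_coords[OF mem] by (elim exE conjE)
    have "torus_coords (z(0 := c * z 0)) i = 0" if "\<not> keys (e i) \<subseteq> {..k}" for i
      by (rule torus_coords_zero[OF _ that]) (use assms(2) in auto)
    then show ?thesis
      unfolding x(2) using torus_coords_binomials by blast
  qed
  ultimately show ?thesis by (auto simp: face_variety_def)
qed

lemma peval_torus_coords:
  fixes z :: "nat \<Rightarrow> 'l::field" and h :: "'c::field \<Rightarrow> 'l"
  assumes h: "field_map h" and p: "p \<in> carrier (mpoly_ring m)" and z: "\<And>j. j > k \<Longrightarrow> z j = 0"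
  shows "peval h p (torus_coords z) = mon_eval h (power_prod z) (theta k p)"
proof -
  have "peval h p (torus_coords z) = mon_eval h (point_char (torus_coords z)) (theta k p)"
    by (rule peval_eq_theta[OF h p torus_coords_binomials torus_coords_zero[of k z]]) (use z in auto)
  also have "\<dots> = mon_eval h (power_prod z) (theta k p)"
    unfolding mon_eval_def
  proof (intro sum.cong refl)
    fix w assume "w \<in> keys (theta k p)"
    then obtain u where u: "u \<in> keys p" "w = wt u"
      using theta_keys by blast
    then have "keys u \<subseteq> {..m}" using p by (auto simp: mpoly_ring_def)
    then show "h (lookup (theta k p) w) * point_char (torus_coords z) w =
        h (lookup (theta k p) w) * power_prod z w"
      using u by (simp add: point_char_wt[OF torus_coords_binomials] power_prod_torus_coords)
  qed
  finally show ?thesis .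
qed

text \<open>
  A polynomial vanishing on the dense torus of a face gives a linear relation between the
  characters of that torus, so the ideal of a face consists of the polynomials with image zero.
\<close>

theorem vanishing_ideal_face_variety:
  fixes h :: "'c::field \<Rightarrow> 'l::alg_closed_field"
  assumes h: "field_map h"
  shows "vanishing_ideal h m (face_variety k :: 'l ppoint set) =
    {p \<in> carrier (mpoly_ring m). theta k p = 0}"
proof -
  interpret field_map h by (rule h)
  have "theta k p = 0" if p: "p \<in> carrier (mpoly_ring m)"
    and van: "\<forall>P\<in>face_variety k. vanishes_at h p (P :: 'l ppoint)" for p
  proof (rule poly_mapping_eqI)
    fix w
    define D where "D = {z :: nat \<Rightarrow> 'l. (\<forall>j\<le>k. z j \<noteq> 0) \<and> (\<forall>j>k. z j = 0)}"
    have "lookup (theta k p) w = 0" if w: "w \<in> keys (theta k p)"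
    proof -
      have "h (lookup (theta k p) w) = 0"
      proof (rule characters_independent[of "keys (theta k p)"
            "\<lambda>j. if j \<le> k then 1 else 0" D "\<lambda>x y j. x j * y j" "\<lambda>w z. power_prod z w"])
        fix u v assume uv: "u \<in> keys (theta k p)" "v \<in> keys (theta k p)" "u \<noteq> v"
        then obtain j where j: "lookup u j \<noteq> lookup v j"
          using poly_mapping_eqI[of u v] by auto
        have uvk: "keys u \<subseteq> {..k}" "keys v \<subseteq> {..k}"
          using theta_keys uv by auto
        then have "j \<le> k"
          using j by (metis atMost_iff in_keys_iff subsetD)
        obtain s :: 'l where s: "s \<noteq> 0" "s ^ lookup u j \<noteq> s ^ lookup v j"
          using separating_scalar[OF j] by blast
        let ?y = "\<lambda>i. if i = j then s else if i \<le> k then 1 else 0"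
        have "power_prod ?y w = s ^ lookup w j" if "keys w \<subseteq> {..k}" for w
        proof -
          have "power_prod ?y w = (\<Prod>i\<le>k. ?y i ^ lookup w i)"
            by (rule power_prod_superset[OF _ that]) simp
          also have "\<dots> = (\<Prod>i\<le>k. if i = j then s ^ lookup w j else 1)"
            by (intro prod.cong refl) auto
          finally show ?thesis using \<open>j \<le> k\<close> by simp
        qed
        then show "\<exists>y\<in>D. power_prod y u \<noteq> power_prod y v"
          using s uvk \<open>j \<le> k\<close> by (intro bexI[of _ ?y]) (auto simp: D_def)
      next
        fix u assume "u \<in> keys (theta k p)"
        then have "keys u \<subseteq> {..k}" using theta_keys by blast
        then show "power_prod (\<lambda>j. if j \<le> k then 1 else 0 :: 'l) u = 1"
          by (subst power_prod_superset[of "{..k}"]) auto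
      next
        fix z assume z: "z \<in> D"
        then have "proj_class (torus_coords z) \<in> face_variety k"
          by (intro torus_point_mem) (auto simp: D_def)
        then have "peval h p (torus_coords z) = 0"
          using van proj_class_self by (auto simp: vanishes_at_def)
        then show "(\<Sum>w\<in>keys (theta k p). h (lookup (theta k p) w) * power_prod z w) = 0"
          using z peval_torus_coords[OF h p, of k z] by (auto simp: D_def mon_eval_def)
      qed (use w in \<open>auto simp: D_def power_prod_mult\<close>)
      then show ?thesis
        using field_map_eq_0[OF h] by blast
    qed
    then show "lookup (theta k p) w = lookup 0 w"
      by (cases "w \<in> keys (theta k p)") (auto simp: in_keys_iff)
  qed
  moreover have "vanishes_at h p P" if "p \<in> carrier (mpoly_ring m)" "theta k p = 0" "P \<in> face_variety k"
    for p and P :: "'l ppoint"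
    unfolding vanishes_at_def
  proof
    fix x assume "x \<in> P"
    then have "binomials_hold x" "\<And>i. i \<le> m \<Longrightarrow> \<not> keys (e i) \<subseteq> {..k} \<Longrightarrow> x i = 0"
      using that(3) unfolding face_variety_def by blast+
    then show "peval h p x = 0"
      using peval_eq_theta[OF h that(1), of x k] that(2) by simp
  qed
  ultimately show ?thesis
    by (auto simp: vanishing_ideal_def)
qed

end

section \<open>Irreducibility\<close>

lemma irreducible_closedI:
  fixes Z :: "'l::field ppoint set"
  assumes closed: "zariski_closed m Z" and "Z \<noteq> {}"
    and prime: "\<And>c d f g. form m c f \<Longrightarrow> form m d g \<Longrightarrow> \<forall>P\<in>Z. vanishes_at id (f * g) P \<Longrightarrow>
      (\<forall>P\<in>Z. vanishes_at id f P) \<or> (\<forall>P\<in>Z. vanishes_at id g P)"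
  shows "irreducible_closed m Z"
  unfolding irreducible_closed_def
proof (intro conjI allI impI)
  interpret field_map "id :: 'l \<Rightarrow> 'l" by (rule field_map_id)
  fix Z1 Z2 :: "'l ppoint set"
  assume Z12: "zariski_closed m Z1" "zariski_closed m Z2" "Z = Z1 \<union> Z2"
  obtain F1 where F1: "F1 \<subseteq> {p. \<exists>d. form m d p}" "Z1 = {P \<in> proj_space m. \<forall>p\<in>F1. vanishes_at id p P}"
    using Z12(1) by (auto simp: zariski_closed_def)
  obtain F2 where F2: "F2 \<subseteq> {p. \<exists>d. form m d p}" "Z2 = {P \<in> proj_space m. \<forall>p\<in>F2. vanishes_at id p P}"
    using Z12(2) by (auto simp: zariski_closed_def)
  have Zp: "Z \<subseteq> proj_space m" using closed by (auto simp: zariski_closed_def)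
  show "Z = Z1 \<or> Z = Z2"
  proof (rule ccontr)
    assume "\<not> (Z = Z1 \<or> Z = Z2)"
    then obtain P Q where PQ: "P \<in> Z" "P \<notin> Z1" "Q \<in> Z" "Q \<notin> Z2" using Z12(3) by auto
    obtain f where f: "f \<in> F1" "\<not> vanishes_at id f P" using PQ Zp F1(2) by auto
    obtain g where g: "g \<in> F2" "\<not> vanishes_at id g Q" using PQ Zp F2(2) by auto
    have "vanishes_at id (f * g) R" if "R \<in> Z" for R
      using that Z12(3) f(1) g(1) F1(2) F2(2) by (auto simp: vanishes_at_def peval_mult)
    moreover have "\<exists>c. form m c f" "\<exists>d. form m d g"
      using f(1) g(1) F1(1) F2(1) by blast+
    ultimately show False using prime f(2) g(2) PQ by blast
  qed
qed fact+

text \<open>The zeros of \<open>f\<close> in \<open>Z\<close> and those of \<open>g\<close> in \<open>Z\<close> are closed and cover \<open>Z\<close>.\<close>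

lemma irreducible_closed_prime:
  fixes Z :: "'l::field ppoint set"
  assumes irr: "irreducible_closed m Z" and f: "form m c f" and g: "form m d g"
    and van: "\<forall>P\<in>Z. vanishes_at id (f * g) P"
  shows "(\<forall>P\<in>Z. vanishes_at id f P) \<or> (\<forall>P\<in>Z. vanishes_at id g P)"
proof -
  interpret field_map "id :: 'l \<Rightarrow> 'l" by (rule field_map_id)
  obtain F where F: "F \<subseteq> {p. \<exists>d. form m d p}" "Z = {P \<in> proj_space m. \<forall>p\<in>F. vanishes_at id p P}"
    using irr by (auto simp: irreducible_closed_def zariski_closed_def)
  define W where "W q = {P \<in> proj_space m. \<forall>p\<in>insert q F. vanishes_at id p P}" for q
  have W_closed: "zariski_closed m (W q)" if "form m b q" for q b
  proof -
    have "insert q F \<subseteq> {p. \<exists>d. form m d p}" using F(1) that by blast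
    then show ?thesis
      unfolding W_def zariski_closed_def by (intro exI[of _ "insert q F"] conjI refl)
  qed
  note closed = W_closed[OF f] W_closed[OF g]
  have "vanishes_at id f P \<or> vanishes_at id g P" if P: "P \<in> Z" for P
  proof -
    obtain x where x: "x \<in> P" using P F(2) proj_space_ex by blast
    have "peval id f x * peval id g x = 0"
      using van P x by (auto simp: vanishes_at_def peval_mult)
    then show ?thesis
      using P F(2) form_vanishes_at_iff[OF field_map_id f _ x] form_vanishes_at_iff[OF field_map_id g _ x]
      by auto
  qed
  then have "Z = W f \<union> W g"
    unfolding W_def F(2) by blast
  then have "Z = W f \<or> Z = W g"
    using irr closed unfolding irreducible_closed_def by blast
  then show ?thesis by (auto simp: W_def)
qed

context flag_variety
begin

lemma theta_binomial:
  assumes "keys u \<subseteq> {..m}" "keys v \<subseteq> {..m}" "wt u = wt v"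
  shows "theta k (single u 1 - single v 1 :: 'c::field mpoly) = 0"
  using theta_add[of k "single u 1" "- single v (1 :: 'c)"] assms(3)
  by (simp add: theta_uminus theta_single)

lemma zariski_closed_face_variety: "zariski_closed m (face_variety k :: 'l::field ppoint set)"
proof -
  interpret field_map "id :: 'l \<Rightarrow> 'l" by (rule field_map_id)
  define B :: "'l mpoly set" where
    "B = {single u 1 + single v (-1) | u v. keys u \<subseteq> {..m} \<and>
      keys v \<subseteq> {..m} \<and> wt u = wt v}"
  define C :: "'l mpoly set" where
    "C = {single (single i 1) 1 | i. i \<le> m \<and> \<not> keys (e i) \<subseteq> {..k}}"
  have "B \<union> C \<subseteq> {p. \<exists>d. form m d p}"
  proof
    fix p assume "p \<in> B \<union> C"
    then consider u v where "p = single u 1 + single v (-1)"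
        "keys u \<subseteq> {..m}" "keys v \<subseteq> {..m}" "wt u = wt v"
      | i where "p = single (single i 1) 1" "i \<le> m"
      unfolding B_def C_def by blast
    then show "p \<in> {p. \<exists>d. form m d p}"
    proof cases
      case 1
      have "form m (lookup (wt u) 0) p"
        unfolding 1(1) by (intro form_add form_single) (simp_all add: 1 flip: wt_degree)
      then show ?thesis by blast
    next
      case 2
      then show ?thesis using form_var[of i m 1] by auto
    qed
  qed
  moreover have "P \<in> face_variety k \<longleftrightarrow> (\<forall>p\<in>B \<union> C. vanishes_at id p P)" if "P \<in> proj_space m" for P
  proof -
    have "(\<forall>p\<in>B. vanishes_at id p P) \<longleftrightarrow> (\<forall>x\<in>P. binomials_hold x)"
    proof
      assume *: "\<forall>p\<in>B. vanishes_at id p P"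
      show "\<forall>x\<in>P. binomials_hold x"
        unfolding binomials_hold_def
      proof (intro ballI allI impI)
        fix x u v assume "x \<in> P" "keys u \<subseteq> {..m}" "keys v \<subseteq> {..m}" "wt u = wt v"
        then have "peval id (single u 1 + single v (-1)) x = 0"
          using * unfolding B_def vanishes_at_def by blast
        then show "power_prod x u = power_prod x v"
          by (simp add: peval_add peval_single)
      qed
    next
      assume *: "\<forall>x\<in>P. binomials_hold x"
      show "\<forall>p\<in>B. vanishes_at id p P"
      proof
        fix p assume "p \<in> B"
        then obtain u v where uv: "p = single u 1 + single v (-1)"
          "keys u \<subseteq> {..m}" "keys v \<subseteq> {..m}" "wt u = wt v"
          unfolding B_def by blast
        show "vanishes_at id p P"
          unfolding vanishes_at_def
        proof
          fix x assume "x \<in> P"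
          then show "peval id p x = 0"
            using binomials_holdD[OF bspec[OF *] uv(2-4), of x] by (simp add: uv(1) peval_add peval_single)
        qed
      qed
    qed
    moreover have "(\<forall>p\<in>C. vanishes_at id p P) \<longleftrightarrow>
      (\<forall>x\<in>P. \<forall>i\<le>m. \<not> keys (e i) \<subseteq> {..k} \<longrightarrow> x i = 0)"
    proof -
      have "vanishes_at id (single (single i 1) 1 :: 'l mpoly) P \<longleftrightarrow> (\<forall>x\<in>P. x i = 0)" for i
        by (simp add: vanishes_at_def peval_single power_prod_single)
      then show ?thesis
        unfolding C_def by auto
    qed
    ultimately show ?thesis
      using that unfolding face_variety_def by blast
  qed
  ultimately show ?thesis
    unfolding zariski_closed_def
    by (intro exI[of _ "B \<union> C"] conjI set_eqI) (auto simp: face_variety_def)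
qed

lemma face_variety_nonempty: "(face_variety k :: 'l::field ppoint set) \<noteq> {}"
  using torus_point_mem[of "\<lambda>j. if j \<le> k then 1 else 0 :: 'l" k] by auto

lemma face_variety_vanishes_iff:
  fixes h :: "'c::field \<Rightarrow> 'l::alg_closed_field"
  assumes "field_map h" "p \<in> carrier (mpoly_ring m)"
  shows "(\<forall>P\<in>face_variety k :: 'l ppoint set. vanishes_at h p P) \<longleftrightarrow> theta k p = 0"
  using vanishing_ideal_face_variety[OF assms(1), of k] assms(2) by (auto simp: vanishing_ideal_def)

text \<open>The image of \<open>theta k\<close> lies in an integral domain.\<close>

lemma irreducible_face_variety: "irreducible_closed m (face_variety k :: 'l::alg_closed_field ppoint set)"
proof (rule irreducible_closedI)
  fix c d and f g :: "'l mpoly"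
  assume fg: "form m c f" "form m d g" "\<forall>P\<in>face_variety k. vanishes_at id (f * g) P"
  have "theta k (f * g) = 0"
    using fg face_variety_vanishes_iff[OF field_map_id form_mpoly[OF form_mult[OF fg(1,2)]]] by blast
  then have "theta k f = 0 \<or> theta k g = 0"
    by (simp add: theta_mult)
  then show "(\<forall>P\<in>face_variety k. vanishes_at id f P) \<or> (\<forall>P\<in>face_variety k. vanishes_at id g P)"
    using face_variety_vanishes_iff[OF field_map_id form_mpoly[OF fg(1)]]
      face_variety_vanishes_iff[OF field_map_id form_mpoly[OF fg(2)]] by blast
qed (rule zariski_closed_face_variety face_variety_nonempty)+

end


section \<open>The ideal is defined over the base field\<close>

lemma cring_of_subset:
  fixes C :: "'a::comm_ring_1 set"
  assumes "0 \<in> C" "1 \<in> C" "\<And>x y. x \<in> C \<Longrightarrow> y \<in> C \<Longrightarrow> x + y \<in> C"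
      "\<And>x y. x \<in> C \<Longrightarrow> y \<in> C \<Longrightarrow> x * y \<in> C" "\<And>x. x \<in> C \<Longrightarrow> - x \<in> C"
  shows "cring (set_ring C)" (is "cring ?R")
proof (rule cringI)
  show "abelian_group ?R"
  proof (rule abelian_groupI)
    fix x assume "x \<in> carrier ?R"
    then show "\<exists>y\<in>carrier ?R. y \<oplus>\<^bsub>?R\<^esub> x = \<zero>\<^bsub>?R\<^esub>"
      using assms(5) by (intro bexI[of _ "- x"]) auto
  qed (use assms in \<open>auto simp: add_ac\<close>)
  show "comm_monoid ?R"
    by (rule comm_monoidI) (use assms in \<open>auto simp: mult_ac\<close>)
qed (auto simp: distrib_right)

lemma mpoly_ring_cring: "cring (mpoly_ring m :: 'c::field mpoly ring)"
  unfolding mpoly_ring_def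
proof (rule cring_of_subset)
  fix p q :: "'c mpoly"
  assume pq: "p \<in> {p. \<forall>u\<in>keys p. keys u \<subseteq> {..m}}"
    "q \<in> {p. \<forall>u\<in>keys p. keys u \<subseteq> {..m}}"
  show "p + q \<in> {p. \<forall>u\<in>keys p. keys u \<subseteq> {..m}}"
    using pq Poly_Mapping.keys_add[of p q] by blast
  show "p * q \<in> {p. \<forall>u\<in>keys p. keys u \<subseteq> {..m}}"
  proof (intro CollectI ballI)
    fix w assume "w \<in> keys (p * q)"
    then obtain u v where "w = u + v" "u \<in> keys p" "v \<in> keys q"
      using keys_mult[of p q] by blast
    then show "keys w \<subseteq> {..m}"
      using pq Poly_Mapping.keys_add[of u v] by blast
  qed
qed auto

context flag_variety
begin

definition flag_algebra :: "'c::field mpoly ring" where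
  "flag_algebra = set_ring (monoid_algebra M)"

lemma flag_algebra_cring: "cring (flag_algebra :: 'c::field mpoly ring)"
  unfolding flag_algebra_def
  by (rule cring_of_subset) (auto intro: algebra_zero algebra_one algebra_add algebra_mult algebra_uminus)

lemma theta_hom: "ring_hom_ring (mpoly_ring m) (flag_algebra :: 'c::field mpoly ring) (theta N)"
  by (intro ring_hom_ringI2 cring.axioms mpoly_ring_cring flag_algebra_cring ring_hom_memI)
    (auto simp: flag_algebra_def mpoly_ring_def theta_mem theta_add theta_mult theta_one)

lemma theta_kernel:
  fixes h :: "'c::field \<Rightarrow> 'l::alg_closed_field"
  assumes "field_map h"
  shows "a_kernel (mpoly_ring m) flag_algebra (theta N) = vanishing_ideal h m (face_variety N :: 'l ppoint set)"
  unfolding vanishing_ideal_face_variety[OF assms] by (auto simp: a_kernel_def' flag_algebra_def)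

lemma vanishing_ideal_ideal:
  fixes h :: "'c::field \<Rightarrow> 'l::alg_closed_field"
  assumes "field_map h"
  shows "ideal (vanishing_ideal h m (face_variety N :: 'l ppoint set)) (mpoly_ring m)"
  unfolding theta_kernel[OF assms, symmetric] by (rule ring_hom_ring.kernel_is_ideal[OF theta_hom])

text \<open>
  Grouping the terms of a polynomial in the kernel of \<open>theta N\<close> by weight exhibits it as a linear
  combination of differences of monomials of equal weight.
\<close>

lemma kernel_in_binomial_ideal:
  fixes p :: "'c::field mpoly"
  assumes I: "ideal I (mpoly_ring m)" and p: "p \<in> carrier (mpoly_ring m)" "theta N p = 0"
    and bin: "\<And>u v. keys u \<subseteq> {..m} \<Longrightarrow> keys v \<subseteq> {..m} \<Longrightarrow> wt u = wt v \<Longrightarrow>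
      single u 1 - single v 1 \<in> I"
  shows "p \<in> I"
proof -
  interpret ideal I "mpoly_ring m" by (rule I)
  define s where "s t = (SOME u. keys u \<subseteq> {..m} \<and> wt u = t)" for t
  have s: "keys (s t) \<subseteq> {..m}" "wt (s t) = t" if "t \<in> M" for t
    using someI_ex[OF wt_surj[OF that]] by (auto simp: s_def)
  let ?l = "lookup p"
  define T where "T f = mon_eval (single 0) (\<lambda>w. single (s w) 1) f"
    for f :: "'c mpoly"
  have "T (theta N p) = (\<Sum>u\<in>keys p. T (theta N (single u (?l u))))"
    by (subst poly_mapping_expand[of p])
      (simp only: theta_sum T_def semiring_map.mon_eval_sum[OF semiring_map_single])
  also have "\<dots> = (\<Sum>u\<in>keys p. single (s (wt u)) (?l u))"
    using M_keys[OF wt_mem]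
    by (simp add: theta_single T_def semiring_map.mon_eval_single[OF semiring_map_single] mult_single)
  also have "T (theta N p) = 0"
    unfolding p(2) T_def by (rule semiring_map.mon_eval_zero[OF semiring_map_single])
  finally have *: "(\<Sum>u\<in>keys p. single (s (wt u)) (?l u)) = 0"
    by (rule sym)
  have "p = (\<Sum>u\<in>keys p. single u (?l u))
      - (\<Sum>u\<in>keys p. single (s (wt u)) (?l u))"
    unfolding * using poly_mapping_expand[of p] by simp
  also have "\<dots> = (\<Sum>u\<in>keys p.
      single 0 (?l u) * (single u 1 - single (s (wt u)) 1))"
    by (simp add: right_diff_distrib mult_single flip: sum_subtractf)
  also have "\<dots> \<in> I"
  proof -
    have sum_mem: "sum f A \<in> I" if "\<And>a. a \<in> A \<Longrightarrow> f a \<in> I" for f and A :: "(nat \<Rightarrow>\<^sub>0 nat) set"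
      using that
    proof (induction A rule: infinite_finite_induct)
      case (insert a A)
      then show ?case
        using additive_subgroup.a_closed[OF is_additive_subgroup, of "f a" "sum f A"] by (simp add: mpoly_ring_def)
    qed (use additive_subgroup.zero_closed[OF is_additive_subgroup] in \<open>auto simp: mpoly_ring_def\<close>)
    have "single 0 (?l u) * (single u 1 - single (s (wt u)) 1) \<in> I"
      if "u \<in> keys p" for u
    proof -
      have "single u 1 - single (s (wt u)) 1 \<in> I"
        using that p(1) s[OF wt_mem] by (intro bin) (auto simp: mpoly_ring_def)
      moreover have "single 0 (?l u) \<in> carrier (mpoly_ring m)"
        by (simp add: mpoly_ring_def)
      ultimately show ?thesis
        using I_l_closed by (auto simp: mpoly_ring_def)
    qed
    then show ?thesis by (rule sum_mem)
  qed
  finally show ?thesis .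
qed

text \<open>The binomials generating the ideal have coefficients \<open>1\<close> and \<open>-1\<close>, hence lie over the base field.\<close>

theorem irreducible_projective_face_variety:
  "irreducible_projective_variety m (face_variety N :: 'k::field alg_closure ppoint set)"
  unfolding irreducible_projective_variety_def
proof (intro conjI equalityI)
  let ?V = "face_variety N :: 'k alg_closure ppoint set"
  let ?J = "Poly_Mapping.map to_ac ` (vanishing_ideal to_ac m ?V :: 'k mpoly set)"
  interpret cring "mpoly_ring m :: 'k alg_closure mpoly ring" by (rule mpoly_ring_cring)
  show "irreducible_closed m ?V" by (rule irreducible_face_variety)
  have J_sub: "?J \<subseteq> vanishing_ideal id m ?V"
  proof
    fix q assume "q \<in> ?J"
    then obtain p :: "'k mpoly" where p: "p \<in> vanishing_ideal to_ac m ?V" "q = Poly_Mapping.map to_ac p"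
      by blast
    have keys: "keys q = keys p"
      by (auto simp: p(2) in_keys_iff map.rep_eq when_def)
    have "lookup q u = to_ac (lookup p u)" for u
      by (simp add: p(2) map.rep_eq when_def)
    then have "peval id q x = peval to_ac p x" for x
      by (simp add: peval_def keys)
    then show "q \<in> vanishing_ideal id m ?V"
      using p(1) keys by (simp add: vanishing_ideal_def vanishes_at_def mpoly_ring_def)
  qed
  then show "Idl\<^bsub>mpoly_ring m\<^esub> ?J \<subseteq> vanishing_ideal id m ?V"
    by (intro genideal_minimal vanishing_ideal_ideal field_map_id)
  have J_car: "?J \<subseteq> carrier (mpoly_ring m)"
    using J_sub by (auto simp: vanishing_ideal_def)
  show "vanishing_ideal id m ?V \<subseteq> Idl\<^bsub>mpoly_ring m\<^esub> ?J"
  proof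
    fix p assume "p \<in> vanishing_ideal id m ?V"
    then have "p \<in> carrier (mpoly_ring m)" "theta N p = 0"
      by (auto simp: vanishing_ideal_face_variety[OF field_map_id])
    then show "p \<in> Idl\<^bsub>mpoly_ring m\<^esub> ?J"
    proof (rule kernel_in_binomial_ideal[OF genideal_ideal[OF J_car]])
      fix u v assume uv: "keys u \<subseteq> {..m}" "keys v \<subseteq> {..m}" "wt u = wt v"
      let ?b = "single u 1 - single v 1 :: 'k mpoly"
      have "keys ?b \<subseteq> {u, v}"
        by (auto simp: in_keys_iff lookup_minus lookup_single when_def split: if_splits)
      then have "?b \<in> vanishing_ideal to_ac m ?V"
        using uv theta_binomial[OF uv]
        by (auto simp: vanishing_ideal_face_variety[OF field_map_to_ac] mpoly_ring_def)
      moreover have "single u 1 - single v 1 = Poly_Mapping.map to_ac ?b"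
        by (rule poly_mapping_eqI) (auto simp: map.rep_eq lookup_minus lookup_single when_def)
      ultimately show "single u 1 - single v 1 \<in> Idl\<^bsub>mpoly_ring m\<^esub> ?J"
        using genideal_self[OF J_car] by blast
    qed
  qed
qed

end


section \<open>Dimension\<close>

text \<open>Gaussian elimination: each \<open>b\<close> is used to eliminate one of the vectors.\<close>

lemma linear_dependence:
  fixes v :: "'i \<Rightarrow> 'b \<Rightarrow> 'l::field"
  assumes "finite B" "finite I" "card B < card I"
  shows "\<exists>c. (\<exists>i\<in>I. c i \<noteq> 0) \<and> (\<forall>b\<in>B. (\<Sum>i\<in>I. c i * v i b) = 0)"
  using assms
proof (induction B arbitrary: I v rule: finite_induct)
  case empty
  then show ?case by (intro exI[of _ "\<lambda>_. 1"]) (auto simp: card_gt_0_iff)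
next
  case (insert b B)
  show ?case
  proof (cases "\<forall>i\<in>I. v i b = 0")
    case True
    obtain c where "\<exists>i\<in>I. c i \<noteq> 0" "\<forall>b\<in>B. (\<Sum>i\<in>I. c i * v i b) = 0"
      using insert.IH[of I v] insert.prems insert.hyps by auto
    then show ?thesis
      using True by (intro exI[of _ c]) auto
  next
    case False
    then obtain k where k: "k \<in> I" "v k b \<noteq> 0" by blast
    define w where "w i b' = v i b' - v i b / v k b * v k b'" for i b'
    have "card B < card (I - {k})"
      using insert.prems insert.hyps k by simp
    then obtain c where c: "\<exists>i\<in>I - {k}. c i \<noteq> 0" "\<forall>b\<in>B. (\<Sum>i\<in>I - {k}. c i * w i b) = 0"
      using insert.IH[of "I - {k}" w] insert.prems by auto
    define a where "a = (\<Sum>i\<in>I - {k}. c i * v i b) / v k b"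
    have sum: "(\<Sum>i\<in>I. (if i = k then - a else c i) * v i b') = (\<Sum>i\<in>I - {k}. c i * w i b')" for b'
    proof -
      have "(\<Sum>i\<in>I. (if i = k then - a else c i) * v i b') = - a * v k b' + (\<Sum>i\<in>I - {k}. c i * v i b')"
        using k insert.prems by (subst sum.remove[of _ k]) auto
      also have "\<dots> = (\<Sum>i\<in>I - {k}. c i * w i b')"
      proof -
        have "a * v k b' = (\<Sum>i\<in>I - {k}. c i * (v i b / v k b * v k b'))"
          by (simp add: a_def sum_divide_distrib sum_distrib_right mult.assoc)
        then show ?thesis
          by (simp add: w_def right_diff_distrib sum_subtractf)
      qed
      finally show ?thesis .
    qed
    have "(\<Sum>i\<in>I - {k}. c i * w i b) = 0"
      using k by (simp add: w_def)
    then show ?thesis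
      using c sum by (intro exI[of _ "\<lambda>i. if i = k then - a else c i"]) auto
  qed
qed

text \<open>
  Along a chain of irreducible closed sets, choose forms of equal degree of which the \<open>i\<close>-th one
  vanishes on the member before the \<open>i\<close>-th but not on the \<open>i\<close>-th. They are algebraically
  independent on the last member: in a relation, the terms free of the last form give a relation
  on the member before it, hence are absent, and then the last form can be cancelled.
\<close>

lemma chain_forms_independent:
  fixes Z :: "nat \<Rightarrow> 'l::field ppoint set" and F :: "nat \<Rightarrow> 'l mpoly"
  assumes "\<And>i. i \<le> l \<Longrightarrow> irreducible_closed m (Z i)"
    and "\<And>i. i < l \<Longrightarrow> Z i \<subseteq> Z (Suc i)"
    and "\<And>i. i \<le> l \<Longrightarrow> form m D (F i)"
    and "\<And>i. i < l \<Longrightarrow> \<forall>P\<in>Z i. vanishes_at id (F (Suc i)) P"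
    and "\<And>i. i \<le> l \<Longrightarrow> \<exists>P\<in>Z i. \<not> vanishes_at id (F i) P"
    and "finite I" "\<And>a. a \<in> I \<Longrightarrow> (\<Sum>i\<le>l. a i) = n" "\<And>a i. a \<in> I \<Longrightarrow> i > l \<Longrightarrow> a i = 0"
    and "\<And>P x. P \<in> Z l \<Longrightarrow> x \<in> P \<Longrightarrow> (\<Sum>a\<in>I. c a * (\<Prod>i\<le>l. peval id (F i) x ^ a i)) = 0"
  shows "\<forall>a\<in>I. c a = 0"
  using assms
proof (induction l arbitrary: n I c)
  case 0
  show ?case
  proof
    fix a assume a: "a \<in> I"
    have "b = a" if "b \<in> I" for b
    proof
      fix i
      show "b i = a i"
        using "0.prems"(7)[OF that] "0.prems"(7)[OF a] "0.prems"(8)[OF that, of i] "0.prems"(8)[OF a, of i]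
        by (cases "i = 0") auto
    qed
    then have "I = {a}" using a by blast
    moreover obtain P x where "P \<in> Z 0" "x \<in> P" "peval id (F 0) x \<noteq> 0"
      using "0.prems"(5)[of 0] unfolding vanishes_at_def by blast
    ultimately show "c a = 0"
      using "0.prems"(9)[of P x] by (simp add: id_def)
  qed
next
  case (Suc l)
  interpret field_map "id :: 'l \<Rightarrow> 'l" by (rule field_map_id)
  note irr = Suc.prems(1) and sub = Suc.prems(2) and F = Suc.prems(3) and van = Suc.prems(4)
    and nonvan = Suc.prems(5)
  let ?v = "\<lambda>l a x. \<Prod>i\<le>l. peval id (F i) x ^ a i"
  have low: "\<forall>a\<in>{a \<in> I. a (Suc l) = 0}. c a = 0"
    if I: "finite I" "\<And>a. a \<in> I \<Longrightarrow> (\<Sum>i\<le>Suc l. a i) = n" "\<And>a i. a \<in> I \<Longrightarrow> i > Suc l \<Longrightarrow> a i = 0"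
      and rel: "\<And>P x. P \<in> Z (Suc l) \<Longrightarrow> x \<in> P \<Longrightarrow> (\<Sum>a\<in>I. c a * ?v (Suc l) a x) = 0" for I n c
  proof (rule Suc.IH[of "{a \<in> I. a (Suc l) = 0}" n])
    fix P x assume Px: "P \<in> Z l" "x \<in> P"
    then have F0: "peval id (F (Suc l)) x = 0"
      using van[of l] by (auto simp: vanishes_at_def id_def)
    have "(\<Sum>a\<in>{a \<in> I. a (Suc l) = 0}. c a * ?v l a x) = (\<Sum>a\<in>I. c a * ?v (Suc l) a x)"
      using I(1) F0 by (intro sum.mono_neutral_cong_left) auto
    then show "(\<Sum>a\<in>{a \<in> I. a (Suc l) = 0}. c a * ?v l a x) = 0"
      using rel[of P x] sub[of l] Px by auto
  next
    fix b i assume b: "b \<in> {a \<in> I. a (Suc l) = 0}" "i > l"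
    then show "b i = 0"
      using I(3)[of b i] by (cases "i = Suc l") auto
  next
    fix b assume b: "b \<in> {a \<in> I. a (Suc l) = 0}"
    then show "(\<Sum>i\<le>l. b i) = n"
      using I(2)[of b] by simp
  qed (use I Suc.prems in auto)
  show ?case
    using Suc.prems(6-9)
  proof (induction n arbitrary: I c)
    case 0
    have "a (Suc l) = 0" if "a \<in> I" for a
      using "0.prems"(2)[OF that] by simp
    moreover have "\<forall>a\<in>{a \<in> I. a (Suc l) = 0}. c a = 0"
      by (rule low[of I 0 c]) (fact "0.prems")+
    ultimately show ?case by blast
  next
    case (Suc n)
    have "\<forall>a\<in>{a \<in> I. a (Suc l) = 0}. c a = 0"
      by (rule low[of I "Suc n" c]) (fact Suc.prems)+
    then have c0: "c a = 0" if "a \<in> I" "a (Suc l) = 0" for a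
      using that by blast
    define J where "J = {a \<in> I. a (Suc l) \<noteq> 0}"
    define dn where "dn a = a(Suc l := a (Suc l) - 1)" for a :: "nat \<Rightarrow> nat"
    define up where "up a = a(Suc l := a (Suc l) + 1)" for a :: "nat \<Rightarrow> nat"
    have up_dn: "up (dn a) = a" if "a \<in> J" for a
      using that by (auto simp: up_def dn_def J_def)
    have inj: "inj_on dn J"
      using up_dn by (metis inj_onI)
    have v_dn: "?v (Suc l) a x = peval id (F (Suc l)) x * ?v (Suc l) (dn a) x" if "a \<in> J" for a x
    proof -
      have "?v l (dn a) x = ?v l a x"
        by (intro prod.cong) (auto simp: dn_def)
      moreover have "peval id (F (Suc l)) x ^ a (Suc l)
          = peval id (F (Suc l)) x * peval id (F (Suc l)) x ^ (dn a (Suc l))"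
        using that by (simp add: dn_def J_def flip: power_Suc)
      ultimately show ?thesis by (simp add: mult_ac)
    qed
    define G where "G = (\<Sum>a\<in>dn ` J. single 0 (c (up a)) * (\<Prod>i\<le>Suc l. F i ^ a i))"
    have G_val: "peval id G x = (\<Sum>a\<in>dn ` J. c (up a) * ?v (Suc l) a x)" for x
      by (simp add: G_def peval_sum peval_mult peval_single peval_prod peval_power del: prod.atMost_Suc)
    have split: "(\<Sum>a\<in>I. c a * ?v (Suc l) a x) = peval id (F (Suc l) * G) x" for x
    proof -
      have "(\<Sum>a\<in>I. c a * ?v (Suc l) a x) = (\<Sum>a\<in>J. c a * ?v (Suc l) a x)"
        using Suc.prems(1) c0 by (intro sum.mono_neutral_right) (auto simp: J_def)
      also have "\<dots> = (\<Sum>a\<in>J. c (up (dn a)) * (peval id (F (Suc l)) x * ?v (Suc l) (dn a) x))"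
        by (intro sum.cong refl) (simp only: v_dn up_dn)
      also have "\<dots> = peval id (F (Suc l)) x * peval id G x"
        unfolding G_val by (simp add: sum.reindex[OF inj] sum_distrib_left mult_ac del: prod.atMost_Suc)
      finally show ?thesis by (simp add: peval_mult)
    qed
    have J_sum: "(\<Sum>i\<le>Suc l. a i) = n" if a: "a \<in> dn ` J" for a
    proof -
      obtain b where b: "b \<in> J" "a = dn b" using a by blast
      have "(\<Sum>i\<le>l. dn b i) = (\<Sum>i\<le>l. b i)"
        by (intro sum.cong) (auto simp: dn_def)
      then show ?thesis
        using b Suc.prems(2)[of b] by (auto simp: J_def dn_def)
    qed
    have G_form: "form m (n * D) G"
      unfolding G_def
    proof (intro form_sum form_scale)
      fix a assume "a \<in> dn ` J"
      then have "(\<Sum>i\<le>Suc l. a i * D) = n * D"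
        using J_sum by (simp only: flip: sum_distrib_right)
      moreover have "form m (\<Sum>i\<le>Suc l. a i * D) (\<Prod>i\<le>Suc l. F i ^ a i)"
        by (intro form_prod form_power F) auto
      ultimately show "form m (n * D) (\<Prod>i\<le>Suc l. F i ^ a i)" by simp
    qed
    have "\<forall>P\<in>Z (Suc l). vanishes_at id (F (Suc l) * G) P"
      using Suc.prems(4) split by (auto simp: vanishes_at_def id_def)
    then have G_van: "\<forall>P\<in>Z (Suc l). vanishes_at id G P"
      using irreducible_closed_prime[OF irr F G_form, of "Suc l" "Suc l"] nonvan[of "Suc l"] by blast
    have "\<forall>a\<in>dn ` J. (c \<circ> up) a = 0"
    proof (rule Suc.IH)
      fix P x assume "P \<in> Z (Suc l)" "x \<in> P"
      then show "(\<Sum>a\<in>dn ` J. (c \<circ> up) a * ?v (Suc l) a x) = 0"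
        using G_van by (simp add: vanishes_at_def G_val)
    next
      fix a i assume "a \<in> dn ` J" "i > Suc l"
      then show "a i = 0"
        using Suc.prems(3) by (auto simp: dn_def J_def)
    qed (use J_sum Suc.prems(1) in \<open>auto simp: J_def\<close>)
    then show ?case
      using c0 up_dn by (auto simp: J_def)
  qed
qed

context flag_variety
begin

lemma theta_eq_0_of_relation:
  fixes G :: "'i \<Rightarrow> 'l::field mpoly"
  assumes G: "\<And>i. i \<in> I \<Longrightarrow> form m d (G i)"
    and rel: "\<And>t. t \<in> Mdeg d \<Longrightarrow> (\<Sum>i\<in>I. c i * lookup (theta N (G i)) t) = 0"
  shows "theta N (\<Sum>i\<in>I. single 0 (c i) * G i) = 0"
proof (rule poly_mapping_eqI)
  fix t
  have lookup: "lookup (single 0 a * f) t = a * lookup f t"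
    for a :: 'l and f :: "'l mpoly"
    by (simp add: map.rep_eq when_def flip: mult_map_scale_conv_mult)
  have "lookup (theta N (G i)) t = 0" if "i \<in> I" "t \<notin> Mdeg d" for i
    using theta_form_mem[OF G[OF that(1)], of N] that(2) by (auto simp: monoid_algebra_def in_keys_iff)
  then have "(\<Sum>i\<in>I. c i * lookup (theta N (G i)) t) = 0"
    using rel[of t] by (cases "t \<in> Mdeg d") auto
  then show "lookup (theta N (\<Sum>i\<in>I. single 0 (c i) * G i)) t
      = lookup 0 t"
    by (simp add: theta_sum theta_mult theta_single lookup_sum lookup)
qed

lemma Mdeg_card_le: "card (Mdeg (c * n)) \<le> (((\<Sum>i\<in>{1..N}. \<beta> i) * c + 1) * (n + 1)) ^ N"
proof -
  let ?C = "(\<Sum>i\<in>{1..N}. \<beta> i) * c + 1"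
  have "card (Mdeg (c * n)) \<le> (\<Prod>i\<in>{1..N}. \<beta> i * (c * n) + 1)"
    by (rule Mdeg_card)
  also have "\<dots> \<le> (\<Prod>i\<in>{1..N}. ?C * (n + 1))"
  proof (intro prod_mono conjI)
    fix i assume "i \<in> {1..N}"
    then have "\<beta> i \<le> (\<Sum>i\<in>{1..N}. \<beta> i)"
      by (intro member_le_sum) auto
    then have "\<beta> i * (c * n) \<le> (\<Sum>i\<in>{1..N}. \<beta> i) * (c * n)"
      by (rule mult_right_mono) simp
    moreover have "(\<Sum>i\<in>{1..N}. \<beta> i) * (c * n) + 1 \<le> ?C * (n + 1)"
      by (simp add: algebra_simps)
    ultimately show "\<beta> i * (c * n) + 1 \<le> ?C * (n + 1)"
      by linarith
  qed simp
  finally show ?thesis by simp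
qed

text \<open>
  The degree \<open>n D\<close> part of the algebra grows like \<open>n\<^sup>N\<close>, while a chain of length \<open>N + 1\<close>
  would provide about \<open>n\<^bsup>N+1\<^esup>\<close> linearly independent elements in degree
  \<open>(N + 1) n D\<close>.
\<close>

lemma no_long_chain:
  fixes Z :: "nat \<Rightarrow> 'l::alg_closed_field ppoint set"
  assumes Z: "\<And>i. i \<le> N + 1 \<Longrightarrow> irreducible_closed m (Z i)"
    and V: "\<And>i. i \<le> N + 1 \<Longrightarrow> Z i \<subseteq> face_variety N"
    and chain: "\<And>i. i < N + 1 \<Longrightarrow> Z i \<subset> Z (Suc i)"
  shows False
proof -
  interpret field_map "id :: 'l \<Rightarrow> 'l" by (rule field_map_id)
  have Zp: "Z i \<subseteq> proj_space m" "Z i \<noteq> {}" if "i \<le> N + 1" for i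
    using Z[OF that] by (auto simp: irreducible_closed_def zariski_closed_def)
  have "\<exists>f d. form m d f \<and> d > 0 \<and> (\<exists>P\<in>Z i. \<not> vanishes_at id f P) \<and>
      (\<forall>j. i = Suc j \<longrightarrow> (\<forall>P\<in>Z j. vanishes_at id f P))" if i: "i \<le> N + 1" for i
  proof (cases i)
    case 0
    obtain P where P: "P \<in> Z i" using Zp[OF i] by auto
    then obtain x where x: "x \<in> P" "P \<in> proj_space m" using Zp[OF i] proj_space_ex by blast
    obtain j where j: "j \<le> m" "x j \<noteq> 0" using proj_space_memD(3)[OF x(2,1)] by blast
    have "\<not> vanishes_at id (single (single j 1) 1 :: 'l mpoly) P"
      using x j by (auto simp: vanishes_at_def peval_single power_prod_single)
    then show ?thesis
      using form_var[OF j(1), of 1] P 0 zero_less_one by blast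
  next
    case (Suc j)
    then have j: "j < N + 1" using i by simp
    obtain P where P: "P \<in> Z i" "P \<notin> Z j" using chain[OF j] Suc by auto
    obtain F where F: "F \<subseteq> {p. \<exists>d. form m d p}" "Z j = {P \<in> proj_space m. \<forall>p\<in>F. vanishes_at id p P}"
      using Z[of j] j by (auto simp: irreducible_closed_def zariski_closed_def)
    obtain f where f: "f \<in> F" "\<not> vanishes_at id f P"
      using P Zp(1)[OF i] F(2) by auto
    obtain d where d: "form m d f" using f(1) F(1) by auto
    have van: "\<forall>P\<in>Z j. vanishes_at id f P" using f(1) F(2) by auto
    have "d > 0"
    proof (rule ccontr)
      assume "\<not> d > 0"
      then have d0: "form m 0 f" using d by simp
      \<comment> \<open>A form of degree zero is constant, and it vanishes somewhere.\<close>
      have "peval id f x = peval id f (\<lambda>i. 0 * x i)" for x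
        using peval_scale_point[OF d0, of 0 x] by simp
      then have const: "peval id f x = peval id f (\<lambda>_. 0)" for x by simp
      obtain Q y where Q: "Q \<in> Z j" "y \<in> Q"
        using Zp[of j] j proj_space_ex by (metis ex_in_conv less_imp_le subsetD)
      have "peval id f y = 0" using van Q by (auto simp: vanishes_at_def)
      then have "peval id f x = 0" for x using const by metis
      then show False using f(2) by (simp add: vanishes_at_def)
    qed
    then show ?thesis using d f van P(1) Suc by blast
  qed
  then obtain f d where f: "\<And>i. i \<le> N + 1 \<Longrightarrow> form m (d i) (f i)" "\<And>i. i \<le> N + 1 \<Longrightarrow> d i > 0"
    "\<And>i. i \<le> N + 1 \<Longrightarrow> \<exists>P\<in>Z i. \<not> vanishes_at id (f i) P"
    "\<And>j. Suc j \<le> N + 1 \<Longrightarrow> \<forall>P\<in>Z j. vanishes_at id (f (Suc j)) P"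
    by metis
  define D where "D = (\<Prod>i\<le>N + 1. d i)"
  define F where "F i = f i ^ (D div d i)" for i
  have dvd: "d i dvd D" if "i \<le> N + 1" for i
    unfolding D_def using that by (intro dvd_prodI) auto
  have "D > 0" unfolding D_def using f(2) by (intro prod_pos) auto
  then have Dd: "D div d i > 0" if "i \<le> N + 1" for i
    using that dvd f(2) by (metis dvd_div_eq_0_iff neq0_conv)
  have F_form: "form m D (F i)" if "i \<le> N + 1" for i
    using form_power[OF f(1)[OF that], of "D div d i"] dvd[OF that] by (simp add: F_def)
  have F_van: "\<forall>P\<in>Z i. vanishes_at id (F (Suc i)) P" if "i < N + 1" for i
    using f(4)[of i] Dd[of "Suc i"] that by (auto simp: vanishes_at_def F_def peval_power)
  have F_nonvan: "\<exists>P\<in>Z i. \<not> vanishes_at id (F i) P" if "i \<le> N + 1" for i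
    using f(3)[OF that] by (auto simp: vanishes_at_def F_def peval_power)
  let ?l = "N + 1"
  define C where "C = (\<Sum>i\<in>{1..N}. \<beta> i) * (?l * D) + 1"
  \<comment> \<open>With this choice \<open>(C (n + 1))\<^sup>N = n (n + 1)\<^sup>N < (n + 1)\<^bsup>N+1\<^esup>\<close>.\<close>
  define n where "n = C ^ N"
  \<comment> \<open>The exponent of the first form fills up the total degree.\<close>
  define \<phi> where "\<phi> a i = (if i = 0 then ?l * n - (\<Sum>i\<in>{1..?l}. a i) else if i \<le> ?l then a i else 0)"
    for a :: "nat \<Rightarrow> nat" and i
  define I0 where "I0 = (\<Pi>\<^sub>E i\<in>{1..?l}. {..n})"
  have I0: "finite I0" "card I0 = (n + 1) ^ ?l"
    by (auto simp: I0_def card_PiE intro: finite_PiE)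
  have inj: "inj_on \<phi> I0"
  proof (rule inj_onI)
    fix a b assume ab: "a \<in> I0" "b \<in> I0" "\<phi> a = \<phi> b"
    show "a = b"
    proof (rule PiE_ext)
      show "a \<in> (\<Pi>\<^sub>E i\<in>{1..?l}. {..n})" "b \<in> (\<Pi>\<^sub>E i\<in>{1..?l}. {..n})" using ab by (auto simp: I0_def)
      fix i assume "i \<in> {1..?l}"
      then show "a i = b i" using fun_cong[OF ab(3), of i] by (simp add: \<phi>_def)
    qed
  qed
  have sum_a: "(\<Sum>i\<le>?l. a i) = ?l * n" if a: "a \<in> \<phi> ` I0" for a
  proof -
    obtain b where b: "b \<in> I0" "a = \<phi> b" using a by blast
    have "(\<Sum>i\<in>{1..?l}. b i) \<le> (\<Sum>i\<in>{1..?l}. n)"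
      using b(1) by (intro sum_mono) (auto simp: I0_def PiE_iff)
    then have le: "(\<Sum>i\<in>{1..?l}. b i) \<le> ?l * n" by simp
    have "{..?l} = insert 0 {1..?l}" by auto
    then have "(\<Sum>i\<le>?l. a i) = a 0 + (\<Sum>i\<in>{1..?l}. a i)" by simp
    also have "(\<Sum>i\<in>{1..?l}. a i) = (\<Sum>i\<in>{1..?l}. b i)"
      unfolding b(2) by (intro sum.cong refl) (auto simp: \<phi>_def)
    also have "a 0 = ?l * n - (\<Sum>i\<in>{1..?l}. b i)"
      unfolding b(2) by (simp add: \<phi>_def)
    finally show ?thesis using le by simp
  qed
  define G where "G a = (\<Prod>i\<le>?l. F i ^ a i)" for a
  have G_form: "form m (?l * D * n) (G a)" if "a \<in> \<phi> ` I0" for a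
  proof -
    have "(\<Sum>i\<le>?l. a i * D) = ?l * D * n"
      using sum_a[OF that] by (metis sum_distrib_right mult.commute mult.left_commute)
    moreover have "form m (\<Sum>i\<le>?l. a i * D) (G a)"
      unfolding G_def by (intro form_prod form_power F_form) auto
    ultimately show ?thesis by simp
  qed
  have "card (Mdeg (?l * D * n)) \<le> (C * (n + 1)) ^ N"
    using Mdeg_card_le[of "?l * D" n] by (simp add: C_def)
  also have "\<dots> = n * (n + 1) ^ N"
    by (simp only: power_mult_distrib n_def)
  also have "\<dots> < (n + 1) ^ ?l"
    by simp
  also have "\<dots> = card (\<phi> ` I0)"
    using card_image[OF inj] I0(2) by simp
  finally have "card (Mdeg (?l * D * n)) < card (\<phi> ` I0)" .
  from linear_dependence[OF Mdeg_card(1) finite_imageI[OF I0(1)] this,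
      of "\<lambda>a t. lookup (theta N (G a)) t"]
  obtain c where c: "\<exists>a\<in>\<phi> ` I0. c a \<noteq> 0"
    "\<forall>t\<in>Mdeg (?l * D * n). (\<Sum>a\<in>\<phi> ` I0. c a * lookup (theta N (G a)) t) = 0"
    by (elim exE conjE)
  define Q where "Q = (\<Sum>a\<in>\<phi> ` I0. single 0 (c a) * G a)"
  have "theta N Q = 0"
    unfolding Q_def using G_form c(2) by (intro theta_eq_0_of_relation) auto
  moreover have "form m (?l * D * n) Q"
    unfolding Q_def by (intro form_sum form_scale G_form)
  ultimately have Q_van: "\<forall>P\<in>face_variety N. vanishes_at id Q (P :: 'l ppoint)"
    using face_variety_vanishes_iff[OF field_map_id form_mpoly] by blast
  have "\<forall>a\<in>\<phi> ` I0. c a = 0"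
  proof (rule chain_forms_independent[of ?l m Z D F])
    fix P x assume "P \<in> Z ?l" "x \<in> P"
    then have "peval id Q x = 0"
      using Q_van V[of ?l] by (auto simp: vanishes_at_def)
    then show "(\<Sum>a\<in>\<phi> ` I0. c a * (\<Prod>i\<le>?l. peval id (F i) x ^ a i)) = 0"
      by (simp add: Q_def G_def peval_sum peval_mult peval_single peval_prod peval_power del: prod.atMost_Suc)
  next
    show "finite (\<phi> ` I0)" using I0(1) by simp
    fix i assume "i < ?l"
    then show "Z i \<subseteq> Z (Suc i)" using chain by blast
  next
    fix a i assume "a \<in> \<phi> ` I0" "i > ?l"
    then show "a i = 0" by (auto simp: \<phi>_def)
  qed (fact Z F_form F_van F_nonvan sum_a)+
  then show False using c(1) by blast
qed

text \<open>The coordinate of \<open>vertex (k + 1)\<close> vanishes on the smaller face and not on the larger one.\<close>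

lemma face_variety_strict_mono:
  assumes "k < N"
  shows "(face_variety k :: 'l::field ppoint set) \<subset> face_variety (Suc k)"
proof
  show "(face_variety k :: 'l ppoint set) \<subseteq> face_variety (Suc k)"
  proof
    fix P :: "'l ppoint" assume P: "P \<in> face_variety k"
    have "keys (e i) \<subseteq> {..Suc k}" if "keys (e i) \<subseteq> {..k}" for i
      using that by fastforce
    then show "P \<in> face_variety (Suc k)"
      using P unfolding face_variety_def by blast
  qed
  obtain i where i: "i \<le> m" "e i = vertex (Suc k)"
    using vertex_index[of "Suc k"] assms by auto
  define z :: "nat \<Rightarrow> 'l" where "z j = (if j \<le> Suc k then 1 else 0)" for j
  have "keys (vertex (Suc k)) = {..Suc k}"
    using beta_pos by (auto simp: in_keys_iff lookup_vertex split: if_splits)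
  then have "torus_coords z i \<noteq> 0" "\<not> keys (e i) \<subseteq> {..k}"
    using i by (auto simp: torus_coords_def power_prod_eq_0_iff z_def)
  then have "proj_class (torus_coords z) \<notin> face_variety k"
    using proj_class_self[of "torus_coords z"] i(1) by (auto simp: face_variety_def)
  moreover have "proj_class (torus_coords z) \<in> face_variety (Suc k)"
    by (rule torus_point_mem) (auto simp: z_def)
  ultimately show "(face_variety k :: 'l ppoint set) \<noteq> face_variety (Suc k)"
    by blast
qed

theorem zariski_dim_face_variety:
  "zariski_dim m (face_variety N :: 'l::alg_closed_field ppoint set) = enat N"
proof -
  let ?V = "face_variety N :: 'l ppoint set"
  let ?L = "{l. \<exists>Z :: nat \<Rightarrow> 'l ppoint set.
     (\<forall>i\<le>l. irreducible_closed m (Z i) \<and> Z i \<subseteq> ?V) \<and> (\<forall>i<l. Z i \<subset> Z (Suc i))}"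
  have mono: "face_variety k \<subseteq> ?V" if "k \<le> N" for k
    using that
  proof (induction rule: inc_induct)
    case (step k)
    then show ?case using face_variety_strict_mono[of k] by blast
  qed simp
  have "N \<in> ?L"
    by (intro CollectI exI[of _ face_variety])
      (simp add: irreducible_face_variety mono face_variety_strict_mono)
  moreover have "l \<le> N" if "l \<in> ?L" for l
  proof (rule ccontr)
    assume "\<not> l \<le> N"
    moreover obtain Z :: "nat \<Rightarrow> 'l ppoint set" where
      "\<forall>i\<le>l. irreducible_closed m (Z i) \<and> Z i \<subseteq> ?V" "\<forall>i<l. Z i \<subset> Z (Suc i)"
      using \<open>l \<in> ?L\<close> by blast
    ultimately show False
      using no_long_chain[of Z] by auto
  qed
  ultimately show ?thesis
    unfolding zariski_dim_def by (intro antisym SUP_least SUP_upper2[of N]) auto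
qed

end

section \<open>The torus\<close>

lemma peval_var_prod:
  fixes h :: "'c::field \<Rightarrow> 'l::field"
  assumes "field_map h"
  shows "peval h (\<Prod>k\<in>A. single (single (f k) 1) 1) x = (\<Prod>k\<in>A. x (f k))"
proof -
  interpret field_map h by fact
  show ?thesis by (simp add: peval_prod peval_single power_prod_single)
qed

lemma form_var_prod:
  "finite A \<Longrightarrow> (\<And>k. k \<in> A \<Longrightarrow> f k \<le> m) \<Longrightarrow>
    form m (card A) (\<Prod>k\<in>A. single (single (f k) 1) 1)"
  using form_prod[of A m "\<lambda>_. 1" "\<lambda>k. single (single (f k) 1) 1"] form_var
  by auto

lemma proj_class_mem_proj_space:
  "(\<And>i. i > m \<Longrightarrow> x i = 0) \<Longrightarrow> i \<le> m \<Longrightarrow> x i \<noteq> 0 \<Longrightarrow> proj_class x \<in> proj_space m"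
  unfolding proj_space_iff by blast

context flag_variety
begin

lemma face_variety_N: "face_variety N = {P \<in> proj_space m. \<forall>x\<in>P. binomials_hold x}"
  using e_keys by (auto simp: face_variety_def)

lemma variety_memI:
  fixes x :: "nat \<Rightarrow> 'l::field"
  assumes "proj_class x \<in> proj_space m" "binomials_hold x"
  shows "proj_class x \<in> face_variety N"
proof -
  have "binomials_hold (\<lambda>i. c * x i)" for c
    unfolding binomials_hold_def
  proof (intro allI impI)
    fix u v assume uv: "keys u \<subseteq> {..m}" "keys v \<subseteq> {..m}" "wt u = wt v"
    have "(\<Sum>i\<le>m. lookup u i) = (\<Sum>i\<le>m. lookup v i)"
      using uv(3) by (simp flip: wt_degree)
    then show "power_prod (\<lambda>i. c * x i) u = power_prod (\<lambda>i. c * x i) v"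
      using uv binomials_holdD[OF assms(2) uv] power_prod_const[of u m c] power_prod_const[of v m c]
      by (simp add: power_prod_mult)
  qed
  then show ?thesis
    using assms(1) by (auto simp: face_variety_N proj_class_def)
qed

definition vertex_ix :: "nat \<Rightarrow> nat" where
  "vertex_ix k = (SOME i. i \<le> m \<and> e i = vertex k)"

definition edge_ix :: "nat \<Rightarrow> nat" where
  "edge_ix k = (SOME i. i \<le> m \<and> e i = edge k)"

lemma vertex_ix: "k \<le> N \<Longrightarrow> vertex_ix k \<le> m" "k \<le> N \<Longrightarrow> e (vertex_ix k) = vertex k"
proof -
  have "k \<le> N \<Longrightarrow> vertex_ix k \<le> m \<and> e (vertex_ix k) = vertex k"
    unfolding vertex_ix_def by (rule someI_ex) (use e_surj[OF vertex_mem] in blast)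
  then show "k \<le> N \<Longrightarrow> vertex_ix k \<le> m" "k \<le> N \<Longrightarrow> e (vertex_ix k) = vertex k" by auto
qed

lemma edge_ix: "k \<in> {1..N} \<Longrightarrow> edge_ix k \<le> m" "k \<in> {1..N} \<Longrightarrow> e (edge_ix k) = edge k"
proof -
  have "k \<in> {1..N} \<Longrightarrow> edge_ix k \<le> m \<and> e (edge_ix k) = edge k"
    unfolding edge_ix_def by (rule someI_ex) (use e_surj[OF edge_mem[of k]] in auto)
  then show "k \<in> {1..N} \<Longrightarrow> edge_ix k \<le> m" "k \<in> {1..N} \<Longrightarrow> e (edge_ix k) = edge k" by auto
qed

definition torus_degree :: nat where
  "torus_degree = (\<Sum>k\<in>{1..N}. \<beta> k)"

text \<open>
  The \<open>i\<close>-th coordinate of the torus embedding is the character \<open>e i\<close> at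
  \<open>y\<^sub>k / y\<^sub>0\<close>, multiplied by a power of \<open>y\<^sub>0\<close> that makes it a form of degree
  \<open>torus_degree\<close> for every \<open>i\<close>.
\<close>

definition torus_expo :: "nat \<Rightarrow> (nat \<Rightarrow>\<^sub>0 nat)" where
  "torus_expo i = single 0 (torus_degree - (\<Sum>k\<in>{1..N}. lookup (e i) k))
     + (\<Sum>k\<in>{1..N}. single k (lookup (e i) k))"

lemma e_bound: "i \<le> m \<Longrightarrow> lookup (e i) k \<le> \<beta> k"
  using e_mem[of i] M_bound[of "e i" k] by (auto simp: Mdeg_def)

lemma lookup_torus_expo:
  "lookup (torus_expo i) j =
    (if j = 0 then torus_degree - (\<Sum>k\<in>{1..N}. lookup (e i) k)
     else if j \<le> N then lookup (e i) j else 0)"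
  by (auto simp: torus_expo_def lookup_add lookup_sum lookup_single when_def sum.delta)

lemma torus_expo_keys: "keys (torus_expo i) \<subseteq> {..N}"
  by (auto simp: in_keys_iff lookup_torus_expo split: if_splits)

lemma atMost_insert: "{..N} = insert 0 {1..N}"
  by auto

lemma torus_expo_degree:
  assumes "i \<le> m"
  shows "(\<Sum>j\<le>N. lookup (torus_expo i) j) = torus_degree"
proof -
  have "(\<Sum>k\<in>{1..N}. lookup (e i) k) \<le> torus_degree"
    unfolding torus_degree_def by (intro sum_mono e_bound assms)
  moreover have "(\<Sum>j\<in>{1..N}. lookup (torus_expo i) j) = (\<Sum>k\<in>{1..N}. lookup (e i) k)"
    by (intro sum.cong refl) (auto simp: lookup_torus_expo)
  ultimately show ?thesis
    unfolding atMost_insert by (simp add: lookup_torus_expo)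
qed

definition torus_map :: "(nat \<Rightarrow> 'l::comm_semiring_1) \<Rightarrow> nat \<Rightarrow> 'l" where
  "torus_map y i = (if i \<le> m then power_prod y (torus_expo i) else 0)"

definition affine_coords :: "(nat \<Rightarrow> 'l::field) \<Rightarrow> nat \<Rightarrow> 'l" where
  "affine_coords y k = (if k = 0 then y 0 ^ torus_degree else if k \<le> N then y k / y 0 else 0)"

lemma power_prod_N:
  assumes "keys u \<subseteq> {..N}"
  shows "power_prod x u = x 0 ^ lookup u 0 * (\<Prod>k\<in>{1..N}. x k ^ lookup u k)"
  by (subst power_prod_superset[OF _ assms]) (auto simp: atMost_insert)

text \<open>
  The embedding is the monomial parametrization at the affine coordinates of the torus, the
  coordinate with index \<open>0\<close> serving as a common factor.
\<close>

lemma torus_map_eq: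
  assumes "y 0 \<noteq> 0"
  shows "torus_map y = torus_coords (affine_coords y)"
proof
  fix i
  show "torus_map y i = torus_coords (affine_coords y) i"
  proof (cases "i \<le> m")
    case True
    let ?t = "lookup (e i)"
    have le: "(\<Sum>k\<in>{1..N}. ?t k) \<le> torus_degree"
      unfolding torus_degree_def by (intro sum_mono e_bound True)
    have "power_prod (affine_coords y) (e i) = y 0 ^ torus_degree * (\<Prod>k\<in>{1..N}. (y k / y 0) ^ ?t k)"
      using e_degree[OF True] by (subst power_prod_N[OF e_keys[OF True]]) (auto simp: affine_coords_def)
    also have "(\<Prod>k\<in>{1..N}. (y k / y 0) ^ ?t k) = (\<Prod>k\<in>{1..N}. y k ^ ?t k) / y 0 ^ (\<Sum>k\<in>{1..N}. ?t k)"
      by (simp add: power_divide prod_dividef power_sum)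
    also have "y 0 ^ torus_degree * \<dots> = power_prod y (torus_expo i)"
      using assms le by (subst power_prod_N[OF torus_expo_keys])
        (auto simp: lookup_torus_expo power_diff)
    finally show ?thesis using True by (simp add: torus_map_def torus_coords_def)
  qed (simp add: torus_map_def torus_coords_def)
qed

lemma torus_map_scale: "torus_map (\<lambda>k. c * y k) i = c ^ torus_degree * torus_map y i"
proof (cases "i \<le> m")
  case True
  then show ?thesis
    using power_prod_const[OF torus_expo_keys, of c i] torus_expo_degree[OF True]
    by (simp add: torus_map_def power_prod_mult)
qed (simp add: torus_map_def)

lemma torus_map_mult: "torus_map (\<lambda>k. x k * y k) i = torus_map x i * torus_map y i"
  by (simp add: torus_map_def power_prod_mult)

lemma torus_map_one: "i \<le> m \<Longrightarrow> torus_map (\<lambda>k. if k \<le> N then 1 else 0) i = 1"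
  by (simp add: torus_map_def power_prod_superset[OF _ torus_expo_keys])

lemma torus_map_nonzero:
  fixes y :: "nat \<Rightarrow> 'l::field"
  assumes "\<And>k. k \<le> N \<Longrightarrow> y k \<noteq> 0" "i \<le> m"
  shows "torus_map y i \<noteq> 0"
  using assms torus_expo_keys[of i] by (auto simp: torus_map_def power_prod_eq_0_iff)

definition embed :: "'l::field ppoint \<Rightarrow> 'l ppoint" where
  "embed P = proj_class (torus_map (SOME y. y \<in> P))"

definition act :: "'l::field ppoint \<Rightarrow> 'l ppoint \<Rightarrow> 'l ppoint" where
  "act P Q = proj_class (\<lambda>i. torus_map (SOME y. y \<in> P) i * (SOME x. x \<in> Q) i)"

lemma torus_rep:
  assumes "P \<in> torus N" "y \<in> P"
  shows "P \<in> proj_space N" "P = proj_class y" "\<And>k. k \<le> N \<Longrightarrow> y k \<noteq> 0" "\<And>k. k > N \<Longrightarrow> y k = 0"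
  using assms proj_space_memD[of P N y] by (auto simp: torus_def)

lemma torus_ex: "P \<in> torus N \<Longrightarrow> \<exists>y. y \<in> P"
  using proj_space_ex by (auto simp: torus_def)

lemma torus_memI:
  assumes "\<And>k. k \<le> N \<Longrightarrow> y k \<noteq> 0" "\<And>k. k > N \<Longrightarrow> y k = 0"
  shows "proj_class y \<in> torus N"
  using assms proj_class_mem_proj_space[of N y 0] by (auto simp: torus_def proj_class_def)

lemma torus_map_rep:
  assumes "P \<in> proj_space n" "y \<in> P"
  shows "\<exists>c. c \<noteq> 0 \<and> (\<forall>i. torus_map (SOME y. y \<in> P) i = c * torus_map y i)"
proof -
  have "(SOME y. y \<in> P) \<in> P" by (rule someI[of "\<lambda>y. y \<in> P", OF assms(2)])
  then obtain c where c: "c \<noteq> 0" "(SOME y. y \<in> P) = (\<lambda>i. c * y i)"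
    using proj_space_memD(1)[OF assms] by (auto simp: proj_class_def)
  then show ?thesis
    by (intro exI[of _ "c ^ torus_degree"]) (simp add: torus_map_scale)
qed

lemma embed_eq:
  assumes "P \<in> torus N" "y \<in> P"
  shows "embed P = proj_class (torus_map y)"
proof -
  obtain c where "c \<noteq> 0" "\<And>i. torus_map (SOME y. y \<in> P) i = c * torus_map y i"
    using torus_map_rep[OF torus_rep(1)[OF assms] assms(2)] by blast
  then show ?thesis unfolding embed_def by (rule proj_class_eqI)
qed

lemma act_eq:
  assumes "P \<in> torus N" "y \<in> P" "Q \<in> proj_space m" "x \<in> Q"
  shows "act P Q = proj_class (\<lambda>i. torus_map y i * x i)"
proof -
  obtain c where c: "c \<noteq> 0" "\<And>i. torus_map (SOME y. y \<in> P) i = c * torus_map y i"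
    using torus_map_rep[OF torus_rep(1)[OF assms(1,2)] assms(2)] by blast
  have "(SOME x. x \<in> Q) \<in> Q" by (rule someI[of "\<lambda>x. x \<in> Q", OF assms(4)])
  then obtain d where d: "d \<noteq> 0" "(SOME x. x \<in> Q) = (\<lambda>i. d * x i)"
    using proj_space_memD(1)[OF assms(3,4)] by (auto simp: proj_class_def)
  show ?thesis
    unfolding act_def by (rule proj_class_eqI[of "c * d"]) (use c d in auto)
qed

lemma embed_mem:
  assumes "P \<in> torus N"
  shows "embed P \<in> face_variety N"
proof -
  obtain y where y: "y \<in> P" using torus_ex[OF assms] by blast
  have y0: "y 0 \<noteq> 0" using torus_rep(3)[OF assms y, of 0] by simp
  have "proj_class (torus_coords (affine_coords y)) \<in> face_variety N"
    by (rule torus_point_mem) (use y0 in \<open>auto simp: affine_coords_def\<close>)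
  then show ?thesis
    using embed_eq[OF assms y] torus_map_eq[of y] y0 by simp
qed

lemma act_mem:
  assumes "P \<in> torus N" "Q \<in> proj_space m"
  shows "act P Q \<in> proj_space m"
proof -
  obtain y where y: "y \<in> P" using torus_ex[OF assms(1)] by blast
  obtain x where x: "x \<in> Q" using proj_space_ex[OF assms(2)] by blast
  obtain i where i: "i \<le> m" "x i \<noteq> 0" using proj_space_memD(3)[OF assms(2) x] by blast
  show ?thesis
    unfolding act_eq[OF assms(1) y assms(2) x]
    by (rule proj_class_mem_proj_space[OF _ i(1)])
      (use i torus_map_nonzero[of y] torus_rep(3)[OF assms(1) y] proj_space_memD(2)[OF assms(2) x] in auto)
qed

lemma binomials_hold_mult: "binomials_hold x \<Longrightarrow> binomials_hold y \<Longrightarrow> binomials_hold (\<lambda>i. x i * y i)"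
  unfolding binomials_hold_def power_prod_mult by metis

lemma act_variety:
  assumes "P \<in> torus N" "Q \<in> face_variety N"
  shows "act P Q \<in> face_variety N"
proof -
  obtain y where y: "y \<in> P" using torus_ex[OF assms(1)] by blast
  have Q: "Q \<in> proj_space m" using assms(2) by (simp add: face_variety_N)
  obtain x where x: "x \<in> Q" using proj_space_ex[OF Q] by blast
  have "binomials_hold (torus_map y)"
    using torus_coords_binomials torus_rep(3)[OF assms(1) y, of 0] by (simp add: torus_map_eq)
  then show ?thesis
    using act_mem[OF assms(1) Q] assms(2) x unfolding act_eq[OF assms(1) y Q x]
    by (intro variety_memI binomials_hold_mult) (auto simp: face_variety_N)
qed

text \<open>The torus coordinates are recovered from the ratios of neighbouring lattice points.\<close>

definition torus_inv :: "(nat \<Rightarrow> 'l::field) \<Rightarrow> nat \<Rightarrow> 'l" where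
  "torus_inv x k = (if k = 0 then 1 else if k \<le> N then x (edge_ix k) / x (vertex_ix (k - 1)) else 0)"

lemma torus_coords_edge:
  assumes "k \<in> {1..N}"
  shows "torus_coords z (edge_ix k) = torus_coords z (vertex_ix (k - 1)) * z k"
proof -
  have "k - 1 \<le> N" using assms by auto
  then show ?thesis
    using edge_ix[OF assms] vertex_ix[of "k - 1"]
    by (simp add: torus_coords_def edge_def power_prod_add power_prod_single)
qed

lemma torus_coords_vertex_nonzero:
  fixes z :: "nat \<Rightarrow> 'l::field"
  assumes "\<And>j. j \<le> N \<Longrightarrow> z j \<noteq> 0" "k \<le> N"
  shows "torus_coords z (vertex_ix k) \<noteq> 0"
  using assms vertex_ix[of k] by (auto simp: torus_coords_def power_prod_eq_0_iff in_keys_iff lookup_vertex split: if_splits)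

lemma torus_inv_embed:
  fixes P :: "'l::field ppoint"
  assumes P: "P \<in> torus N" and x: "x \<in> embed P"
  shows "proj_class (torus_inv x) = P" "\<And>k. k \<le> N \<Longrightarrow> x (vertex_ix k) \<noteq> 0"
proof -
  obtain y where y: "y \<in> P" using torus_ex[OF P] by blast
  note y_nz = torus_rep(3)[OF P y]
  obtain c where c: "c \<noteq> 0" "x = (\<lambda>i. c * torus_coords (affine_coords y) i)"
    using x y_nz[of 0] unfolding embed_eq[OF P y] by (auto simp: proj_class_def torus_map_eq)
  have aff: "affine_coords y j \<noteq> 0" if "j \<le> N" for j
    using that y_nz[of 0] y_nz[OF that] by (simp add: affine_coords_def)
  show nz: "x (vertex_ix k) \<noteq> 0" if "k \<le> N" for k
    using c torus_coords_vertex_nonzero[of "affine_coords y" k] aff that by simp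
  have "torus_inv x k = (1 / y 0) * y k" for k
  proof (cases "k = 0 \<or> k > N")
    case True
    then show ?thesis using y_nz[of 0] torus_rep(4)[OF P y, of k] by (auto simp: torus_inv_def)
  next
    case False
    then have k: "k \<in> {1..N}" by auto
    then have "torus_inv x k = affine_coords y k"
      using c torus_coords_edge[OF k, of "affine_coords y"] torus_coords_vertex_nonzero[of "affine_coords y" "k - 1"] aff
      by (simp add: torus_inv_def le_diff_conv)
    then show ?thesis using k by (simp add: affine_coords_def)
  qed
  then show "proj_class (torus_inv x) = P"
    unfolding torus_rep(2)[OF P y] by (intro proj_class_eqI[of "1 / y 0"]) (use y_nz[of 0] in auto)
qed

lemma embed_inj: "inj_on embed (torus N :: 'l::field ppoint set)"
proof (rule inj_onI)
  fix P Q :: "'l ppoint" assume PQ: "P \<in> torus N" "Q \<in> torus N" "embed P = embed Q"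
  obtain x where x: "x \<in> embed P"
    using proj_class_self by (auto simp: embed_def)
  have "proj_class (torus_inv x) = P"
    by (rule torus_inv_embed(1)[OF PQ(1) x])
  moreover have "proj_class (torus_inv x) = Q"
    by (rule torus_inv_embed(1)[OF PQ(2) x[unfolded PQ(3)]])
  ultimately show "P = Q" by (rule subst)
qed

text \<open>
  The relation \<open>\<beta>\<^sub>k edge k = vertex k + (\<beta>\<^sub>k - 1) vertex (k - 1)\<close> shows that the edge coordinates
  are nonzero as well, and \<open>t = vertex 0 + \<Sum>\<^sub>k t\<^sub>k (edge k - vertex (k - 1))\<close> for \<open>t\<close> of degree one
  expresses all coordinates by those of the vertices and edges.
\<close>

lemma torus_image:
  fixes x :: "nat \<Rightarrow> 'l::field"
  assumes x: "binomials_hold x" "\<And>i. i > m \<Longrightarrow> x i = 0" and nz: "\<And>k. k \<le> N \<Longrightarrow> x (vertex_ix k) \<noteq> 0"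
  shows "proj_class (torus_inv x) \<in> torus N" "embed (proj_class (torus_inv x)) = proj_class x"
proof -
  have edge_nz: "x (edge_ix k) \<noteq> 0" if k: "k \<in> {1..N}" for k
  proof
    assume 0: "x (edge_ix k) = 0"
    let ?u = "single (edge_ix k) (\<beta> k)"
    let ?v = "single (vertex_ix k) 1 + single (vertex_ix (k - 1)) (\<beta> k - 1)"
    have k1: "k - 1 \<le> N" "k \<le> N" using k by auto
    have ix: "edge_ix k \<le> m" "vertex_ix k \<le> m" "vertex_ix (k - 1) \<le> m"
      using edge_ix(1)[OF k] vertex_ix(1)[OF k1(1)] vertex_ix(1)[OF k1(2)] by auto
    have "wt ?u = wt ?v"
    proof (rule poly_mapping_eqI)
      fix i
      show "lookup (wt ?u) i = lookup (wt ?v) i"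
        using k beta_pos[of k]
        by (auto simp: wt_add wt_single ix[unfolded One_nat_def] edge_ix(2)[OF k]
            vertex_ix(2)[OF k1(1), unfolded One_nat_def] vertex_ix(2)[OF k1(2)]
            lookup_add lookup_of_nat_mult lookup_edge lookup_vertex diff_mult_distrib mult.commute
            simp del: of_nat_diff)
    qed
    then have "power_prod x ?u = power_prod x ?v"
      using ix by (intro binomials_holdD[OF x(1)]) (auto simp: keys_add_nat)
    then show False
      using 0 beta_pos[of k] nz[OF k1(1)] nz[OF k1(2)] by (simp add: power_prod_single power_prod_add zero_power)
  qed
  have inv_nz: "torus_inv x k \<noteq> 0" if "k \<le> N" for k
    using that edge_nz[of k] nz[of "k - 1"] by (auto simp: torus_inv_def)
  show mem: "proj_class (torus_inv x) \<in> torus N"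
    by (rule torus_memI) (use inv_nz in \<open>auto simp: torus_inv_def\<close>)
  have "torus_map (torus_inv x) i = (1 / x (vertex_ix 0)) * x i" for i
  proof (cases "i \<le> m")
    case True
    let ?t = "lookup (e i)"
    let ?u = "single i 1 + (\<Sum>k\<in>{1..N}. single (vertex_ix (k - 1)) (?t k))"
    let ?v = "single (vertex_ix 0) 1 + (\<Sum>k\<in>{1..N}. single (edge_ix k) (?t k))"
    let ?T = "\<Sum>k\<in>{1..N}. of_nat (?t k) * single k 1"
    let ?V = "\<Sum>k\<in>{1..N}. wt (single (vertex_ix (k - 1)) (?t k))"
    have e_eq: "e i = vertex 0 + ?T"
    proof (rule poly_mapping_eqI)
      fix j
      have "?t j = 0" if "j > N"
        using e_keys[OF True] that by (auto simp: in_keys_iff)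
      then show "?t j = lookup (vertex 0 + (\<Sum>k\<in>{1..N}. of_nat (?t k) * single k 1)) j"
        using e_degree[OF True] beta_0
        by (auto simp: lookup_add lookup_vertex lookup_sum lookup_of_nat_mult lookup_single when_def
            if_distrib[of "\<lambda>a. _ * a"] sum.delta cong: if_cong)
    qed
    have W: "(\<Sum>k\<in>{1..N}. wt (single (edge_ix k) (?t k)))
        = (\<Sum>k\<in>{1..N}. wt (single (vertex_ix (k - 1)) (?t k)) + of_nat (?t k) * single k 1)"
    proof (intro sum.cong refl)
      fix k assume k: "k \<in> {1..N}"
      then show "wt (single (edge_ix k) (?t k))
        = wt (single (vertex_ix (k - 1)) (?t k)) + of_nat (?t k) * single k 1"
        using edge_ix[OF k] vertex_ix[of "k - 1"] by (simp add: wt_single edge_def distrib_left le_diff_conv)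
    qed
    have "wt ?u = e i + ?V"
      using True by (simp add: wt_add wt_sum wt_single)
    also have "\<dots> = vertex 0 + ?T + ?V"
      using arg_cong[OF e_eq, of "\<lambda>t. t + ?V"] .
    also have "\<dots> = wt ?v"
      unfolding wt_add wt_sum W sum.distrib using vertex_ix[of 0] by (simp add: wt_single add_ac)
    finally have "wt ?u = wt ?v" .
    moreover have "keys ?u \<subseteq> {..m}" "keys ?v \<subseteq> {..m}"
    proof -
      have keys: "keys (\<Sum>k\<in>{1..N}. single (f k) (?t k)) \<subseteq> {..m}"
        if "\<And>k. k \<in> {1..N} \<Longrightarrow> f k \<le> m" for f
        by (rule order.trans[OF keys_sum_subset]) (use that in \<open>auto split: if_splits\<close>)
      show "keys ?u \<subseteq> {..m}"
        unfolding keys_add_nat using True keys[of "\<lambda>k. vertex_ix (k - 1)"] vertex_ix(1)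
        by (simp add: le_diff_conv)
      show "keys ?v \<subseteq> {..m}"
        unfolding keys_add_nat using keys[of edge_ix] edge_ix(1) vertex_ix(1)[of 0] by simp
    qed
    ultimately have "power_prod x ?u = power_prod x ?v"
      by (intro binomials_holdD[OF x(1)])
    let ?B = "\<Prod>k\<in>{1..N}. x (vertex_ix (k - 1)) ^ ?t k" and ?E = "\<Prod>k\<in>{1..N}. x (edge_ix k) ^ ?t k"
    have "x i * ?B = x (vertex_ix 0) * ?E"
      using \<open>power_prod x ?u = power_prod x ?v\<close>
      by (simp add: power_prod_add power_prod_single power_prod_sum)
    moreover have "?B \<noteq> 0"
      using nz by (auto simp: prod_zero_iff)
    ultimately have "x i = x (vertex_ix 0) * ?E / ?B"
      by (simp add: eq_divide_eq)
    moreover have "torus_map (torus_inv x) i = ?E / ?B"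
    proof -
      have "torus_map (torus_inv x) i = (\<Prod>k\<in>{1..N}. (x (edge_ix k) / x (vertex_ix (k - 1))) ^ ?t k)"
        using True by (simp add: torus_map_def power_prod_N[OF torus_expo_keys] lookup_torus_expo torus_inv_def)
      then show ?thesis
        by (simp only: power_divide prod_dividef)
    qed
    ultimately show ?thesis
      using nz[of 0] by simp
  qed (simp add: torus_map_def x(2))
  then have "proj_class (torus_map (torus_inv x)) = proj_class x"
    by (intro proj_class_eqI[of "1 / x (vertex_ix 0)"]) (use nz in auto)
  then show "embed (proj_class (torus_inv x)) = proj_class x"
    by (simp add: embed_eq[OF mem proj_class_self])
qed

lemma embed_open:
  "\<exists>Z. zariski_closed m Z \<and> embed ` (torus N :: 'l::field ppoint set) = face_variety N - Z"
proof -
  interpret field_map "id :: 'l \<Rightarrow> 'l" by (rule field_map_id)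
  define f :: "'l mpoly" where "f = (\<Prod>k\<le>N. single (single (vertex_ix k) 1) 1)"
  have f: "form m (card {..N}) f"
    unfolding f_def by (rule form_var_prod) (use vertex_ix in auto)
  have f_val: "peval id f x = (\<Prod>k\<le>N. x (vertex_ix k))" for x
    unfolding f_def by (rule peval_var_prod[OF field_map_id])
  define Z where "Z = {P \<in> proj_space m. \<forall>p\<in>{f}. vanishes_at id p P}"
  have "zariski_closed m Z"
    unfolding zariski_closed_def Z_def by (intro exI[of _ "{f}"]) (use f in auto)
  moreover have "embed ` torus N = face_variety N - Z"
  proof (intro equalityI subsetI)
    fix Q :: "'l ppoint" assume "Q \<in> embed ` torus N"
    then obtain P where P: "P \<in> torus N" "Q = embed P" by blast
    obtain x where x: "x \<in> embed P" using proj_class_self by (auto simp: embed_def)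
    then have "peval id f x \<noteq> 0"
      using torus_inv_embed(2)[OF P(1) x] by (simp add: f_val)
    then show "Q \<in> face_variety N - Z"
      using x P embed_mem[OF P(1)] by (auto simp: Z_def vanishes_at_def)
  next
    fix Q :: "'l ppoint" assume Q: "Q \<in> face_variety N - Z"
    then have Qp: "Q \<in> proj_space m" by (simp add: face_variety_N)
    then obtain x where x: "x \<in> Q" "peval id f x \<noteq> 0"
      using Q by (auto simp: Z_def vanishes_at_def)
    have *: "binomials_hold x" "\<And>i. i > m \<Longrightarrow> x i = 0" "\<And>k. k \<le> N \<Longrightarrow> x (vertex_ix k) \<noteq> 0"
      using Q x proj_space_memD(2)[OF Qp x(1)] by (auto simp: face_variety_N f_val)
    show "Q \<in> embed ` torus N"
      using torus_image[OF *] proj_space_memD(1)[OF Qp x(1)] by (metis image_eqI)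
  qed
  ultimately show ?thesis by blast
qed

lemma embed_regular: "regular_map N (torus N) m (embed :: 'k::field alg_closure ppoint \<Rightarrow> _)"
  unfolding regular_map_def
proof (intro conjI ballI)
  interpret field_map "to_ac :: 'k \<Rightarrow> 'k alg_closure" by (rule field_map_to_ac)
  show "embed ` (torus N :: 'k alg_closure ppoint set) \<subseteq> proj_space m"
    using embed_mem by (fastforce simp: face_variety_N)
  fix P :: "'k alg_closure ppoint" assume P: "P \<in> torus N"
  obtain y where y: "y \<in> P" using torus_ex[OF P] by blast
  let ?F = "\<lambda>i. single (torus_expo i) (1 :: 'k)"
  have val: "(\<lambda>i. if i \<le> m then peval to_ac (?F i) x else 0) = torus_map x" for x
    by (auto simp: torus_map_def peval_single)
  show "\<exists>d F. (\<forall>i\<le>m. form N d (F i :: 'k mpoly)) \<and> (\<exists>i\<le>m. \<not> vanishes_at to_ac (F i) P) \<and>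
    (\<forall>Q\<in>torus N. (\<exists>i\<le>m. \<not> vanishes_at to_ac (F i) Q) \<longrightarrow>
      (\<forall>x\<in>Q. (\<lambda>i. if i \<le> m then peval to_ac (F i) x else 0) \<in> embed Q))"
  proof (rule exI[of _ torus_degree], rule exI[of _ ?F], intro conjI allI ballI impI)
    fix i assume "i \<le> m"
    then show "form N torus_degree (?F i)"
      using torus_expo_keys torus_expo_degree by (intro form_single) auto
  next
    have "peval to_ac (?F 0) y \<noteq> 0"
      using torus_map_nonzero[of y 0] torus_rep(3)[OF P y] by (simp add: peval_single torus_map_def)
    then show "\<exists>i\<le>m. \<not> vanishes_at to_ac (?F i) P"
      using y by (auto simp: vanishes_at_def)
  next
    fix Q :: "'k alg_closure ppoint" and x assume "Q \<in> torus N" "x \<in> Q"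
    then show "(\<lambda>i. if i \<le> m then peval to_ac (?F i) x else 0) \<in> embed Q"
      unfolding val by (simp add: embed_eq proj_class_self)
  qed
qed

text \<open>
  Multiplying the coordinates \<open>x\<^bsub>edge k\<^esub> / x\<^bsub>vertex (k-1)\<^esub>\<close> by the product of all denominators gives
  forms of degree \<open>N\<close>.
\<close>

lemma embed_inv_regular:
  "regular_map m (embed ` torus N) N (the_inv_into (torus N) (embed :: 'k::field alg_closure ppoint \<Rightarrow> _))"
  unfolding regular_map_def
proof (intro conjI ballI)
  interpret field_map "to_ac :: 'k \<Rightarrow> 'k alg_closure" by (rule field_map_to_ac)
  let ?T = "torus N :: 'k alg_closure ppoint set"
  have inv: "the_inv_into ?T embed (embed P) = P" if "P \<in> ?T" for P
    using the_inv_into_f_f[OF embed_inj that] .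
  show "the_inv_into ?T embed ` embed ` ?T \<subseteq> proj_space N"
    using inv by (auto simp: torus_def)
  fix R assume "R \<in> embed ` ?T"
  let ?X = "\<lambda>i. single (single i 1) 1 :: 'k mpoly"
  define F where "F k = (if k = 0 then \<Prod>j\<in>{1..N}. ?X (vertex_ix (j - 1))
      else ?X (edge_ix k) * (\<Prod>j\<in>{1..N} - {k}. ?X (vertex_ix (j - 1))))" for k
  have F0: "peval to_ac (F 0) x = (\<Prod>j\<in>{1..N}. x (vertex_ix (j - 1)))" for x
    using peval_var_prod[OF field_map_to_ac, of "\<lambda>j. vertex_ix (j - 1)" "{1..N}" x]
    by (simp add: F_def)
  have F0_nz: "peval to_ac (F 0) x \<noteq> 0" if "P \<in> ?T" "x \<in> embed P" for P x
    using torus_inv_embed(2)[OF that] by (auto simp: F0)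
  have F_val: "(if k \<le> N then peval to_ac (F k) x else 0) = peval to_ac (F 0) x * torus_inv x k"
    if "P \<in> ?T" "x \<in> embed P" for P x k
  proof (cases "k \<in> {1..N}")
    case True
    have "peval to_ac (F k) x = x (edge_ix k) * (\<Prod>j\<in>{1..N} - {k}. x (vertex_ix (j - 1)))"
      using True peval_var_prod[OF field_map_to_ac, of "\<lambda>j. vertex_ix (j - 1)" "{1..N} - {k}" x]
      by (simp add: F_def peval_mult peval_single power_prod_single)
    moreover have "peval to_ac (F 0) x = x (vertex_ix (k - 1)) * (\<Prod>j\<in>{1..N} - {k}. x (vertex_ix (j - 1)))"
      unfolding F0 using True by (intro prod.remove) auto
    ultimately show ?thesis
      using True torus_inv_embed(2)[OF that, of "k - 1"]
      by (auto simp: torus_inv_def le_diff_conv)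
  next
    case False
    then show ?thesis by (auto simp: torus_inv_def)
  qed
  show "\<exists>d F. (\<forall>i\<le>N. form m d (F i :: 'k mpoly)) \<and> (\<exists>i\<le>N. \<not> vanishes_at to_ac (F i) R) \<and>
    (\<forall>Q\<in>embed ` ?T. (\<exists>i\<le>N. \<not> vanishes_at to_ac (F i) Q) \<longrightarrow>
      (\<forall>x\<in>Q. (\<lambda>i. if i \<le> N then peval to_ac (F i) x else 0) \<in> the_inv_into ?T embed Q))"
  proof (rule exI[of _ N], rule exI[of _ F], intro conjI allI ballI impI)
    fix k assume "k \<le> N"
    show "form m N (F k)"
    proof (cases "k = 0")
      case True
      have "form m (card {1..N}) (\<Prod>j\<in>{1..N}. ?X (vertex_ix (j - 1)))"
        by (rule form_var_prod) (use vertex_ix in auto)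
      then show ?thesis using True by (simp add: F_def)
    next
      case False
      have "form m (card ({1..N} - {k})) (\<Prod>j\<in>{1..N} - {k}. ?X (vertex_ix (j - 1)))"
        by (rule form_var_prod) (use vertex_ix in auto)
      moreover have "form m 1 (?X (edge_ix k))"
        using False \<open>k \<le> N\<close> edge_ix(1)[of k] by (intro form_var) auto
      ultimately have "form m (1 + card ({1..N} - {k})) (F k)"
        using False by (simp add: F_def del: One_nat_def) (rule form_mult)
      then show ?thesis using False \<open>k \<le> N\<close> by simp
    qed
  next
    obtain P where P: "P \<in> ?T" "R = embed P" using \<open>R \<in> embed ` ?T\<close> by blast
    obtain x where "x \<in> embed P" using proj_class_self by (auto simp: embed_def)
    then show "\<exists>i\<le>N. \<not> vanishes_at to_ac (F i) R"
      using F0_nz[OF P(1)] P(2) by (auto simp: vanishes_at_def)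
  next
    fix Q x assume "Q \<in> embed ` ?T" and x: "x \<in> Q"
    then obtain P where P: "P \<in> ?T" "Q = embed P" by blast
    have "(\<lambda>i. if i \<le> N then peval to_ac (F i) x else 0) = (\<lambda>i. peval to_ac (F 0) x * torus_inv x i)"
      using F_val[OF P(1)] x P(2) by (intro ext) blast
    also have "\<dots> \<in> proj_class (torus_inv x)"
      using F0_nz[OF P(1)] x P(2) by (auto simp: proj_class_def)
    also have "proj_class (torus_inv x) = the_inv_into ?T embed Q"
      using torus_inv_embed(1)[OF P(1)] x P inv by simp
    finally show "(\<lambda>i. if i \<le> N then peval to_ac (F i) x else 0) \<in> the_inv_into ?T embed Q" .
  qed
qed

lemma act_regular:
  "regular_map2 N (torus N) m (face_variety N) m (act :: 'k::field alg_closure ppoint \<Rightarrow> _)"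
  unfolding regular_map2_def
proof (intro conjI ballI)
  interpret field_map "to_ac :: 'k \<Rightarrow> 'k alg_closure" by (rule field_map_to_ac)
  fix P Q :: "'k alg_closure ppoint" assume P: "P \<in> torus N" and "Q \<in> face_variety N"
  then have Q: "Q \<in> proj_space m" by (simp add: face_variety_N)
  then show "act P Q \<in> proj_space m" by (rule act_mem[OF P])
  let ?F = "\<lambda>i. single (torus_expo i + single (N + 1 + i) 1) (1 :: 'k)"
  have join: "power_prod (join_coords N x y) (torus_expo i) = power_prod x (torus_expo i)"
    for x y :: "nat \<Rightarrow> 'k alg_closure" and i
    by (rule power_prod_cong) (use torus_expo_keys[of i] in \<open>auto simp: join_coords_def\<close>)
  have F_val: "peval to_ac (?F i) (join_coords N x y) = power_prod x (torus_expo i) * y i" for i x y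
    unfolding peval_single power_prod_add join by (simp add: power_prod_single join_coords_def)
  show "\<exists>d d' F. (\<forall>i\<le>m. biform N m d d' (F i :: 'k mpoly)) \<and>
    (\<exists>i\<le>m. \<exists>x\<in>P. \<exists>y\<in>Q. peval to_ac (F i) (join_coords N x y) \<noteq> 0) \<and>
    (\<forall>P'\<in>torus N. \<forall>Q'\<in>face_variety N. \<forall>x\<in>P'. \<forall>y\<in>Q'.
      (\<exists>i\<le>m. peval to_ac (F i) (join_coords N x y) \<noteq> 0) \<longrightarrow>
      (\<lambda>i. if i \<le> m then peval to_ac (F i) (join_coords N x y) else 0) \<in> act P' Q')"
  proof (rule exI[of _ torus_degree], rule exI[of _ 1], rule exI[of _ ?F], intro conjI allI ballI impI)
    fix i assume i: "i \<le> m"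
    have "(\<Sum>j\<le>m. if i = j then 1 else 0 :: nat) = 1" using i by simp
    moreover have "lookup (torus_expo i) (N + 1 + j) = 0" for j
      by (simp add: lookup_torus_expo)
    ultimately show "biform N m torus_degree 1 (?F i)"
      using i torus_expo_keys[of i] torus_expo_degree[OF i]
      by (fastforce simp: biform_def keys_add_nat lookup_add lookup_single when_def sum.distrib)
  next
    obtain y where y: "y \<in> P" using torus_ex[OF P] by blast
    obtain x where x: "x \<in> Q" using proj_space_ex[OF Q] by blast
    obtain i where i: "i \<le> m" "x i \<noteq> 0" using proj_space_memD(3)[OF Q x] by blast
    have "peval to_ac (?F i) (join_coords N y x) \<noteq> 0"
      unfolding F_val using i torus_map_nonzero[of y i] torus_rep(3)[OF P y] by (simp add: torus_map_def)
    then show "\<exists>i\<le>m. \<exists>x\<in>P. \<exists>y\<in>Q. peval to_ac (?F i) (join_coords N x y) \<noteq> 0"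
      using x y i(1) by blast
  next
    fix P' Q' :: "'k alg_closure ppoint" and x y
    assume *: "P' \<in> torus N" "Q' \<in> face_variety N" "x \<in> P'" "y \<in> Q'"
    then have Q': "Q' \<in> proj_space m" by (simp add: face_variety_N)
    have "(\<lambda>i. if i \<le> m then peval to_ac (?F i) (join_coords N x y) else 0) = (\<lambda>i. torus_map x i * y i)"
    proof
      fix i
      show "(if i \<le> m then peval to_ac (?F i) (join_coords N x y) else 0) = torus_map x i * y i"
        unfolding F_val by (simp add: torus_map_def)
    qed
    then show "(\<lambda>i. if i \<le> m then peval to_ac (?F i) (join_coords N x y) else 0) \<in> act P' Q'"
      using act_eq[OF *(1,3) Q' *(4)] proj_class_self by simp
  qed
qed

lemma torus_mult_rep:
  assumes "P \<in> torus N" "Q \<in> torus N" "x \<in> P" "y \<in> Q"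
  shows "torus_mult P Q \<in> torus N" "(\<lambda>i. x i * y i) \<in> torus_mult P Q"
proof -
  have "torus_mult P Q = proj_class (\<lambda>i. x i * y i)"
    unfolding torus_rep(2)[OF assms(1,3)] torus_rep(2)[OF assms(2,4)]
  proof (intro equalityI subsetI)
    fix z assume "z \<in> torus_mult (proj_class x) (proj_class y)"
    then obtain a b where "a \<noteq> 0" "b \<noteq> 0" "z = (\<lambda>i. (a * x i) * (b * y i))"
      by (auto simp: torus_mult_def proj_class_def)
    then show "z \<in> proj_class (\<lambda>i. x i * y i)"
      by (auto simp: proj_class_def mult_ac intro!: exI[of _ "a * b"])
  next
    fix z assume "z \<in> proj_class (\<lambda>i. x i * y i)"
    then obtain a where "a \<noteq> 0" "z = (\<lambda>i. (a * x i) * y i)"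
      by (auto simp: proj_class_def mult_ac)
    moreover have "(\<lambda>i. a * x i) \<in> proj_class x" if "a \<noteq> 0"
      using that by (auto simp: proj_class_def)
    ultimately show "z \<in> torus_mult (proj_class x) (proj_class y)"
      using proj_class_self[of y] unfolding torus_mult_def by fast
  qed
  moreover have "proj_class (\<lambda>i. x i * y i) \<in> torus N"
    by (rule torus_memI) (use torus_rep(3,4)[OF assms(1,3)] torus_rep(3)[OF assms(2,4)] in auto)
  ultimately show "torus_mult P Q \<in> torus N" "(\<lambda>i. x i * y i) \<in> torus_mult P Q"
    using proj_class_self by auto
qed

theorem projective_toric_face_variety:
  "projective_toric_variety m (face_variety N :: 'k::field alg_closure ppoint set)"
  unfolding projective_toric_variety_def
proof (intro conjI exI[of _ N] exI[of _ embed] exI[of _ act] ballI)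
  show "irreducible_projective_variety m (face_variety N :: 'k alg_closure ppoint set)"
    by (rule irreducible_projective_face_variety)
  show "embed ` torus N \<subseteq> (face_variety N :: 'k alg_closure ppoint set)"
    using embed_mem by blast
next
  fix P Q :: "'k alg_closure ppoint" assume "P \<in> torus N" "Q \<in> face_variety N"
  then show "act P Q \<in> face_variety N" by (rule act_variety)
next
  fix Q :: "'k alg_closure ppoint" assume "Q \<in> face_variety N"
  then have Q: "Q \<in> proj_space m" by (simp add: face_variety_N)
  then obtain x where x: "x \<in> Q" using proj_space_ex by blast
  let ?o = "\<lambda>i. if i \<le> N then 1 else 0 :: 'k alg_closure"
  have "torus_one N = proj_class ?o"
    by (auto simp: torus_one_def proj_class_def fun_eq_iff intro!: exI)
  then have o: "torus_one N \<in> (torus N :: 'k alg_closure ppoint set)" "?o \<in> torus_one N"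
    using torus_memI[of ?o] proj_class_self by auto
  have "(\<lambda>i. torus_map ?o i * x i) = x"
  proof
    fix i
    show "torus_map ?o i * x i = x i"
      using torus_map_one[of i, where ?'a="'k alg_closure"] proj_space_memD(2)[OF Q x, of i]
      by (cases "i \<le> m") auto
  qed
  then show "act (torus_one N) Q = Q"
    using act_eq[OF o Q x] proj_space_memD(1)[OF Q x] by simp
next
  fix s t Q :: "'k alg_closure ppoint" assume st: "s \<in> torus N" "t \<in> torus N" and "Q \<in> face_variety N"
  then have Q: "Q \<in> proj_space m" by (simp add: face_variety_N)
  obtain x where x: "x \<in> s" using torus_ex[OF st(1)] by blast
  obtain y where y: "y \<in> t" using torus_ex[OF st(2)] by blast
  obtain z where z: "z \<in> Q" using proj_space_ex[OF Q] by blast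
  note * = x y z
  have "act s (act t Q) = proj_class (\<lambda>i. torus_map x i * (torus_map y i * z i))"
    using act_eq[OF st(2) *(2) Q *(3)] proj_class_self
    by (intro act_eq[OF st(1) *(1) act_mem[OF st(2) Q]]) simp
  then show "act (torus_mult s t) Q = act s (act t Q)"
    using act_eq[OF torus_mult_rep[OF st *(1,2)] Q *(3)] by (simp add: torus_map_mult mult.assoc)
next
  fix s t :: "'k alg_closure ppoint" assume st: "s \<in> torus N" "t \<in> torus N"
  obtain x where x: "x \<in> s" using torus_ex[OF st(1)] by blast
  obtain y where y: "y \<in> t" using torus_ex[OF st(2)] by blast
  note * = x y
  have "embed t \<in> proj_space m" using embed_mem[OF st(2)] by (simp add: face_variety_N)
  then have "act s (embed t) = proj_class (\<lambda>i. torus_map x i * torus_map y i)"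
    using embed_eq[OF st(2) *(2)] proj_class_self by (intro act_eq[OF st(1) *(1)]) simp_all
  then show "act s (embed t) = embed (torus_mult s t)"
    using embed_eq[OF torus_mult_rep[OF st *]] by (simp add: torus_map_mult[abs_def])
qed (rule embed_regular embed_inj embed_inv_regular embed_open act_regular)+

end

section \<open>The coordinate ring and the local rings\<close>

text \<open>
  The LS algebra and the coordinate rings are records without an ambient field. They become
  subrings of a field of type \<open>fract\<close> by means of an isomorphism with a monoid algebra.
\<close>

lemma field_embedding_Fract:
  fixes g :: "'a \<Rightarrow> 'b::idom"
  assumes R: "cring R" and g: "g \<in> ring_hom R (set_ring C)"
    and inj: "inj_on g (carrier R)"
  shows "field_embedding R (\<lambda>x. Fract (g x) 1)"
proof -
  interpret cring R by (rule R)
  have hom: "g (x \<oplus>\<^bsub>R\<^esub> y) = g x + g y" "g (x \<otimes>\<^bsub>R\<^esub> y) = g x * g y" "g \<one>\<^bsub>R\<^esub> = 1"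
    if "x \<in> carrier R" "y \<in> carrier R" for x y
    using that g by (auto simp: ring_hom_def)
  have zero: "g \<zero>\<^bsub>R\<^esub> = 0"
    using hom(1)[OF zero_closed zero_closed] by (metis add_cancel_right_right l_zero zero_closed)
  show ?thesis
  proof
    show "inj_on (\<lambda>x. Fract (g x) 1) (carrier R)"
      using inj by (auto simp: inj_on_def eq_fract)
    fix a assume a: "a \<in> carrier R"
    then have "g a + g (\<ominus>\<^bsub>R\<^esub> a) = 0"
      using hom(1)[of a "\<ominus>\<^bsub>R\<^esub> a"] zero by (simp add: r_neg)
    then have "g (\<ominus>\<^bsub>R\<^esub> a) = - g a"
      by (simp add: eq_neg_iff_add_eq_0 add.commute)
    then show "\<exists>b\<in>carrier R. Fract (g b) 1 = - Fract (g a) 1"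
      using a by (intro bexI[of _ "\<ominus>\<^bsub>R\<^esub> a"]) auto
  qed (use hom zero hom(3)[OF zero_closed zero_closed] in \<open>auto simp: One_fract_def Zero_fract_def\<close>)
qed

context flag_variety
begin

definition theta_quot :: "'c::field mpoly set \<Rightarrow> 'c mpoly" where
  "theta_quot Y = the_elem (theta N ` Y)"

lemma theta_image: "theta N ` carrier (mpoly_ring m) = carrier (flag_algebra :: 'c::field mpoly ring)"
proof (intro equalityI subsetI)
  fix f assume "f \<in> carrier (flag_algebra :: 'c mpoly ring)"
  then show "f \<in> theta N ` carrier (mpoly_ring m)"
    using theta_surj[of f] by (auto simp: flag_algebra_def)
qed (auto simp: flag_algebra_def theta_mem)

lemma theta_quot_iso:
  fixes h :: "'c::field \<Rightarrow> 'l::alg_closed_field"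
  assumes "field_map h"
  shows "theta_quot \<in> ring_iso (coordinate_ring h m (face_variety N :: 'l ppoint set)) flag_algebra"
  unfolding coordinate_ring_def theta_kernel[OF assms, symmetric] theta_quot_def[abs_def]
  by (rule ring_hom_ring.FactRing_iso_set[OF theta_hom theta_image])

lemma theta_quot_residue_class:
  fixes h :: "'c::field \<Rightarrow> 'l::alg_closed_field"
  assumes "field_map h" "p \<in> carrier (mpoly_ring m)"
  shows "theta_quot (residue_class h m (face_variety N :: 'l ppoint set) p) = theta N p"
proof -
  have "theta N ` (residue_class h m (face_variety N :: 'l ppoint set) p) = {theta N p}"
  proof -
    have "residue_class h m (face_variety N :: 'l ppoint set) p
        = (\<lambda>q. q + p) ` {q \<in> carrier (mpoly_ring m). theta N q = 0}"
      unfolding residue_class_def vanishing_ideal_face_variety[OF assms(1)]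
      by (auto simp: a_r_coset_def' mpoly_ring_def)
    moreover have "0 \<in> {q \<in> carrier (mpoly_ring m). theta N q = (0 :: 'c mpoly)}"
      by (simp add: mpoly_ring_def)
    ultimately show ?thesis
      by (auto simp: theta_add image_iff intro!: bexI[of _ 0])
  qed
  then show ?thesis by (simp add: theta_quot_def)
qed

lemma coordinate_ring_cring:
  fixes h :: "'c::field \<Rightarrow> 'l::alg_closed_field"
  assumes "field_map h"
  shows "cring (coordinate_ring h m (face_variety N :: 'l ppoint set))"
  unfolding coordinate_ring_def
  by (rule ideal.quotient_is_cring[OF vanishing_ideal_ideal[OF assms] mpoly_ring_cring])

lemma residue_class_mem:
  fixes h :: "'c::field \<Rightarrow> 'l::alg_closed_field"
  assumes "field_map h" "p \<in> carrier (mpoly_ring m)"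
  shows "residue_class h m (face_variety N :: 'l ppoint set) p \<in> carrier (coordinate_ring h m (face_variety N))"
  using assms(2) by (auto simp: coordinate_ring_def residue_class_def FactRing_def A_RCOSETS_def')

lemma coordinate_ring_embedding:
  "field_embedding (coordinate_ring id m (face_variety N :: 'l::alg_closed_field ppoint set))
     (\<lambda>x. Fract (theta_quot x) 1)"
proof (rule field_embedding_Fract)
  show "cring (coordinate_ring id m (face_variety N :: 'l ppoint set))"
    by (rule coordinate_ring_cring[OF field_map_id])
  show "theta_quot \<in> ring_hom (coordinate_ring id m (face_variety N :: 'l ppoint set))
      (set_ring (monoid_algebra M))"
    "inj_on theta_quot (carrier (coordinate_ring id m (face_variety N :: 'l ppoint set)))"
    using theta_quot_iso[OF field_map_id] by (auto simp: ring_iso_def flag_algebra_def bij_betw_def)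
qed

text \<open>
  Multiplication by a homogeneous \<open>G\<close> shifts degrees, so only one homogeneous component of \<open>H\<close>
  contributes to a homogeneous product.
\<close>

lemma homogeneous_quotient:
  fixes G H :: "'c::field mpoly"
  assumes G: "G \<in> monoid_algebra (Mdeg d)" and H: "H \<in> monoid_algebra M"
    and GH: "G * H \<in> monoid_algebra (Mdeg (D + d))"
  shows "\<exists>H'\<in>monoid_algebra (Mdeg D). G * H = G * H'"
proof -
  define H' where "H' = (\<Sum>t\<in>keys H \<inter> Mdeg D. single t (lookup H t))"
  have lookup: "lookup H' t = (if t \<in> Mdeg D then lookup H t else 0)" for t
  proof -
    have "lookup H' t = (\<Sum>s\<in>keys H \<inter> Mdeg D. if s = t then lookup H t else 0)"
      unfolding H'_def lookup_sum by (intro sum.cong refl) (auto simp: lookup_single when_def)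
    then show ?thesis by (auto simp: sum.delta in_keys_iff)
  qed
  have H': "H' \<in> monoid_algebra (Mdeg D)"
    by (auto simp: monoid_algebra_def in_keys_iff lookup split: if_splits)
  have "keys (G * (H - H')) = {}"
  proof (rule ccontr)
    assume "keys (G * (H - H')) \<noteq> {}"
    then obtain w where w: "w \<in> keys (G * (H - H'))" by blast
    then obtain u v where uv: "w = u + v" "u \<in> keys G" "v \<in> keys (H - H')"
      using keys_mult[of G "H - H'"] by blast
    have "v \<in> M" "v \<notin> Mdeg D"
      using uv(3) H by (auto simp: in_keys_iff lookup_minus lookup monoid_algebra_def split: if_splits)
    then have "lookup w 0 \<noteq> D + d"
      using uv(1,2) G by (auto simp: monoid_algebra_def Mdeg_def lookup_add)
    moreover have "w \<in> keys (G * H) \<or> w \<in> keys (G * H')"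
      using w by (auto simp: right_diff_distrib in_keys_iff lookup_minus)
    moreover have "lookup w 0 = D + d" if w': "w \<in> keys (G * H')"
    proof -
      obtain u v where "w = u + v" "u \<in> keys G" "v \<in> keys H'"
        using keys_mult[of G H'] w' by blast
      moreover from this have "u \<in> Mdeg d" "v \<in> Mdeg D"
        using G H' by (auto simp: monoid_algebra_def)
      ultimately show ?thesis by (simp add: Mdeg_def lookup_add)
    qed
    ultimately show False using GH by (auto simp: monoid_algebra_def Mdeg_def)
  qed
  then have "G * (H - H') = 0" by simp
  then have "G * H = G * H'" by (simp add: right_diff_distrib)
  then show ?thesis using H' by blast
qed

lemma algebra_Mdeg_add:
  fixes F G :: "'c::field mpoly"
  shows "F \<in> monoid_algebra (Mdeg d) \<Longrightarrow> G \<in> monoid_algebra (Mdeg d) \<Longrightarrow> F + G \<in> monoid_algebra (Mdeg d)"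
  using Poly_Mapping.keys_add[of F G] by (auto simp: monoid_algebra_def)

lemma algebra_Mdeg_uminus: "F \<in> monoid_algebra (Mdeg d) \<Longrightarrow> - F \<in> monoid_algebra (Mdeg d)"
  for F :: "'c::field mpoly"
  by (auto simp: monoid_algebra_def in_keys_iff)

lemma algebra_Mdeg_mult:
  fixes F G :: "'c::field mpoly"
  assumes "F \<in> monoid_algebra (Mdeg c)" "G \<in> monoid_algebra (Mdeg d)"
  shows "F * G \<in> monoid_algebra (Mdeg (c + d))"
proof -
  have "w \<in> Mdeg (c + d)" if w: "w \<in> keys (F * G)" for w
  proof -
    obtain u v where "w = u + v" "u \<in> keys F" "v \<in> keys G"
      using w keys_mult[of F G] by blast
    moreover from this have "u \<in> Mdeg c" "v \<in> Mdeg d"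
      using assms by (auto simp: monoid_algebra_def)
    ultimately show ?thesis using Mdeg_add by simp
  qed
  then show ?thesis by (auto simp: monoid_algebra_def)
qed

lemma algebra_Mdeg_sub: "monoid_algebra (Mdeg d) \<subseteq> monoid_algebra M"
  using Mdeg_sub[of d] by (auto simp: monoid_algebra_def)

lemma algebra_Mdeg_one: "(1 :: 'c::field mpoly) \<in> monoid_algebra (Mdeg 0)"
  by (simp add: monoid_algebra_def Mdeg_0)

text \<open>
  The homogeneous localization of the monoid algebra at the prime ideal of the point with
  coordinates \<open>x\<close>.
\<close>

definition local_values :: "(nat \<Rightarrow> 'l::field) \<Rightarrow> 'l mpoly fract set" where
  "local_values x = {Fract F G | F G d. F \<in> monoid_algebra (Mdeg d) \<and> G \<in> monoid_algebra (Mdeg d) \<and>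
     mon_eval id (point_char x) G \<noteq> 0}"

context
  fixes x :: "nat \<Rightarrow> 'l::field"
  assumes x: "binomials_hold x"
begin

lemma point_eval_theta: "p \<in> carrier (mpoly_ring m) \<Longrightarrow>
    mon_eval id (point_char x) (theta N p) = peval id p x"
  using peval_eq_theta[OF field_map_id _ x, of p N] e_keys by auto

lemma point_eval_mult:
  assumes "F \<in> monoid_algebra M" "G \<in> monoid_algebra M"
  shows "mon_eval id (point_char x) (F * G)
      = mon_eval id (point_char x) F * mon_eval id (point_char x) G"
proof -
  interpret cring "mpoly_ring m :: 'l mpoly ring" by (rule mpoly_ring_cring)
  obtain f g where fg: "f \<in> carrier (mpoly_ring m)" "theta N f = F" "g \<in> carrier (mpoly_ring m)" "theta N g = G"
    using theta_surj[OF assms(1)] theta_surj[OF assms(2)] by blast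
  have "f * g \<in> carrier (mpoly_ring m)"
    using m_closed[OF fg(1,3)] by (simp add: mpoly_ring_def)
  then have "mon_eval id (point_char x) (theta N (f * g)) = peval id (f * g) x"
    by (rule point_eval_theta)
  then show ?thesis
    using point_eval_theta[OF fg(1)] point_eval_theta[OF fg(3)]
    by (simp add: theta_mult fg(2,4) field_map.peval_mult[OF field_map_id])
qed

lemma point_eval_one: "mon_eval id (point_char x) 1 = 1"
  using point_eval_theta[of 1] by (simp add: theta_one mpoly_ring_def field_map.peval_one[OF field_map_id])

lemma point_eval_nonzero: "mon_eval id (point_char x) G \<noteq> 0 \<Longrightarrow> G \<noteq> 0"
  by (auto simp: mon_eval_def)

lemma local_values_ring:
  "0 \<in> local_values x" "1 \<in> local_values x"
  "a \<in> local_values x \<Longrightarrow> b \<in> local_values x \<Longrightarrow> a + b \<in> local_values x"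
  "a \<in> local_values x \<Longrightarrow> b \<in> local_values x \<Longrightarrow> a * b \<in> local_values x"
  "a \<in> local_values x \<Longrightarrow> - a \<in> local_values x"
proof -
  have zero: "(0 :: 'l mpoly) \<in> monoid_algebra (Mdeg 0)" by (simp add: monoid_algebra_def)
  show "0 \<in> local_values x" "1 \<in> local_values x"
    unfolding local_values_def Zero_fract_def One_fract_def
    using zero algebra_Mdeg_one point_eval_one by (force, force)
  show "- a \<in> local_values x" if "a \<in> local_values x"
  proof -
    obtain F G d where *: "a = Fract F G" "F \<in> monoid_algebra (Mdeg d)" "G \<in> monoid_algebra (Mdeg d)"
      "mon_eval id (point_char x) G \<noteq> 0"
      using \<open>a \<in> local_values x\<close> unfolding local_values_def by blast
    then have "- a = Fract (- F) G" by simp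
    then show ?thesis
      unfolding local_values_def using * algebra_Mdeg_uminus[OF *(2)] by blast
  qed
  show "a + b \<in> local_values x" "a * b \<in> local_values x"
    if a: "a \<in> local_values x" and b: "b \<in> local_values x"
  proof -
    obtain F G d where *: "a = Fract F G" "F \<in> monoid_algebra (Mdeg d)" "G \<in> monoid_algebra (Mdeg d)"
      "mon_eval id (point_char x) G \<noteq> 0"
      using a unfolding local_values_def by blast
    obtain F' G' d' where **: "b = Fract F' G'" "F' \<in> monoid_algebra (Mdeg d')" "G' \<in> monoid_algebra (Mdeg d')"
      "mon_eval id (point_char x) G' \<noteq> 0"
      using b unfolding local_values_def by blast
    have GG: "mon_eval id (point_char x) (G * G') \<noteq> 0" "G * G' \<in> monoid_algebra (Mdeg (d + d'))"
      using *(4) **(4) algebra_Mdeg_mult[OF *(3) **(3)]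
        point_eval_mult[OF subsetD[OF algebra_Mdeg_sub *(3)] subsetD[OF algebra_Mdeg_sub **(3)]] by auto
    have "a + b = Fract (F * G' + F' * G) (G * G')" "a * b = Fract (F * F') (G * G')"
      using * ** point_eval_nonzero by auto
    moreover have "F * G' + F' * G \<in> monoid_algebra (Mdeg (d + d'))" "F * F' \<in> monoid_algebra (Mdeg (d + d'))"
      using algebra_Mdeg_mult[OF *(2) **(3)] algebra_Mdeg_mult[OF **(2) *(3)] algebra_Mdeg_mult[OF *(2) **(2)]
        algebra_Mdeg_add by (auto simp: add.commute)
    ultimately show "a + b \<in> local_values x" "a * b \<in> local_values x"
      unfolding local_values_def using GG by blast+
  qed
qed

text \<open>
  Clearing the denominators \<open>K\<close> of an integral equation for \<open>F / G\<close> makes \<open>K F / G\<close> integral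
  over the monoid algebra, which is normal; the quotient \<open>H = K F / G\<close> may be taken
  homogeneous, and \<open>F / G = H / K\<close>.
\<close>

lemma local_values_integrally_closed:
  assumes a: "a \<in> local_values x" and b: "b \<in> local_values x" "b \<noteq> 0"
    and int: "integral_elem (local_values x) (a / b)"
  shows "a / b \<in> local_values x"
proof -
  define ev where "ev = mon_eval id (point_char x)"
  have lv: "local_values x = {Fract F G | F G d. F \<in> monoid_algebra (Mdeg d) \<and>
      G \<in> monoid_algebra (Mdeg d) \<and> ev G \<noteq> 0}"
    by (simp add: local_values_def ev_def)
  have ev_nz: "G \<noteq> 0" if "ev G \<noteq> 0" for G
    using that point_eval_nonzero by (simp add: ev_def)
  let ?C = "(\<lambda>f. Fract f 1) ` (monoid_algebra M :: 'l mpoly set)"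
  have C: "u \<in> ?C \<Longrightarrow> v \<in> ?C \<Longrightarrow> u * v \<in> ?C" "u \<in> ?C \<Longrightarrow> u ^ k \<in> ?C" for u v and k :: nat
  proof -
    assume u: "u \<in> ?C"
    then obtain f where f: "f \<in> monoid_algebra M" "u = Fract f 1" by blast
    then show "u ^ k \<in> ?C"
      using algebra_power[OF f(1)] by (intro image_eqI[of _ _ "f ^ k"]) (auto simp: Fract_power)
    assume "v \<in> ?C"
    then obtain g where g: "g \<in> monoid_algebra M" "v = Fract g 1" by blast
    then show "u * v \<in> ?C"
      using f algebra_mult[OF f(1) g(1)] by (intro image_eqI[of _ _ "f * g"]) auto
  qed
  obtain F1 G1 d1 where 1: "a = Fract F1 G1" "F1 \<in> monoid_algebra (Mdeg d1)" "G1 \<in> monoid_algebra (Mdeg d1)"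
    "ev G1 \<noteq> 0" using a unfolding lv by blast
  obtain F2 G2 d2 where 2: "b = Fract F2 G2" "F2 \<in> monoid_algebra (Mdeg d2)" "G2 \<in> monoid_algebra (Mdeg d2)"
    "ev G2 \<noteq> 0" using b unfolding lv by blast
  have G_nz: "G1 \<noteq> 0" "G2 \<noteq> 0"
    by (rule ev_nz, rule 1 2)+
  have "F2 \<noteq> 0"
    using b(2) unfolding 2(1) by (auto simp: fract_collapse)
  note nz = G_nz this
  define F G d where "F = F1 * G2" and "G = G1 * F2" and "d = d1 + d2"
  have FG: "F \<in> monoid_algebra (Mdeg d)" "G \<in> monoid_algebra (Mdeg d)" "G \<noteq> 0" "a / b = Fract F G"
    using 1 2 nz algebra_Mdeg_mult by (auto simp: F_def G_def d_def)
  obtain n c where c: "\<And>i. i < n \<Longrightarrow> c i \<in> local_values x" "(a / b) ^ n + (\<Sum>i<n. c i * (a / b) ^ i) = 0"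
    using int by (auto simp: integral_elem_def)
  define good where "good v q \<longleftrightarrow> v = Fract (fst q) (fst (snd q)) \<and> fst q \<in> monoid_algebra (Mdeg (snd (snd q))) \<and>
    fst (snd q) \<in> monoid_algebra (Mdeg (snd (snd q))) \<and> ev (fst (snd q)) \<noteq> 0"
    for v :: "'l mpoly fract" and q
  define s where "s i = (SOME q. good (c i) q)" for i
  have good: "good (c i) (s i)" if i: "i < n" for i
  proof -
    obtain H K e where "c i = Fract H K" "H \<in> monoid_algebra (Mdeg e)" "K \<in> monoid_algebra (Mdeg e)" "ev K \<noteq> 0"
      using c(1)[OF i] unfolding lv by blast
    then have "good (c i) (H, K, e)" by (simp add: good_def)
    then show ?thesis unfolding s_def by (rule someI)
  qed
  define H K e where "H i = fst (s i)" and "K i = fst (snd (s i))" and "e i = snd (snd (s i))" for i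
  have HK: "c i = Fract (H i) (K i)" "H i \<in> monoid_algebra (Mdeg (e i))"
    "K i \<in> monoid_algebra (Mdeg (e i))" "ev (K i) \<noteq> 0" if "i < n" for i
    using good[OF that] by (auto simp: good_def H_def K_def e_def)
  have prod: "(\<Prod>i\<in>A. K i) \<in> monoid_algebra (Mdeg (\<Sum>i\<in>A. e i)) \<and> ev (\<Prod>i\<in>A. K i) \<noteq> 0"
    if "A \<subseteq> {..<n}" for A
    using finite_subset[OF that finite_lessThan] that
  proof (induction A rule: finite_induct)
    case empty
    then show ?case using point_eval_one by (simp add: algebra_Mdeg_one ev_def[symmetric])
  next
    case (insert i A)
    then have i: "i < n" and A: "(\<Prod>i\<in>A. K i) \<in> monoid_algebra (Mdeg (\<Sum>i\<in>A. e i))" "ev (\<Prod>i\<in>A. K i) \<noteq> 0"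
      by auto
    have "ev (K i * (\<Prod>i\<in>A. K i)) = ev (K i) * ev (\<Prod>i\<in>A. K i)"
      unfolding ev_def
      by (rule point_eval_mult[OF subsetD[OF algebra_Mdeg_sub HK(3)[OF i]] subsetD[OF algebra_Mdeg_sub A(1)]])
    then show ?case
      using algebra_Mdeg_mult[OF HK(3)[OF i] A(1)] HK(4)[OF i] A(2) insert.hyps by simp
  qed
  define k where "k = (\<Prod>i<n. K i)"
  define D where "D = (\<Sum>i<n. e i)"
  have k: "k \<in> monoid_algebra (Mdeg D)" "ev k \<noteq> 0"
    using prod[of "{..<n}"] by (auto simp: k_def D_def)
  then have k_nz: "k \<noteq> 0" using ev_nz by blast
  have kc: "Fract k 1 * c i \<in> ?C" if i: "i < n" for i
  proof -
    have "k = K i * (\<Prod>j\<in>{..<n} - {i}. K j)"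
      unfolding k_def using i by (intro prod.remove) auto
    moreover have "K i \<noteq> 0" using HK(4)[OF i] ev_nz by blast
    ultimately have "Fract k 1 * c i = Fract (H i * (\<Prod>j\<in>{..<n} - {i}. K j)) 1"
      by (simp add: HK(1)[OF i] eq_fract mult_ac)
    moreover have "H i * (\<Prod>j\<in>{..<n} - {i}. K j) \<in> monoid_algebra M"
      using HK(2)[OF i] prod[of "{..<n} - {i}"] algebra_Mdeg_sub by (intro algebra_mult) auto
    ultimately show ?thesis by blast
  qed
  let ?k = "Fract k 1"
  have "integral_elem ?C (?k * (a / b))"
    unfolding integral_elem_def
  proof (intro exI[of _ n] exI[of _ "\<lambda>i. ?k ^ (n - i) * c i"] conjI allI impI)
    fix i assume i: "i < n"
    obtain r where r: "n - i = Suc r" using i by (metis Suc_diff_Suc)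
    have eq: "?k ^ (n - i) * c i = ?k ^ r * (?k * c i)"
      unfolding r power_Suc2 by (rule mult.assoc)
    have "?k \<in> ?C" using k(1) algebra_Mdeg_sub by blast
    then show "?k ^ (n - i) * c i \<in> ?C"
      unfolding eq by (intro C kc i)
  next
    have "(?k * (a / b)) ^ n + (\<Sum>i<n. ?k ^ (n - i) * c i * (?k * (a / b)) ^ i)
        = ?k ^ n * ((a / b) ^ n + (\<Sum>i<n. c i * (a / b) ^ i))"
    proof -
      have "?k ^ (n - i) * c i * (?k * (a / b)) ^ i = ?k ^ n * (c i * (a / b) ^ i)" if "i < n" for i
      proof -
        have "?k ^ n = ?k ^ (n - i) * ?k ^ i"
          using that by (simp only: le_add_diff_inverse2 less_imp_le flip: power_add)
        then show ?thesis by (simp only: power_mult_distrib mult_ac)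
      qed
      then have "(\<Sum>i<n. ?k ^ (n - i) * c i * (?k * (a / b)) ^ i) = (\<Sum>i<n. ?k ^ n * (c i * (a / b) ^ i))"
        by (intro sum.cong refl) (simp only: lessThan_iff)
      then show ?thesis
        by (simp only: power_mult_distrib distrib_left sum_distrib_left)
    qed
    then show "(?k * (a / b)) ^ n + (\<Sum>i<n. ?k ^ (n - i) * c i * (?k * (a / b)) ^ i) = 0"
      using c(2) by simp
  qed
  then have "integral_elem ?C (Fract (k * F) G)"
    by (simp add: FG(4))
  then obtain h where h: "h \<in> monoid_algebra M" "k * F = G * h"
    using integrally_closed[of "k * F" G] FG k(1) algebra_Mdeg_sub algebra_mult by blast
  have "k * F \<in> monoid_algebra (Mdeg (D + d))"
    using algebra_Mdeg_mult[OF k(1) FG(1)] .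
  then obtain h' where h': "h' \<in> monoid_algebra (Mdeg D)" "k * F = G * h'"
    using homogeneous_quotient[OF FG(2) h(1), of D] h(2) by auto
  have "a / b = Fract h' k"
    using h'(2) k_nz FG(3,4) by (simp add: eq_fract mult_ac)
  then show ?thesis
    unfolding lv using h'(1) k by blast
qed

end

text \<open>
  Taking values identifies the local ring at a point with \<open>local_values\<close>, so that its
  normality can be tested there.
\<close>

theorem normal_variety_face_variety: "normal_variety m (face_variety N :: 'l::alg_closed_field ppoint set)"
  unfolding normal_variety_def
proof
  fix P :: "'l ppoint" assume P: "P \<in> face_variety N"
  let ?V = "face_variety N :: 'l ppoint set"
  define R where "R = coordinate_ring id m ?V"
  interpret E: field_embedding R "\<lambda>x. Fract (theta_quot x) 1"
    unfolding R_def by (rule coordinate_ring_embedding)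
  interpret Q: field_embedding "fraction_field R" E.quot_val
    by (rule E.fraction_field_embedding)
  have Pp: "P \<in> proj_space m" using P by (simp add: face_variety_N)
  obtain x where x: "x \<in> P" using proj_space_ex[OF Pp] by blast
  have bin: "binomials_hold x" using P x by (simp add: face_variety_N)
  let ?res = "residue_class id m ?V"
  have res: "?res p \<in> carrier R" "theta_quot (?res p) = theta N p" if "form m d p" for p d
    using residue_class_mem[OF field_map_id form_mpoly[OF that]]
      theta_quot_residue_class[OF field_map_id form_mpoly[OF that]] by (auto simp: R_def)
  have ev: "mon_eval id (point_char x) (theta N p) = peval id p x" if "form m d p" for p d
    using point_eval_theta[OF bin form_mpoly[OF that]] .
  have res_nz: "?res g \<in> carrier R - {\<zero>\<^bsub>R\<^esub>}" if g: "form m d g" "\<not> vanishes_at id g P" for g d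
  proof -
    have "peval id g x \<noteq> 0"
      using g(2) form_vanishes_at_iff[OF field_map_id g(1) Pp x] by simp
    then have "theta N g \<noteq> 0" using ev[OF g(1)] by (auto simp: mon_eval_def)
    then have "Fract (theta_quot (?res g)) 1 \<noteq> 0"
      using res(2)[OF g(1)] by (simp add: Zero_fract_def eq_fract)
    then show ?thesis using E.j_zero res(1)[OF g(1)] by auto
  qed
  define C where "C = {fraction R (?res f) (?res g) | f g d. form m d f \<and> form m d g \<and> \<not> vanishes_at id g P}"
  let ?L = "fraction_field R\<lparr>carrier := C\<rparr>"
  have L: "local_ring m ?V P = ?L"
    by (simp add: local_ring_def C_def R_def)
  have val: "E.quot_val (fraction R (?res f) (?res g)) = Fract (theta N f) (theta N g)"
    if "form m d f" "form m d g" "\<not> vanishes_at id g P" for f g d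
    using E.quot_val_fraction[OF res(1)[OF that(1)] res_nz[OF that(2,3)]] res(2) that by simp
  have C_sub: "C \<subseteq> carrier (fraction_field R)"
  proof
    fix y assume "y \<in> C"
    then obtain f g d where *: "y = fraction R (?res f) (?res g)" "form m d f" "form m d g" "\<not> vanishes_at id g P"
      unfolding C_def by blast
    then show "y \<in> carrier (fraction_field R)"
      unfolding E.carrier_fraction_field using res(1)[OF *(2)] res_nz[OF *(3,4)] by blast
  qed
  have C_val: "E.quot_val y \<in> local_values x" if "y \<in> C" for y
  proof -
    obtain f g d where *: "y = fraction R (?res f) (?res g)" "form m d f" "form m d g" "\<not> vanishes_at id g P"
      using \<open>y \<in> C\<close> unfolding C_def by blast
    have "mon_eval id (point_char x) (theta N g) \<noteq> 0"
      using ev[OF *(3)] *(4) form_vanishes_at_iff[OF field_map_id *(3) Pp x] by simp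
    then have "Fract (theta N f) (theta N g) \<in> local_values x"
      unfolding local_values_def using theta_form_mem[OF *(2), of N] theta_form_mem[OF *(3), of N] by blast
    then show ?thesis
      using val[OF *(2-4)] *(1) by simp
  qed
  have val_C: "\<exists>y\<in>C. E.quot_val y = v" if v: "v \<in> local_values x" for v
  proof -
    obtain F G d where *: "v = Fract F G" "F \<in> monoid_algebra (Mdeg d)" "G \<in> monoid_algebra (Mdeg d)"
      "mon_eval id (point_char x) G \<noteq> 0" using v unfolding local_values_def by blast
    have "F \<in> monoid_algebra M" "G \<in> monoid_algebra M" using *(2,3) algebra_Mdeg_sub by auto
    then obtain f g where fg: "theta N f = F" "form m d f" "theta N g = G" "form m d g"
      using theta_surj[of F] theta_surj[of G] *(2,3) by metis
    have nv: "\<not> vanishes_at id g P"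
      using ev[OF fg(4)] *(4) fg(3) form_vanishes_at_iff[OF field_map_id fg(4) Pp x] by simp
    then have "fraction R (?res f) (?res g) \<in> C"
      using fg unfolding C_def by blast
    then show ?thesis
      using val[OF fg(2,4) nv] fg *(1) by auto
  qed
  have memI: "y \<in> C" if y: "y \<in> carrier (fraction_field R)" "E.quot_val y \<in> local_values x" for y
  proof -
    obtain z where z: "z \<in> C" "E.quot_val z = E.quot_val y" using val_C[OF y(2)] by blast
    then have "z = y" using Q.j_eq_iff[of z y] C_sub y(1) by blast
    then show ?thesis using z by simp
  qed
  note closed = local_values_ring[OF bin]
  interpret L: field_embedding ?L E.quot_val
  proof
    show "inj_on E.quot_val (carrier ?L)"
      using inj_on_subset[OF Q.inj C_sub] by simp
    show "\<one>\<^bsub>?L\<^esub> \<in> carrier ?L"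
      "\<zero>\<^bsub>?L\<^esub> \<in> carrier ?L"
      using memI[OF Q.one_closed] memI[OF Q.zero_closed] closed(1,2) by (auto simp: Q.j_one Q.j_zero)
    show "E.quot_val \<one>\<^bsub>?L\<^esub> = 1"
      "E.quot_val \<zero>\<^bsub>?L\<^esub> = 0"
      by (simp_all add: Q.j_one Q.j_zero)
    fix y assume "y \<in> carrier ?L"
    then have y: "y \<in> C" by simp
    show "\<exists>z\<in>carrier ?L. E.quot_val z = - E.quot_val y"
      using val_C[OF closed(5)[OF C_val[OF y]]] by simp
    fix z assume "z \<in> carrier ?L"
    then have z: "z \<in> C" by simp
    have yz: "y \<in> carrier (fraction_field R)" "z \<in> carrier (fraction_field R)" using y z C_sub by auto
    show "E.quot_val (y \<oplus>\<^bsub>?L\<^esub> z) = E.quot_val y + E.quot_val z"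
      "E.quot_val (y \<otimes>\<^bsub>?L\<^esub> z) = E.quot_val y * E.quot_val z"
      using Q.j_add[OF yz] Q.j_mult[OF yz] by simp_all
    show "y \<oplus>\<^bsub>?L\<^esub> z \<in> carrier ?L"
      "y \<otimes>\<^bsub>?L\<^esub> z \<in> carrier ?L"
      using memI[OF Q.add_closed[OF yz]] memI[OF Q.mult_closed[OF yz]] closed(3,4) C_val[OF y] C_val[OF z]
      by (simp_all add: Q.j_add[OF yz] Q.j_mult[OF yz])
  qed
  have img: "E.quot_val ` C = local_values x"
    using C_val val_C by blast
  show "normal_domain (local_ring m ?V P)"
    unfolding L
  proof (rule L.normal_domainI)
    fix a b assume "a \<in> carrier ?L" "b \<in> carrier ?L"
      "E.quot_val b \<noteq> 0"
      "integral_elem (E.quot_val ` carrier ?L) (E.quot_val a / E.quot_val b)"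
    then show "E.quot_val a / E.quot_val b \<in> E.quot_val ` carrier ?L"
      using local_values_integrally_closed[OF bin] C_val by (simp add: img)
  qed
qed

end

section \<open>LS-paths in integral coordinates\<close>

text \<open>Serves to carry the LS algebra over to the monoid algebra of \<open>M\<close>.\<close>

definition relabel :: "('m \<Rightarrow> 'n) \<Rightarrow> ('m \<Rightarrow>\<^sub>0 'c::comm_semiring_1) \<Rightarrow> ('n::comm_monoid_add \<Rightarrow>\<^sub>0 'c)" where
  "relabel w = mon_eval (single 0) (\<lambda>u. single (w u) 1)"

lemma relabel_eq: "relabel w f = (\<Sum>u\<in>keys f. single (w u) (lookup f u))"
  by (simp add: relabel_def mon_eval_def mult_single)

lemma lookup_relabel:
  assumes "inj_on w A" "f \<in> monoid_algebra A" "u \<in> A"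
  shows "lookup (relabel w f) (w u) = lookup f u"
proof -
  have "lookup (relabel w f) (w u) =
      (\<Sum>v\<in>keys f. if v = u then lookup f u else 0)"
    unfolding relabel_eq lookup_sum
    using assms by (intro sum.cong refl) (auto simp: lookup_single when_def monoid_algebra_def inj_on_def)
  then show ?thesis by (auto simp: sum.delta in_keys_iff)
qed

lemma relabel_keys: "keys (relabel w f) \<subseteq> w ` keys f"
  unfolding relabel_eq by (rule order.trans[OF keys_sum_subset]) (auto split: if_splits)

lemma relabel_mem: "f \<in> monoid_algebra A \<Longrightarrow> relabel w f \<in> monoid_algebra (w ` A)"
  using relabel_keys[of w f] unfolding monoid_algebra_def by blast

lemma relabel_image:
  fixes w :: "'m \<Rightarrow> 'n::comm_monoid_add"
  shows "relabel w ` (monoid_algebra A :: ('m \<Rightarrow>\<^sub>0 'c::comm_semiring_1) set) = monoid_algebra (w ` A)"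
proof (intro equalityI subsetI)
  fix g :: "'n \<Rightarrow>\<^sub>0 'c" assume g: "g \<in> monoid_algebra (w ` A)"
  define s where "s t = (SOME u. u \<in> A \<and> w u = t)" for t
  have s: "s t \<in> A" "w (s t) = t" if "t \<in> keys g" for t
  proof -
    have "\<exists>u. u \<in> A \<and> w u = t" using g that by (auto simp: monoid_algebra_def)
    from someI_ex[OF this] show "s t \<in> A" "w (s t) = t" by (auto simp: s_def)
  qed
  define f where "f = (\<Sum>t\<in>keys g. single (s t) (lookup g t))"
  have "keys f \<subseteq> A"
    unfolding f_def by (rule order.trans[OF keys_sum_subset]) (use s in \<open>auto split: if_splits\<close>)
  moreover have "relabel w f = (\<Sum>t\<in>keys g. single t (lookup g t))"
    unfolding relabel_def f_def semiring_map.mon_eval_sum[OF semiring_map_single]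
    by (intro sum.cong refl) (simp add: semiring_map.mon_eval_single[OF semiring_map_single] mult_single s)
  then have "relabel w f = g" using poly_mapping_expand[of g] by simp
  ultimately show "g \<in> relabel w ` monoid_algebra A"
    unfolding monoid_algebra_def by blast
qed (auto intro: relabel_mem)

lemma relabel_iso:
  fixes w :: "'m::comm_monoid_add \<Rightarrow> 'n::comm_monoid_add"
  assumes inj: "inj_on w A" and A: "0 \<in> A" "\<And>u v. u \<in> A \<Longrightarrow> v \<in> A \<Longrightarrow> u + v \<in> A"
    and w: "w 0 = 0" "\<And>u v. u \<in> A \<Longrightarrow> v \<in> A \<Longrightarrow> w (u + v) = w u + w v"
  shows "relabel w \<in> ring_iso
    (set_ring (monoid_algebra A) :: ('m \<Rightarrow>\<^sub>0 'c::comm_ring_1) ring)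
    (set_ring (monoid_algebra (w ` A)))"
proof (rule ring_iso_memI)
  interpret s: semiring_map "\<lambda>c::'c. single (0::'n) c" by (rule semiring_map_single)
  have mult: "relabel w (f * g) = relabel w f * relabel w g"
    if "f \<in> monoid_algebra A" "g \<in> monoid_algebra A" for f g :: "'m \<Rightarrow>\<^sub>0 'c"
    unfolding relabel_def
    using that by (intro s.mon_eval_mult) (auto simp: monoid_algebra_def mult_single w subset_iff)
  have add: "relabel w (f + g) = relabel w f + relabel w g" for f g :: "'m \<Rightarrow>\<^sub>0 'c"
    unfolding relabel_def by (rule s.mon_eval_add)
  let ?R = "(set_ring (monoid_algebra A) :: ('m \<Rightarrow>\<^sub>0 'c) ring)"
  let ?S = "(set_ring (monoid_algebra (w ` A)) :: ('n \<Rightarrow>\<^sub>0 'c) ring)"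
  show "relabel w \<one>\<^bsub>?R\<^esub> = \<one>\<^bsub>?S\<^esub>"
    using s.mon_eval_one[of "\<lambda>u. single (w u) 1"] by (simp add: relabel_def w)
  have "f = g" if fg: "f \<in> monoid_algebra A" "g \<in> monoid_algebra A" "relabel w f = relabel w g"
    for f g :: "'m \<Rightarrow>\<^sub>0 'c"
  proof (rule poly_mapping_eqI)
    fix u
    show "lookup f u = lookup g u"
    proof (cases "u \<in> A")
      case True
      then show ?thesis
        using lookup_relabel[OF inj fg(1) True] lookup_relabel[OF inj fg(2) True] fg(3) by simp
    next
      case False
      then have "u \<notin> keys f" "u \<notin> keys g"
        using fg by (auto simp: monoid_algebra_def)
      then show ?thesis by (simp add: in_keys_iff)
    qed
  qed
  then have "inj_on (relabel w) (monoid_algebra A :: ('m \<Rightarrow>\<^sub>0 'c) set)"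
    by (intro inj_onI)
  then show "bij_betw (relabel w) (carrier ?R) (carrier ?S)"
    by (simp add: bij_betw_def relabel_image)
  fix f g assume "f \<in> carrier ?R" "g \<in> carrier ?R"
  then have fg: "f \<in> monoid_algebra A" "g \<in> monoid_algebra A" by simp_all
  show "relabel w (f \<otimes>\<^bsub>?R\<^esub> g) = relabel w f \<otimes>\<^bsub>?S\<^esub> relabel w g"
    "relabel w (f \<oplus>\<^bsub>?R\<^esub> g) = relabel w f \<oplus>\<^bsub>?S\<^esub> relabel w g"
    using mult[OF fg] add by simp_all
qed (use relabel_mem in auto)

text \<open>The denominator of \<open>a\<close> divides every element of \<open>B\<close>.\<close>

lemma of_nat_Gcd_mult:
  fixes a :: rat
  assumes "a \<ge> 0" "\<And>n. n \<in> B \<Longrightarrow> of_nat n * a \<in> \<nat>"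
  shows "of_nat (Gcd B) * a \<in> \<nat>"
proof -
  obtain p q where pq: "quotient_of a = (p, q)" by (cases "quotient_of a")
  then have q: "q > 0" and a: "a = of_int p / of_int q" and cop: "coprime p q"
    using quotient_of_denom_pos quotient_of_div quotient_of_coprime by auto
  have p: "p \<ge> 0" using assms(1) q unfolding a by (simp add: zero_le_divide_iff)
  have "nat q dvd n" if n: "n \<in> B" for n
  proof -
    obtain k where "of_nat n * a = of_nat k" using assms(2)[OF n] by (auto simp: Nats_def)
    then have "(of_int (int n * p) :: rat) = of_int (int k * q)"
      using q unfolding a by (simp add: field_simps)
    then have "int n * p = int k * q" by (simp only: of_int_eq_iff)
    then have "q dvd int n * p" by simp
    then have "q dvd int n" using cop by (simp add: coprime_commute coprime_dvd_mult_left_iff)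
    then show ?thesis using q by (simp add: nat_dvd_iff)
  qed
  then have "nat q dvd Gcd B" by (rule Gcd_greatest)
  then obtain k where k: "Gcd B = nat q * k" by blast
  have "of_nat (Gcd B) * a = of_nat (k * nat p)"
    using q p unfolding k a by simp
  then show ?thesis by simp
qed

locale bonded_chain =
  fixes S :: "'s::linorder set" and b :: "'s \<Rightarrow> 's \<Rightarrow> nat" and N :: nat
  assumes finite_S: "finite S" and card_S: "card S = N + 1" and bonds_S: "bonds S b"
begin

definition \<rho> :: "nat \<Rightarrow> 's" where
  "\<rho> i = sorted_list_of_set S ! (N - i)"

definition \<beta> :: "nat \<Rightarrow> nat" where
  "\<beta> i = (if i \<in> {1..N} then b (\<rho> i) (\<rho> (i - 1)) else 1)"

lemma rho_less: "i < j \<Longrightarrow> j \<le> N \<Longrightarrow> \<rho> j < \<rho> i"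
  unfolding \<rho>_def using card_S strict_sorted_list_of_set[of S]
  by (intro sorted_wrt_nth_less[of "(<)"]) auto

lemma rho_image: "\<rho> ` {..N} = S"
proof -
  have "S = (\<lambda>i. sorted_list_of_set S ! i) ` {..N}"
    using finite_S card_S set_conv_nth[of "sorted_list_of_set S"]
    by (auto simp: image_iff less_Suc_eq_le)
  also have "{..N} = (\<lambda>i. N - i) ` {..N}"
  proof (intro equalityI subsetI)
    fix x assume "x \<in> {..N}"
    then show "x \<in> (\<lambda>i. N - i) ` {..N}" by (intro image_eqI[of _ _ "N - x"]) auto
  qed auto
  finally show ?thesis by (simp add: image_image \<rho>_def)
qed

lemma rho_le_iff: "i \<le> N \<Longrightarrow> j \<le> N \<Longrightarrow> \<rho> i \<le> \<rho> j \<longleftrightarrow> j \<le> i"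
  using rho_less[of i j] rho_less[of j i] by (metis leD le_cases less_imp_le nat_less_le order_refl)

lemma rho_less_iff: "i \<le> N \<Longrightarrow> j \<le> N \<Longrightarrow> \<rho> i < \<rho> j \<longleftrightarrow> j < i"
  using rho_le_iff[of j i] by (simp add: not_le[symmetric])

lemma rho_eq_iff: "i \<le> N \<Longrightarrow> j \<le> N \<Longrightarrow> \<rho> i = \<rho> j \<longleftrightarrow> i = j"
  using rho_le_iff[of i j] rho_le_iff[of j i] by (auto simp: order.eq_iff)

lemma rho_inj: "inj_on \<rho> {..N}"
  by (auto simp: inj_on_def rho_eq_iff)

lemma rho_mem: "i \<le> N \<Longrightarrow> \<rho> i \<in> S"
  using rho_image by blast

lemma rho_cases:
  assumes "\<sigma> \<in> S" obtains i where "i \<le> N" "\<sigma> = \<rho> i"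
  using assms rho_image by blast

lemma rho_top: "\<sigma> \<in> S \<Longrightarrow> \<sigma> \<le> \<rho> 0"
  by (elim rho_cases) (simp add: rho_le_iff)

lemma succ_in_iff: "succ_in S x y \<longleftrightarrow> (\<exists>i\<in>{1..N}. x = \<rho> i \<and> y = \<rho> (i - 1))"
proof
  assume s: "succ_in S x y"
  then obtain i j where ij: "i \<le> N" "x = \<rho> i" "j \<le> N" "y = \<rho> j"
    by (auto simp: succ_in_def elim!: rho_cases)
  then have "j < i" using s by (simp add: succ_in_def rho_less_iff)
  have "j = i - 1"
  proof (rule ccontr)
    assume "j \<noteq> i - 1"
    then have "j < i - 1" "i - 1 < i" "i - 1 \<le> N" using \<open>j < i\<close> ij by auto
    then have "\<rho> i < \<rho> (i - 1)" "\<rho> (i - 1) < \<rho> j" "\<rho> (i - 1) \<in> S"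
      using ij by (auto simp: rho_less_iff intro: rho_mem)
    then show False using s ij by (auto simp: succ_in_def)
  qed
  then show "\<exists>i\<in>{1..N}. x = \<rho> i \<and> y = \<rho> (i - 1)"
    using ij \<open>j < i\<close> by (intro bexI[of _ i]) auto
next
  assume "\<exists>i\<in>{1..N}. x = \<rho> i \<and> y = \<rho> (i - 1)"
  then obtain i where i: "i \<in> {1..N}" "x = \<rho> i" "y = \<rho> (i - 1)" by blast
  have "False" if "z \<in> S" "\<rho> i < z" "z < \<rho> (i - 1)" for z
  proof -
    obtain j where "j \<le> N" "z = \<rho> j" using rho_cases[OF \<open>z \<in> S\<close>] .
    then show False using that i by (auto simp: rho_less_iff)
  qed
  then show "succ_in S x y"
    using i by (auto simp: succ_in_def rho_mem rho_less_iff)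
qed

sublocale flag_monoid N \<beta>
proof
  show "\<beta> 0 = 1" by (simp add: \<beta>_def)
  fix i
  show "\<beta> i > 0"
    using bonds_S succ_in_iff[of "\<rho> i" "\<rho> (i - 1)"] by (auto simp: \<beta>_def bonds_def)
qed

lemma bond_eq:
  assumes "q < p" "p \<le> N"
  shows "bond S b (\<rho> p) (\<rho> q) = Gcd (\<beta> ` {q<..p})"
proof -
  have "{b s t | s t. succ_in S s t \<and> \<rho> p \<le> s \<and> t \<le> \<rho> q} = \<beta> ` {q<..p}"
  proof (intro equalityI subsetI)
    fix n assume "n \<in> {b s t | s t. succ_in S s t \<and> \<rho> p \<le> s \<and> t \<le> \<rho> q}"
    then obtain i where i: "i \<in> {1..N}" "n = b (\<rho> i) (\<rho> (i - 1))" "\<rho> p \<le> \<rho> i" "\<rho> (i - 1) \<le> \<rho> q"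
      by (auto simp: succ_in_iff)
    have "i - 1 \<le> N" "q \<le> N" "i \<le> N" using i(1) assms by auto
    then have "i \<le> p" "q \<le> i - 1" using i(3,4) assms by (auto simp: rho_le_iff)
    then have "i \<in> {q<..p}" using i(1) by auto
    then show "n \<in> \<beta> ` {q<..p}" using i by (auto simp: \<beta>_def)
  next
    fix n assume "n \<in> \<beta> ` {q<..p}"
    then obtain i where i: "i \<in> {q<..p}" "n = \<beta> i" by blast
    then have "i \<in> {1..N}" "i - 1 \<le> N" "q \<le> N" "i \<le> N" "q \<le> i - 1" "i \<le> p" using assms by auto
    then have "succ_in S (\<rho> i) (\<rho> (i - 1))" "\<rho> p \<le> \<rho> i" "\<rho> (i - 1) \<le> \<rho> q" "n = b (\<rho> i) (\<rho> (i - 1))"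
      using i assms by (auto simp: succ_in_iff rho_le_iff \<beta>_def)
    then show "n \<in> {b s t | s t. succ_in S s t \<and> \<rho> p \<le> s \<and> t \<le> \<rho> q}" by blast
  qed
  then show ?thesis by (simp add: bond_def)
qed

definition psum :: "('s \<Rightarrow>\<^sub>0 rat) \<Rightarrow> nat \<Rightarrow> rat" where
  "psum \<pi> i = (\<Sum>j\<in>{i..N}. lookup \<pi> (\<rho> j))"

lemma psum_add: "psum (\<pi> + \<pi>') i = psum \<pi> i + psum \<pi>' i"
  by (simp add: psum_def lookup_add sum.distrib)

lemma psum_step: "i \<le> N \<Longrightarrow> psum \<pi> i = lookup \<pi> (\<rho> i) + psum \<pi> (Suc i)"
  unfolding psum_def by (simp add: sum.atLeast_Suc_atMost)

lemma psum_eq_sum_keys: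
  assumes "keys \<pi> \<subseteq> S" "i \<le> N"
  shows "(\<Sum>\<sigma>\<in>{\<sigma> \<in> keys \<pi>. \<sigma> \<le> \<rho> i}. lookup \<pi> \<sigma>) = psum \<pi> i"
proof -
  have "psum \<pi> i = (\<Sum>\<sigma>\<in>\<rho> ` {i..N}. lookup \<pi> \<sigma>)"
    unfolding psum_def by (subst sum.reindex) (auto intro: inj_on_subset[OF rho_inj])
  also have "\<dots> = (\<Sum>\<sigma>\<in>{\<sigma> \<in> keys \<pi>. \<sigma> \<le> \<rho> i}. lookup \<pi> \<sigma>)"
  proof (rule sum.mono_neutral_right)
    show "{\<sigma> \<in> keys \<pi>. \<sigma> \<le> \<rho> i} \<subseteq> \<rho> ` {i..N}"
    proof
      fix \<sigma> assume \<sigma>: "\<sigma> \<in> {\<sigma> \<in> keys \<pi>. \<sigma> \<le> \<rho> i}"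
      then have "\<sigma> \<in> S" using assms(1) by auto
      then obtain j where "j \<le> N" "\<sigma> = \<rho> j" by (rule rho_cases)
      then show "\<sigma> \<in> \<rho> ` {i..N}" using \<sigma> assms(2) by (auto simp: rho_le_iff)
    qed
  qed (use assms(2) in \<open>auto simp: in_keys_iff rho_le_iff\<close>)
  finally show ?thesis by simp
qed

lemma psum_const:
  assumes "i \<le> p" "p \<le> N" "\<And>j. i \<le> j \<Longrightarrow> j < p \<Longrightarrow> \<rho> j \<notin> keys \<pi>"
  shows "psum \<pi> i = psum \<pi> p"
  unfolding psum_def
  by (rule sum.mono_neutral_right) (use assms in \<open>auto simp: in_keys_iff not_le\<close>)

definition paths :: "('s \<Rightarrow>\<^sub>0 rat) set" where
  "paths = {\<pi>. keys \<pi> \<subseteq> S \<and> (\<forall>\<sigma>. lookup \<pi> \<sigma> \<ge> 0) \<and>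
     (\<forall>i\<le>N. of_nat (\<beta> i) * psum \<pi> i \<in> \<nat>)}"

lemma psum_nonneg: "\<pi> \<in> paths \<Longrightarrow> psum \<pi> i \<ge> 0"
  by (auto simp: psum_def paths_def intro: sum_nonneg)

text \<open>
  The integrality conditions at consecutive elements of the support are equivalent to one
  condition for each bond of \<open>S\<close>: between consecutive elements of the support the partial sums
  are constant, below and above the support they are \<open>0\<close> and the degree, and an integral multiple
  by the greatest common divisor of some bonds means an integral multiple by each of them.
\<close>

lemma ls_path_iff: "ls_path S b r \<pi> \<longleftrightarrow> \<pi> \<in> paths \<and> psum \<pi> 0 = of_nat r"
proof
  assume ls: "ls_path S b r \<pi>"
  then have keys: "keys \<pi> \<subseteq> S" and nonneg: "\<And>\<sigma>. lookup \<pi> \<sigma> \<ge> 0"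
    and cond: "\<And>\<tau> \<tau>'. succ_in (keys \<pi>) \<tau> \<tau>' \<Longrightarrow> of_nat (bond S b \<tau> \<tau>') *
          (\<Sum>\<sigma>\<in>{\<sigma> \<in> keys \<pi>. \<sigma> \<le> \<tau>}. lookup \<pi> \<sigma>) \<in> \<nat>"
    and total: "(\<Sum>\<sigma>\<in>keys \<pi>. lookup \<pi> \<sigma>) = of_nat r"
    by (auto simp: ls_path_def)
  have "{\<sigma> \<in> keys \<pi>. \<sigma> \<le> \<rho> 0} = keys \<pi>"
    using keys rho_top by blast
  then have p0: "psum \<pi> 0 = of_nat r"
    using psum_eq_sum_keys[OF keys, of 0] total by simp
  have "of_nat (\<beta> i) * psum \<pi> i \<in> \<nat>" if i: "i \<le> N" for i
  proof -
    let ?lo = "{j \<in> {i..N}. \<rho> j \<in> keys \<pi>}" and ?hi = "{j. j < i \<and> \<rho> j \<in> keys \<pi>}"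
    consider "?lo = {}" | "?hi = {}" | "?lo \<noteq> {}" "?hi \<noteq> {}" by blast
    then show ?thesis
    proof cases
      case 1
      then have "psum \<pi> i = 0"
        unfolding psum_def by (intro sum.neutral) (auto simp: in_keys_iff)
      then show ?thesis by simp
    next
      case 2
      then have "psum \<pi> 0 = psum \<pi> i" using i by (intro psum_const) auto
      then have "psum \<pi> i = of_nat r" using p0 by simp
      then show ?thesis by (simp flip: of_nat_mult)
    next
      case 3
      define p where "p = Min ?lo"
      define q where "q = Max ?hi"
      have fin: "finite ?lo" "finite ?hi" by auto
      have p: "p \<in> ?lo" "\<And>j. j \<in> ?lo \<Longrightarrow> p \<le> j"
        using Min_in[OF fin(1) 3(1)] Min_le[OF fin(1)] by (auto simp: p_def)
      have q: "q \<in> ?hi" "\<And>j. j \<in> ?hi \<Longrightarrow> j \<le> q"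
        using Max_in[OF fin(2) 3(2)] Max_ge[OF fin(2)] by (auto simp: q_def)
      have pq: "q < p" "p \<le> N" "q \<le> N" "i \<le> p" "q < i" using p(1) q(1) by auto
      have "succ_in (keys \<pi>) (\<rho> p) (\<rho> q)"
        unfolding succ_in_def
      proof (intro conjI notI)
        assume "\<exists>z\<in>keys \<pi>. \<rho> p < z \<and> z < \<rho> q"
        then obtain z where z: "z \<in> keys \<pi>" "\<rho> p < z" "z < \<rho> q" by blast
        then have "z \<in> S" using keys by blast
        then obtain j where j: "j \<le> N" "z = \<rho> j" by (rule rho_cases)
        then have "q < j" "j < p" using z pq by (auto simp: rho_less_iff)
        then show False using p(2)[of j] q(2)[of j] z(1) j by (cases "j < i") auto
      qed (use p(1) q(1) pq in \<open>auto simp: rho_less_iff\<close>)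
      from cond[OF this] have "of_nat (Gcd (\<beta> ` {q<..p})) * psum \<pi> p \<in> \<nat>"
        using bond_eq[OF pq(1,2)] psum_eq_sum_keys[OF keys pq(2)] by simp
      moreover have "Gcd (\<beta> ` {q<..p}) dvd \<beta> i"
        using pq by (intro Gcd_dvd) auto
      then obtain k where "\<beta> i = k * Gcd (\<beta> ` {q<..p})" by (auto simp: dvd_def mult.commute)
      moreover have "psum \<pi> i = psum \<pi> p"
      proof (rule psum_const[OF pq(4,2)])
        fix j assume "i \<le> j" "j < p"
        then show "\<rho> j \<notin> keys \<pi>" using p(2)[of j] pq(2) by auto
      qed
      ultimately show ?thesis
        by (simp add: mult.assoc Nats_mult)
    qed
  qed
  then show "\<pi> \<in> paths \<and> psum \<pi> 0 = of_nat r"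
    using keys nonneg p0 by (simp add: paths_def)
next
  assume *: "\<pi> \<in> paths \<and> psum \<pi> 0 = of_nat r"
  then have keys: "keys \<pi> \<subseteq> S" by (simp add: paths_def)
  have "{\<sigma> \<in> keys \<pi>. \<sigma> \<le> \<rho> 0} = keys \<pi>"
    using keys rho_top by blast
  then have total: "(\<Sum>\<sigma>\<in>keys \<pi>. lookup \<pi> \<sigma>) = of_nat r"
    using psum_eq_sum_keys[OF keys, of 0] * by simp
  have "of_nat (bond S b \<tau> \<tau>') *
      (\<Sum>\<sigma>\<in>{\<sigma> \<in> keys \<pi>. \<sigma> \<le> \<tau>}. lookup \<pi> \<sigma>) \<in> \<nat>"
    if s: "succ_in (keys \<pi>) \<tau> \<tau>'" for \<tau> \<tau>'
  proof -
    have "\<tau> \<in> S" "\<tau>' \<in> S" using s keys by (auto simp: succ_in_def)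
    then obtain p q where pq: "p \<le> N" "\<tau> = \<rho> p" "q \<le> N" "\<tau>' = \<rho> q" by (metis rho_cases)
    then have qp: "q < p" using s by (simp add: succ_in_def rho_less_iff)
    have "of_nat (Gcd (\<beta> ` {q<..p})) * psum \<pi> p \<in> \<nat>"
    proof (rule of_nat_Gcd_mult)
      show "psum \<pi> p \<ge> 0" using * psum_nonneg by blast
      fix n assume "n \<in> \<beta> ` {q<..p}"
      then obtain i where i: "q < i" "i \<le> p" "n = \<beta> i" by auto
      have "psum \<pi> i = psum \<pi> p"
      proof (rule psum_const)
        fix j assume j: "i \<le> j" "j < p"
        then have "\<rho> p < \<rho> j" "\<rho> j < \<rho> q" using pq i by (auto simp: rho_less_iff)
        then show "\<rho> j \<notin> keys \<pi>" using s pq by (auto simp: succ_in_def)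
      qed (use i pq in auto)
      moreover have "of_nat (\<beta> i) * psum \<pi> i \<in> \<nat>" using * i pq by (auto simp: paths_def)
      ultimately show "of_nat n * psum \<pi> p \<in> \<nat>" using i by simp
    qed
    then show ?thesis
      using bond_eq[OF qp pq(1)] psum_eq_sum_keys[OF keys pq(1)] pq by simp
  qed
  then show "ls_path S b r \<pi>"
    using * total by (auto simp: ls_path_def paths_def)
qed

definition coords :: "('s \<Rightarrow>\<^sub>0 rat) \<Rightarrow> (nat \<Rightarrow>\<^sub>0 nat)" where
  "coords \<pi> = (\<Sum>i\<le>N. single i (nat \<lfloor>of_nat (\<beta> i) * psum \<pi> i\<rfloor>))"

lemma lookup_coords:
  "lookup (coords \<pi>) i = (if i \<le> N then nat \<lfloor>of_nat (\<beta> i) * psum \<pi> i\<rfloor> else 0)"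
  by (simp add: coords_def lookup_sum lookup_single when_def sum.delta)

lemma of_nat_lookup_coords:
  assumes "\<pi> \<in> paths" "i \<le> N"
  shows "of_nat (lookup (coords \<pi>) i) = of_nat (\<beta> i) * psum \<pi> i"
proof -
  obtain k where "of_nat (\<beta> i) * psum \<pi> i = of_nat k"
    using assms by (auto simp: paths_def Nats_def)
  then show ?thesis using assms(2) by (simp add: lookup_coords)
qed

lemma paths_zero: "0 \<in> paths"
  by (simp add: paths_def psum_def)

lemma paths_add:
  assumes "\<pi> \<in> paths" "\<pi>' \<in> paths"
  shows "\<pi> + \<pi>' \<in> paths"
  using assms Poly_Mapping.keys_add[of \<pi> \<pi>']
  by (auto simp: paths_def lookup_add psum_add distrib_left intro: Nats_add)

lemma coords_zero: "coords 0 = 0"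
  by (simp add: coords_def psum_def)

lemma coords_add:
  assumes "\<pi> \<in> paths" "\<pi>' \<in> paths"
  shows "coords (\<pi> + \<pi>') = coords \<pi> + coords \<pi>'"
proof (rule poly_mapping_eqI)
  fix i
  show "lookup (coords (\<pi> + \<pi>')) i = lookup (coords \<pi> + coords \<pi>') i"
  proof (cases "i \<le> N")
    case True
    have "(of_nat (lookup (coords (\<pi> + \<pi>')) i) :: rat)
        = of_nat (lookup (coords \<pi> + coords \<pi>') i)"
      using of_nat_lookup_coords[OF assms(1) True] of_nat_lookup_coords[OF assms(2) True]
        of_nat_lookup_coords[OF paths_add[OF assms] True]
      by (simp add: lookup_add psum_add distrib_left)
    then show ?thesis by (simp only: of_nat_eq_iff)
  qed (simp add: lookup_add lookup_coords)
qed

lemma coords_inj: "inj_on coords paths"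
proof (rule inj_onI)
  fix \<pi> \<pi>' assume *: "\<pi> \<in> paths" "\<pi>' \<in> paths" "coords \<pi> = coords \<pi>'"
  have eq: "psum \<pi> i = psum \<pi>' i" for i
  proof (cases "i \<le> N")
    case True
    then show ?thesis
      using of_nat_lookup_coords[OF *(1) True] of_nat_lookup_coords[OF *(2) True] *(3) beta_pos[of i]
      by simp
  qed (simp add: psum_def)
  show "\<pi> = \<pi>'"
  proof (rule poly_mapping_eqI)
    fix \<sigma>
    show "lookup \<pi> \<sigma> = lookup \<pi>' \<sigma>"
    proof (cases "\<sigma> \<in> S")
      case True
      then obtain i where i: "i \<le> N" "\<sigma> = \<rho> i" by (rule rho_cases)
      then show ?thesis
        using psum_step[OF i(1), of \<pi>] psum_step[OF i(1), of \<pi>'] eq by simp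
    next
      case False
      then have "\<sigma> \<notin> keys \<pi>" "\<sigma> \<notin> keys \<pi>'"
        using *(1,2) by (auto simp: paths_def)
      then show ?thesis by (simp add: in_keys_iff)
    qed
  qed
qed

lemma coords_mem:
  assumes "\<pi> \<in> paths"
  shows "coords \<pi> \<in> M"
proof (rule M_I)
  fix i assume i: "i < N"
  let ?t = "lookup (coords \<pi>)"
  have "psum \<pi> (Suc i) \<le> psum \<pi> i"
    using psum_step[of i \<pi>] i assms by (simp add: paths_def)
  then have "of_nat (\<beta> (Suc i)) * of_nat (\<beta> i) * psum \<pi> (Suc i) \<le> of_nat (\<beta> (Suc i)) * of_nat (\<beta> i) * psum \<pi> i"
    by (intro mult_left_mono) auto
  then have "(of_nat (?t (Suc i) * \<beta> i) :: rat) \<le> of_nat (?t i * \<beta> (Suc i))"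
    using of_nat_lookup_coords[OF assms, of i] of_nat_lookup_coords[OF assms, of "Suc i"] i
    by (simp add: mult_ac)
  then show "?t (Suc i) * \<beta> i \<le> ?t i * \<beta> (Suc i)"
    by (simp only: of_nat_le_iff)
qed (simp add: lookup_coords)

lemma coords_image: "coords ` paths = M"
proof (intro equalityI subsetI)
  fix t assume t: "t \<in> M"
  let ?t = "lookup t"
  define d where "d i = (of_nat (?t i) / of_nat (\<beta> i) :: rat)" for i
  define \<pi> where "\<pi> = (\<Sum>i\<le>N. single (\<rho> i) (d i - d (Suc i)))"
  have lookup: "lookup \<pi> (\<rho> i) = d i - d (Suc i)" if "i \<le> N" for i
  proof -
    have "lookup \<pi> (\<rho> i) = (\<Sum>j\<le>N. if j = i then d i - d (Suc i) else 0)"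
      unfolding \<pi>_def lookup_sum using that
      by (intro sum.cong refl) (auto simp: lookup_single when_def rho_eq_iff)
    then show ?thesis using that by simp
  qed
  have keys: "keys \<pi> \<subseteq> S"
    unfolding \<pi>_def by (rule order.trans[OF keys_sum_subset]) (auto intro: rho_mem split: if_splits)
  have psum: "psum \<pi> i = d i" if "i \<le> N" for i
    using that
  proof (induction rule: inc_induct)
    case base
    have "d (Suc N) = 0" using M_lookup_beyond[OF t] by (simp add: d_def)
    then show ?case using psum_step[of N \<pi>] lookup[of N] by (simp add: psum_def)
  next
    case (step i)
    then show ?case using psum_step[of i \<pi>] lookup[of i] by simp
  qed
  have "d (Suc i) \<le> d i" for i
  proof -
    have "(of_nat (?t (Suc i) * \<beta> i) :: rat) \<le> of_nat (?t i * \<beta> (Suc i))"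
      using M_step[OF t, of i] by (simp only: of_nat_le_iff)
    then show ?thesis
      using beta_pos[of i] beta_pos[of "Suc i"] by (simp add: d_def field_simps)
  qed
  then have "lookup \<pi> \<sigma> \<ge> 0" for \<sigma>
  proof (cases "\<sigma> \<in> keys \<pi>")
    case True
    then obtain i where "i \<le> N" "\<sigma> = \<rho> i" using keys by (blast elim: rho_cases)
    then show ?thesis using lookup \<open>\<And>i. d (Suc i) \<le> d i\<close> by simp
  qed (simp add: in_keys_iff)
  moreover have bt: "of_nat (\<beta> i) * psum \<pi> i = of_nat (?t i)" if "i \<le> N" for i
    using psum[OF that] beta_pos[of i] by (simp add: d_def)
  ultimately have \<pi>: "\<pi> \<in> paths"
    using keys by (simp add: paths_def)
  have "coords \<pi> = t"
  proof (rule poly_mapping_eqI)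
    fix i
    show "lookup (coords \<pi>) i = ?t i"
      using bt[of i] M_lookup_beyond[OF t, of i] by (simp add: lookup_coords)
  qed
  then show "t \<in> coords ` paths" using \<pi> by blast
qed (auto intro: coords_mem)

lemma coords_degree: "\<pi> \<in> paths \<Longrightarrow> ls_path S b d \<pi> \<longleftrightarrow> coords \<pi> \<in> Mdeg d"
proof -
  assume \<pi>: "\<pi> \<in> paths"
  have "psum \<pi> 0 = of_nat (lookup (coords \<pi>) 0)"
    using of_nat_lookup_coords[OF \<pi>, of 0] by (simp add: beta_0)
  then show ?thesis
    using \<pi> coords_mem by (auto simp: ls_path_iff Mdeg_def)
qed

lemma paths_eq: "{\<pi>. \<exists>r. ls_path S b r \<pi>} = paths"
  using coords_degree coords_mem by (auto simp: ls_path_iff Mdeg_def)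

lemma coords_Mdeg: "coords ` {\<pi>. ls_path S b d \<pi>} = Mdeg d"
proof (intro equalityI subsetI)
  fix t assume t: "t \<in> Mdeg d"
  then have "t \<in> coords ` paths"
    unfolding coords_image using Mdeg_sub by blast
  then obtain \<pi> where "\<pi> \<in> paths" "coords \<pi> = t" by blast
  then show "t \<in> coords ` {\<pi>. ls_path S b d \<pi>}" using t coords_degree by blast
qed (auto simp: ls_path_iff coords_degree[symmetric])

lemma ls_algebra_eq: "ls_algebra S b =
  (set_ring (monoid_algebra paths) :: (('s \<Rightarrow>\<^sub>0 rat) \<Rightarrow>\<^sub>0 'k::field) ring)"
  by (simp add: ls_algebra_def paths_eq monoid_algebra_def)

definition to_flag_algebra :: "(('s \<Rightarrow>\<^sub>0 rat) \<Rightarrow>\<^sub>0 'k::field) \<Rightarrow> ((nat \<Rightarrow>\<^sub>0 nat) \<Rightarrow>\<^sub>0 'k)" where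
  "to_flag_algebra = relabel coords"

lemma to_flag_algebra_iso: "to_flag_algebra \<in> ring_iso (ls_algebra S b)
  (set_ring (monoid_algebra M) :: ((nat \<Rightarrow>\<^sub>0 nat) \<Rightarrow>\<^sub>0 'k::field) ring)"
  unfolding ls_algebra_eq to_flag_algebra_def coords_image[symmetric]
  by (rule relabel_iso[OF coords_inj paths_zero paths_add coords_zero coords_add])

lemma ls_algebra_cring: "cring (ls_algebra S b :: (('s \<Rightarrow>\<^sub>0 rat) \<Rightarrow>\<^sub>0 'k::field) ring)"
  unfolding ls_algebra_eq
proof (rule cring_of_subset)
  fix f g :: "('s \<Rightarrow>\<^sub>0 rat) \<Rightarrow>\<^sub>0 'k"
  assume fg: "f \<in> monoid_algebra paths" "g \<in> monoid_algebra paths"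
  show "f + g \<in> monoid_algebra paths"
    using fg Poly_Mapping.keys_add[of f g] by (auto simp: monoid_algebra_def)
  show "f * g \<in> monoid_algebra paths"
    unfolding monoid_algebra_def
  proof (intro CollectI subsetI)
    fix w assume "w \<in> keys (f * g)"
    then obtain u v where "w = u + v" "u \<in> keys f" "v \<in> keys g"
      using keys_mult[of f g] by blast
    moreover from this have "u \<in> paths" "v \<in> paths" using fg by (auto simp: monoid_algebra_def)
    ultimately show "w \<in> paths" using paths_add by simp
  qed
qed (auto simp: monoid_algebra_def paths_zero in_keys_iff)

text \<open>An integral fraction is carried to the monoid algebra of \<open>M\<close>, where the division is possible.\<close>

theorem normal_domain_ls_algebra: "normal_domain (ls_algebra S b :: (('s \<Rightarrow>\<^sub>0 rat) \<Rightarrow>\<^sub>0 'k::field) ring)"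
proof -
  let ?A = "ls_algebra S b :: (('s \<Rightarrow>\<^sub>0 rat) \<Rightarrow>\<^sub>0 'k) ring"
  have bij: "bij_betw to_flag_algebra (carrier ?A) (monoid_algebra M)"
    using to_flag_algebra_iso[where ?'k='k] by (simp add: ring_iso_def)
  interpret field_embedding ?A "\<lambda>x. Fract (to_flag_algebra x) 1"
    using to_flag_algebra_iso[where ?'k='k] bij
    by (intro field_embedding_Fract[OF ls_algebra_cring]) (auto simp: ring_iso_def bij_betw_def)
  have img: "(\<lambda>x. Fract (to_flag_algebra x) 1) ` carrier ?A = (\<lambda>f. Fract f 1) ` monoid_algebra M"
    unfolding bij_betw_imp_surj_on[OF bij, symmetric] image_image by (rule refl)
  show ?thesis
  proof (rule normal_domainI)
    fix f g assume fg: "f \<in> carrier ?A" "g \<in> carrier ?A" "Fract (to_flag_algebra g) 1 \<noteq> 0"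
      and int: "integral_elem ((\<lambda>x. Fract (to_flag_algebra x) 1) ` carrier ?A) (Fract (to_flag_algebra f) 1 / Fract (to_flag_algebra g) 1)"
    have mem: "to_flag_algebra f \<in> monoid_algebra M" "to_flag_algebra g \<in> monoid_algebra M"
      using bij_betwE[OF bij] fg(1,2) by auto
    have g0: "to_flag_algebra g \<noteq> 0" using fg(3) by (auto simp: fract_collapse)
    have "integral_elem ((\<lambda>f. Fract f 1) ` monoid_algebra M) (Fract (to_flag_algebra f) (to_flag_algebra g))"
      using int unfolding img by simp
    then obtain h where h: "h \<in> monoid_algebra M" "to_flag_algebra f = to_flag_algebra g * h"
      using integrally_closed[OF mem g0] by blast
    then have "Fract (to_flag_algebra f) 1 / Fract (to_flag_algebra g) 1 = Fract h 1"
      using g0 by (simp add: eq_fract)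
    then show "Fract (to_flag_algebra f) 1 / Fract (to_flag_algebra g) 1 \<in> (\<lambda>x. Fract (to_flag_algebra x) 1) ` carrier ?A"
      unfolding img using h(1) by blast
  qed
qed

lemma to_flag_algebra_component: "to_flag_algebra ` ls_component S b d = monoid_algebra (Mdeg d)"
  unfolding to_flag_algebra_def ls_component_def coords_Mdeg[symmetric] relabel_image[symmetric]
  by (simp add: monoid_algebra_def)

lemma to_flag_algebra_scalar: "to_flag_algebra (ls_scalar c) = single 0 c"
  unfolding to_flag_algebra_def ls_scalar_def relabel_def semiring_map.mon_eval_single[OF semiring_map_single]
  by (simp add: coords_zero mult_single)

theorem coordinate_ring_ls_algebra:
  assumes "flag_variety N \<beta> m e"
  shows "is_homogeneous_coordinate_ring (ls_algebra S b) (ls_component S b) ls_scalar m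
    (flag_variety.face_variety m e N :: 'k::field alg_closure ppoint set)"
proof -
  interpret V: flag_variety N \<beta> m e by (rule assms)
  let ?V = "V.face_variety N :: 'k alg_closure ppoint set"
  let ?A = "ls_algebra S b :: (('s \<Rightarrow>\<^sub>0 rat) \<Rightarrow>\<^sub>0 'k) ring"
  define U where "U = inv_into (carrier ?A) to_flag_algebra"
  have T: "to_flag_algebra \<in> ring_iso ?A V.flag_algebra"
    using to_flag_algebra_iso by (simp add: V.flag_algebra_def)
  have U: "U \<in> ring_iso V.flag_algebra ?A"
    unfolding U_def by (rule ring_iso_set_sym[OF cring.axioms(1)[OF ls_algebra_cring] T])
  have inj: "inj_on to_flag_algebra (carrier ?A)"
    using T by (simp add: ring_iso_def bij_betw_def)
  have U_T: "U (to_flag_algebra f) = f" if "f \<in> carrier ?A" for f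
    unfolding U_def using inv_into_f_f[OF inj that] .
  define h where "h = U \<circ> V.theta_quot"
  have h: "h \<in> ring_iso (coordinate_ring to_ac m ?V) ?A"
    unfolding h_def by (rule ring_iso_set_trans[OF V.theta_quot_iso[OF field_map_to_ac] U])
  have h_res: "h (residue_class to_ac m ?V p) = U (V.theta N p)" if "p \<in> carrier (mpoly_ring m)" for p
    using that by (simp add: h_def V.theta_quot_residue_class[OF field_map_to_ac])
  have sub: "ls_component S b d \<subseteq> carrier ?A" for d
    by (auto simp: ls_component_def ls_algebra_def)
  show ?thesis
    unfolding is_homogeneous_coordinate_ring_def
  proof (intro bexI[OF _ h] conjI allI)
    fix c :: 'k
    have "single 0 c \<in> carrier (mpoly_ring m :: 'k mpoly ring)"
      by (simp add: mpoly_ring_def)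
    moreover have "ls_scalar c \<in> carrier ?A"
      using paths_zero by (simp add: ls_scalar_def ls_algebra_eq monoid_algebra_def)
    ultimately show "h (residue_class to_ac m ?V (single 0 c)) = ls_scalar c"
      using h_res[of "single 0 c"] U_T[of "ls_scalar c"] by (simp add: V.theta_single to_flag_algebra_scalar)
  next
    fix d
    have "h ` residue_class to_ac m ?V ` {p. form m d p} = U ` V.theta N ` {p. form m d p}"
      unfolding image_image using h_res form_mpoly by (intro image_cong) auto
    also have "V.theta N ` {p :: 'k mpoly. form m d p} = monoid_algebra (Mdeg d)"
    proof (intro equalityI subsetI)
      fix f :: "'k mpoly" assume f: "f \<in> monoid_algebra (Mdeg d)"
      then have "f \<in> monoid_algebra M" using V.algebra_Mdeg_sub by blast
      then show "f \<in> V.theta N ` {p. form m d p}"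
        using V.theta_surj f by (metis image_eqI mem_Collect_eq)
    qed (auto intro: V.theta_form_mem)
    also have "U ` monoid_algebra (Mdeg d) = (ls_component S b d :: (('s \<Rightarrow>\<^sub>0 rat) \<Rightarrow>\<^sub>0 'k) set)"
    proof -
      have "(\<lambda>f. U (to_flag_algebra f)) ` ls_component S b d = (\<lambda>f. f) ` (ls_component S b d :: (('s \<Rightarrow>\<^sub>0 rat) \<Rightarrow>\<^sub>0 'k) set)"
        by (intro image_cong refl U_T subsetD[OF sub])
      then show ?thesis
        unfolding to_flag_algebra_component[symmetric] image_image by simp
    qed
    finally show "h ` residue_class to_ac m ?V ` {p. form m d p} = ls_component S b d" .
  qed
qed

end

theorem proposition0p5p1:
  fixes S :: "'s::linorder set" and b :: "'s \<Rightarrow> 's \<Rightarrow> nat" and N :: nat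
    and A :: "(('s \<Rightarrow>\<^sub>0 rat) \<Rightarrow>\<^sub>0 'k::field) ring"
  assumes "finite S" and "card S = N + 1" and "bonds S b"
    and "A = ls_algebra S b"
  shows "normal_domain A \<and>
    (\<exists>m (V :: 'k alg_closure ppoint set).
       projective_toric_variety m V \<and> zariski_dim m V = enat N \<and> normal_variety m V \<and>
       is_homogeneous_coordinate_ring A (ls_component S b) ls_scalar m V)"
proof -
  interpret bonded_chain S b N
    by unfold_locales (use assms in auto)
  have "finite (Mdeg 1)" "Mdeg 1 \<noteq> {}"
    using Mdeg_card(1) vertex_mem[of 0] by auto
  then have "card (Mdeg 1) > 0" by (simp add: card_gt_0_iff)
  then obtain m where m: "card (Mdeg 1) = Suc m" by (metis gr0_conv_Suc)
  obtain e where "bij_betw e {0..<card (Mdeg 1)} (Mdeg 1)"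
    using ex_bij_betw_nat_finite[OF Mdeg_card(1)] by blast
  then have "bij_betw e {..m} (Mdeg 1)"
    unfolding m by (simp add: atLeast0LessThan lessThan_Suc_atMost)
  then interpret V: flag_variety N \<beta> m e
    by unfold_locales
  show ?thesis
    unfolding assms(4)
    by (intro conjI exI[of _ m] exI[of _ "V.face_variety N"] normal_domain_ls_algebra
        V.projective_toric_face_variety V.zariski_dim_face_variety V.normal_variety_face_variety
        coordinate_ring_ls_algebra V.flag_variety_axioms)
qed

end
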